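(* Let $f$ be a rational map of degree $3$ defined over the field $\mathbb{C}((t))$ of formal Laurent series which does not have potential good reduction. Then $f$ admits a repelling rigid periodic cycle of period at most $3$.
   Context: $\mathbb{C}((t))$ is endowed with the $t$-adic norm $|\sum a_nt^n|=e^{-\min\{n:\,a_n\neq0\}}$, which extends uniquely to its algebraic closure $\mathbb{C}\langle\langle t\rangle\rangle$ (Puiseux series) and to the completion $\mathbb{L}$ of the latter, an algebraically closed complete field with residue field $\mathbb{C}$. Rigid points of the Berkovich projective line $\mathbb{P}^{1,\mathrm{an}}_{\mathbb{L}}$ are the points of $\mathbb{P}^1(\mathbb{L})$. A rigid point $z$ with $f^n(z)=z$ is automatically defined over $\mathbb{C}\langle\langle t\rangle\rangle$; a rigid cycle of period $n$ is repelling if the multiplier $\mu$ of $f^n$ at one (hence any) of its points satisfies $|\mu|>1$. A rational map $f$ of degree $d$ over $\mathbb{L}$ has good reduction if, writing $f=[P:Q]$ with the maximum of the norms of the coefficients of $P$ and $Q$ equal to $1$, the reduction $[\tilde P:\tilde Q]$ is a rational map of degree $d$ over the residue field $\mathbb{C}$ (equivalently the Gauss point is totally invariant). It has potential good reduction if it is conjugate by an element of $\mathrm{PGL}(2,\mathbb{L})$ to a map having good reduction. *)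

theory Defs
  imports "HOL-Analysis.Analysis" "HOL-Algebra.Algebraic_Closure_Type"
begin

subsection \<open>The field \<open>L\<close>: completed algebraic closure of the formal Laurent series\<close>

definition tadic_norm :: "complex fls \<Rightarrow> real" where
  "tadic_norm a = (if a = 0 then 0 else exp (- real_of_int (fls_subdegree a)))"

locale nonarchimedean_field =
  fixes nrm :: "'a::field \<Rightarrow> real"
  assumes nrm_nonneg: "0 \<le> nrm x"
    and nrm_eq_0_iff: "nrm x = 0 \<longleftrightarrow> x = 0"
    and nrm_mult: "nrm (x * y) = nrm x * nrm y"
    and nrm_add_le: "nrm (x + y) \<le> max (nrm x) (nrm y)"
begin

lemma nrm_1: "nrm 1 = 1"
proof -
  have "nrm 1 * nrm 1 = nrm 1 * 1"
    using nrm_mult[of 1 1] by simp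
  then show ?thesis
    using nrm_eq_0_iff[of 1] by (simp only: mult_cancel_left) simp
qed

lemma nrm_minus: "nrm (- x) = nrm x"
proof -
  have "nrm (-1) * nrm (-1) = 1"
    using nrm_mult[of "-1" "-1"] nrm_1 by simp
  then have "(nrm (-1))\<^sup>2 = 1"
    by (simp add: power2_eq_square)
  then have "nrm (-1) = 1"
    using nrm_nonneg[of "-1"] by (simp add: power2_eq_1_iff)
  then show ?thesis
    using nrm_mult[of "-1" x] by simp
qed

definition ndist :: "'a \<Rightarrow> 'a \<Rightarrow> real" where
  "ndist x y = nrm (x - y)"

sublocale Metric_space UNIV ndist
proof
  fix x y z :: 'a
  show "0 \<le> ndist x y"
    by (simp add: ndist_def nrm_nonneg)
  show "ndist x y = ndist y x"
    using nrm_minus[of "x - y"] by (simp add: ndist_def)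
  show "ndist x y = 0 \<longleftrightarrow> x = y"
    by (simp add: ndist_def nrm_eq_0_iff)
  have "ndist x z \<le> max (ndist x y) (ndist y z)"
    using nrm_add_le[of "x - y" "y - z"] by (simp add: ndist_def)
  then show "ndist x z \<le> ndist x y + ndist y z"
    using nrm_nonneg[of "x - y"] nrm_nonneg[of "y - z"] by (simp add: ndist_def)
qed

end

text \<open>
  \<open>'a\<close>, with norm \<open>nrm\<close>, is the completion of the algebraic closure of the field of complex
  Laurent series, \<open>emb\<close> being the canonical map. The norm of the algebraic closure is
  \<open>\<lambda>x. nrm (emb x)\<close>; no separate datum is needed, as the \<open>t\<close>-adic norm extends uniquely.
\<close>

locale completed_alg_closure = nonarchimedean_field nrm
  for nrm :: "'a::field \<Rightarrow> real" +
  fixes emb :: "complex fls alg_closure \<Rightarrow> 'a"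
  assumes emb_1: "emb 1 = 1"
    and emb_add: "emb (x + y) = emb x + emb y"
    and emb_mult: "emb (x * y) = emb x * emb y"
    and nrm_emb: "nrm (emb (to_ac a)) = tadic_norm a"
    and dense: "mtopology closure_of range emb = UNIV"
    and complete: "mcomplete"

subsection \<open>The projective line and rational maps\<close>

datatype 'a proj_line = Affine 'a | Infinity

text \<open>
  A pair \<open>(P, Q)\<close> stands for the rational map \<open>[P : Q]\<close>, that is \<open>z \<mapsto> P z / Q z\<close>, written in lowest
  terms (see \<open>rational_map\<close>); its homogeneous lift is obtained by homogenising both \<open>P\<close> and \<open>Q\<close>
  to the degree \<open>rat_degree (P, Q)\<close>.
\<close>

type_synonym 'a ratmap = "'a poly \<times> 'a poly"

definition rat_degree :: "'a::field ratmap \<Rightarrow> nat" where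
  "rat_degree F = max (Polynomial.degree (fst F)) (Polynomial.degree (snd F))"

definition rational_map :: "nat \<Rightarrow> 'a::field ratmap \<Rightarrow> bool" where
  "rational_map d F \<longleftrightarrow> coprime (fst F) (snd F) \<and> rat_degree F = d"

definition map_ratmap :: "('a::field \<Rightarrow> 'b::field) \<Rightarrow> 'a ratmap \<Rightarrow> 'b ratmap" where
  "map_ratmap h F = (map_poly h (fst F), map_poly h (snd F))"

abbreviation base_change ::
  "(complex fls alg_closure \<Rightarrow> 'a::field) \<Rightarrow> complex fls ratmap \<Rightarrow> 'a ratmap" where
  "base_change emb f \<equiv> map_ratmap (\<lambda>a. emb (to_ac a)) f"

definition proj_point :: "'a::field \<Rightarrow> 'a \<Rightarrow> 'a proj_line" where
  "proj_point x y = (if y = 0 then Infinity else Affine (x / y))"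

fun rat_apply :: "'a::field ratmap \<Rightarrow> 'a proj_line \<Rightarrow> 'a proj_line" where
  "rat_apply F (Affine z) = proj_point (poly (fst F) z) (poly (snd F) z)"
| "rat_apply F Infinity =
    proj_point (poly.coeff (fst F) (rat_degree F)) (poly.coeff (snd F) (rat_degree F))"

text \<open>The degree \<open>d\<close> homogenisation of \<open>P\<close>, evaluated at \<open>(R, S)\<close>.\<close>

definition homog_subst :: "nat \<Rightarrow> 'a::field poly \<Rightarrow> 'a poly \<Rightarrow> 'a poly \<Rightarrow> 'a poly" where
  "homog_subst d P R S = (\<Sum>i\<le>d. Polynomial.smult (poly.coeff P i) (R ^ i * S ^ (d - i)))"

definition rat_comp :: "'a::field ratmap \<Rightarrow> 'a ratmap \<Rightarrow> 'a ratmap" where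
  "rat_comp F G =
    (homog_subst (rat_degree F) (fst F) (fst G) (snd G),
     homog_subst (rat_degree F) (snd F) (fst G) (snd G))"

primrec rat_iter :: "nat \<Rightarrow> 'a::field ratmap \<Rightarrow> 'a ratmap" where
  "rat_iter 0 F = ([:0, 1:], 1)"
| "rat_iter (Suc n) F = rat_comp F (rat_iter n F)"

text \<open>The Moebius map \<open>z \<mapsto> (a * z + b) / (c * z + d)\<close>, and conjugation of \<open>F\<close> by it.\<close>

definition mobius :: "'a::field \<Rightarrow> 'a \<Rightarrow> 'a \<Rightarrow> 'a \<Rightarrow> 'a ratmap" where
  "mobius a b c d = ([:b, a:], [:d, c:])"

definition mobius_conj :: "'a::field \<Rightarrow> 'a \<Rightarrow> 'a \<Rightarrow> 'a \<Rightarrow> 'a ratmap \<Rightarrow> 'a ratmap" where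
  "mobius_conj a b c d F =
    rat_comp (mobius a b c d) (rat_comp F (mobius d (- b) (- c) a))"

subsection \<open>Good reduction\<close>

definition coeff_norm :: "('a::field \<Rightarrow> real) \<Rightarrow> 'a ratmap \<Rightarrow> real" where
  "coeff_norm nrm F = Max (nrm ` (set (coeffs (fst F)) \<union> set (coeffs (snd F))))"

text \<open>
  The residue field is identified with the complex numbers: the residue class of \<open>x\<close>, where
  \<open>nrm x \<le> 1\<close>, is the class of a unique constant.
\<close>

definition residue_class ::
  "('a::field \<Rightarrow> real) \<Rightarrow> (complex fls alg_closure \<Rightarrow> 'a) \<Rightarrow> 'a \<Rightarrow> complex" where
  "residue_class nrm emb x = (THE c. nrm (x - emb (to_ac (fls_const c))) < 1)"

text \<open>The map \<open>F\<close> is presented by a pair that is unique up to a scalar, here \<open>c\<close>.\<close>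

definition good_reduction ::
  "('a::field \<Rightarrow> real) \<Rightarrow> (complex fls alg_closure \<Rightarrow> 'a) \<Rightarrow> 'a ratmap \<Rightarrow> bool" where
  "good_reduction nrm emb F \<longleftrightarrow>
    (\<exists>c G. c \<noteq> 0 \<and> G = (Polynomial.smult c (fst F), Polynomial.smult c (snd F)) \<and>
       coeff_norm nrm G = 1 \<and>
       rational_map (rat_degree F) (map_ratmap (residue_class nrm emb) G))"

definition potential_good_reduction ::
  "('a::field \<Rightarrow> real) \<Rightarrow> (complex fls alg_closure \<Rightarrow> 'a) \<Rightarrow> 'a ratmap \<Rightarrow> bool" where
  "potential_good_reduction nrm emb F \<longleftrightarrow>
    (\<exists>a b c d. a * d - b * c \<noteq> 0 \<and> good_reduction nrm emb (mobius_conj a b c d F))"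

subsection \<open>Rigid periodic cycles\<close>

definition rigid_cycle :: "'a::field ratmap \<Rightarrow> nat \<Rightarrow> 'a proj_line set \<Rightarrow> bool" where
  "rigid_cycle F n C \<longleftrightarrow> n > 0 \<and> card C = n \<and>
    (\<exists>z. (rat_apply F ^^ n) z = z \<and> C = (\<lambda>k. (rat_apply F ^^ k) z) ` {..<n})"

text \<open>
  The derivative of \<open>F\<close> at a fixed point; the point at infinity is first moved to \<open>0\<close> by
  \<open>z \<mapsto> 1 / z\<close>.
\<close>

definition affine_deriv :: "'a::field ratmap \<Rightarrow> 'a \<Rightarrow> 'a" where
  "affine_deriv F z =
    (poly (pderiv (fst F)) z * poly (snd F) z - poly (fst F) z * poly (pderiv (snd F)) z)
      / (poly (snd F) z)\<^sup>2"

fun multiplier :: "'a::field ratmap \<Rightarrow> 'a proj_line \<Rightarrow> 'a" where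
  "multiplier F (Affine z) = affine_deriv F z"
| "multiplier F Infinity = affine_deriv (mobius_conj 0 1 1 0 F) 0"

definition repelling_cycle ::
  "('a::field \<Rightarrow> real) \<Rightarrow> 'a ratmap \<Rightarrow> nat \<Rightarrow> 'a proj_line set \<Rightarrow> bool" where
  "repelling_cycle nrm F n C \<longleftrightarrow>
    rigid_cycle F n C \<and> (\<exists>z\<in>C. nrm (multiplier (rat_iter n F) z) > 1)"

end

theory Submission
  imports Defs
begin

text \<open>
  The field \<open>L\<close> is algebraically closed, so everything can be computed over \<open>L\<close>. Attach to
  \<open>f = P / Q\<close> the quartic form \<open>F\<close> of its fixed points and a quadratic form \<open>h\<close>; conjugation acts
  linearly on the pair, and minimising the larger of their norms gives a model of \<open>f\<close> that is
  semistable in the sense of geometric invariant theory. If the reduction of this model has no hole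
  (common zero of the reduced numerator and denominator), then \<open>f\<close> has potential good reduction.

  A hole at a simple zero of the reduction of \<open>F\<close> comes from a repelling fixed point. Otherwise
  semistability shows that, after a slight zoom into the hole, the reduction of \<open>[P : Q]\<close> is
  \<open>[p z\<^sup>2 : q z]\<close>. If \<open>p\<close> and \<open>q\<close> are nonzero, \<open>f\<close> maps the residue discs of the holes \<open>0\<close> and
  \<open>\<infinity>\<close> over each other injectively, which gives a repelling 2-cycle. If one of them vanishes, then
  \<open>f\<close> is conjugate to \<open>(z - w\<^sub>1) (z - w\<^sub>2) (z - w\<^sub>3) / (z (1 + q z))\<close> with \<open>\<bar>w\<^sub>i\<bar> < 1\<close> and \<open>\<bar>q\<bar> \<le> 1\<close>,
  a singular perturbation of the squaring map. It has a repelling 3-cycle \<open>y \<mapsto> w \<mapsto> x \<mapsto> y\<close>, with \<open>w\<close>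
  near one of the \<open>w\<^sub>i\<close>, with \<open>x\<close> near the pole \<open>0\<close>, and with \<open>y\<close> near a square root of \<open>w\<close>. The
  choice of the square root is used to keep the cycle away from the critical points.
\<close>

text \<open>Read \<open>(homP, homQ)\<close> as a vector field on the plane. Then \<open>F\<close>
  is its component across the radial direction and \<open>h\<close> is its divergence, and both
  recover the field: with the homogeneous forms, 4 P = x h - F_y and 4 Q = y h + F_x, where 4 is a
  unit.

  The value group of \<open>L\<close> is dense, so the existence of a minimum is not automatic. No
  minimum is taken: coordinates are written down in which semistability can be tested, either from
  fixed points placed at 0, 1 and infinity or, where the fixed points cluster, from the centre of
  the roots of \<open>h\<close>.

  The 3-cycle has to be found quantitatively, because the map contracts at \<open>y\<close>. With d
  and e the other preimages of \<open>x\<close>, the product of the three derivatives has norm |w -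
  d| |w - e| / |x|, which exceeds 1 only if \<open>w\<close> is well separated from d and e. Where
  the \<open>w\<^sub>i\<close> cluster, this can fail for one square root, and then it holds for the
  other, since the two resulting points \<open>x\<close> are as far apart as their size permits.
  Integers being units (residue characteristic 0) is used throughout, notably for 2 and 3.\<close>

lemmas expand_simps = algebra_simps power2_eq_square power3_eq_cube power4_eq_xxxx

subsection \<open>Roots of polynomials over a valued field\<close>

context nonarchimedean_field
begin

lemma nrm_0 [simp]: "nrm 0 = 0"
  using nrm_eq_0_iff by blast

lemma nrm_one [simp]: "nrm 1 = 1"
  by (rule nrm_1)

lemma nrm_uminus [simp]: "nrm (- x) = nrm x"
  by (rule nrm_minus)

lemma nrm_commute: "nrm (x - y) = nrm (y - x)"
  using nrm_minus[of "x - y"] by simp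

lemma nrm_pos_iff: "0 < nrm x \<longleftrightarrow> x \<noteq> 0"
  using nrm_nonneg[of x] nrm_eq_0_iff[of x] by linarith

lemma nrm_power: "nrm (x ^ n) = nrm x ^ n"
  by (induction n) (simp_all add: nrm_mult)

lemma nrm_inverse: "nrm (inverse x) = inverse (nrm x)"
proof (cases "x = 0")
  case False
  then have "nrm x * nrm (inverse x) = 1"
    by (simp flip: nrm_mult)
  then show ?thesis
    by (metis inverse_unique)
qed simp

lemma nrm_divide: "nrm (x / y) = nrm x / nrm y"
  by (simp add: divide_inverse nrm_mult nrm_inverse)

lemma nrm_add_leI: "nrm x \<le> b \<Longrightarrow> nrm y \<le> b \<Longrightarrow> nrm (x + y) \<le> b"
  using nrm_add_le[of x y] by linarith

lemma nrm_diff_leI: "nrm x \<le> b \<Longrightarrow> nrm y \<le> b \<Longrightarrow> nrm (x - y) \<le> b"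
  using nrm_add_le[of x "- y"] by simp

lemma nrm_add_lessI: "nrm x < b \<Longrightarrow> nrm y < b \<Longrightarrow> nrm (x + y) < b"
  using nrm_add_le[of x y] by linarith

lemma nrm_diff_lessI: "nrm x < b \<Longrightarrow> nrm y < b \<Longrightarrow> nrm (x - y) < b"
  using nrm_add_le[of x "- y"] by simp

lemma nrm_add_eq: "nrm x < nrm y \<Longrightarrow> nrm (x + y) = nrm y"
  using nrm_add_le[of x y] nrm_add_le[of "x + y" "- x"] by simp

lemma nrm_add_eq2: "nrm y < nrm x \<Longrightarrow> nrm (x + y) = nrm x"
  using nrm_add_eq[of y x] by (simp add: add.commute)

lemma nrm_diff_eq: "nrm x < nrm y \<Longrightarrow> nrm (x - y) = nrm y"
  using nrm_add_eq[of x "- y"] by simp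

lemma nrm_diff_eq2: "nrm y < nrm x \<Longrightarrow> nrm (x - y) = nrm x"
  using nrm_add_eq2[of "- y" x] by simp

lemma nrm_eqI: "nrm (x - y) < nrm y \<Longrightarrow> nrm x = nrm y"
  using nrm_add_eq[of "x - y" y] by simp

lemma nrm_ultra: "nrm (x - z) \<le> max (nrm (x - y)) (nrm (y - z))"
  using nrm_add_le[of "x - y" "y - z"] by simp

lemma nrm_larger: "\<exists>m. (m = x \<or> m = y) \<and> nrm x \<le> nrm m \<and> nrm y \<le> nrm m"
  by (cases "nrm x \<le> nrm y") auto

lemma nrm_mult_le1: "nrm x \<le> 1 \<Longrightarrow> nrm y \<le> 1 \<Longrightarrow> nrm (x * y) \<le> 1"
  by (simp add: nrm_mult mult_le_one nrm_nonneg)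

lemma nrm_mult_less1: "nrm x < 1 \<Longrightarrow> nrm y \<le> 1 \<Longrightarrow> nrm (x * y) < 1"
  using mult_left_le[OF _ nrm_nonneg, of "nrm y" x] by (simp add: nrm_mult)

lemma nrm_mult_less1': "nrm x \<le> 1 \<Longrightarrow> nrm y < 1 \<Longrightarrow> nrm (x * y) < 1"
  using nrm_mult_less1[of y x] by (simp add: mult.commute)

lemma nrm_power_le1: "nrm x \<le> 1 \<Longrightarrow> nrm (x ^ n) \<le> 1"
  by (simp add: nrm_power power_le_one nrm_nonneg)

lemma nrm_power_less1: "nrm x < 1 \<Longrightarrow> 0 < n \<Longrightarrow> nrm (x ^ n) < 1"
  by (simp add: nrm_power power_less_one_iff nrm_nonneg)

lemma nrm_poly_le1:
  assumes "\<forall>i. nrm (poly.coeff p i) \<le> 1" "nrm x \<le> 1"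
  shows "nrm (poly p x) \<le> 1"
  using assms(1)
proof (induction p)
  case (pCons a p)
  have "nrm a \<le> 1" "\<forall>i. nrm (poly.coeff p i) \<le> 1"
    using pCons.prems by (metis coeff_pCons_0, metis coeff_pCons_Suc)
  then show ?case
    using pCons.IH assms(2) by (auto intro: nrm_add_leI nrm_mult_le1)
qed simp

lemma nrm_poly_Lipschitz:
  assumes "\<forall>i. nrm (poly.coeff p i) \<le> 1" "nrm x \<le> 1" "nrm y \<le> 1"
  shows "nrm (poly p x - poly p y) \<le> nrm (x - y)"
  using assms(1)
proof (induction p)
  case (pCons a p)
  have p: "\<forall>i. nrm (poly.coeff p i) \<le> 1"
    using pCons.prems by (metis coeff_pCons_Suc)
  have "poly (pCons a p) x - poly (pCons a p) y
      = (x - y) * poly p x + y * (poly p x - poly p y)"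
    by (simp add: algebra_simps)
  moreover have "nrm ((x - y) * poly p x) \<le> nrm (x - y)"
    using nrm_poly_le1[OF p assms(2)] by (simp add: nrm_mult mult_left_le nrm_nonneg)
  moreover have "nrm (y * (poly p x - poly p y)) \<le> nrm (x - y)"
    using pCons.IH[OF p] assms(3) mult_left_le_one_le[OF nrm_nonneg nrm_nonneg assms(3)]
    by (auto simp: nrm_mult intro: order_trans)
  ultimately show ?case
    by (simp add: nrm_add_leI)
qed (simp add: nrm_nonneg)

end

section \<open>Newton polygon estimates and roots near a given point\<close>

lemma coeff_1_shift:
  fixes p :: "'a::field poly"
  shows "poly.coeff (pcompose p [:c, 1:]) 1 = poly (pderiv p) c"
proof -
  have "poly.coeff q 1 = poly (pderiv q) 0" for q :: "'a poly"
    by (simp add: poly_0_coeff_0 coeff_pderiv)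
  then show ?thesis
    by (simp add: pderiv_pcompose poly_pcompose pderiv_pCons)
qed

text \<open>Completeness is not assumed. The locale is used first for the algebraic closure with the
  norm pulled back along \<open>emb\<close>, in the proof that \<open>L\<close> is algebraically
  closed, and then for \<open>L\<close> itself.\<close>

locale valued_acf = nonarchimedean_field nrm for nrm :: "'a::field \<Rightarrow> real" +
  assumes poly_root: "Polynomial.degree (p :: 'a poly) > 0 \<Longrightarrow> \<exists>x. poly p x = 0"
begin

text \<open>Splitting off a root \<open>r\<close> with |r| > \<rho> preserves the strict dominance
  of the constant coefficient at radius \<rho>. This is the Newton polygon statement in the only
  form used here; applied contrapositively it produces roots.\<close>

lemma coeff_bound:
  assumes "p \<noteq> 0" "0 \<le> \<rho>" "\<And>x. poly p x = 0 \<Longrightarrow> \<rho> < nrm x" "0 < i"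
  shows "nrm (poly.coeff p i) * \<rho> ^ i < nrm (poly.coeff p 0)"
  using assms
proof (induction "Polynomial.degree p" arbitrary: p i)
  case 0
  then obtain a where "p = [:a:]"
    by (metis degree_eq_zeroE)
  with 0 show ?case
    by (auto simp: coeff_pCons nrm_pos_iff split: nat.split)
next
  case (Suc n)
  obtain r where r: "poly p r = 0"
    using poly_root[of p] Suc.hyps(2) by auto
  then obtain q where p: "p = [:-r, 1:] * q"
    by (metis dvdE poly_eq_0_iff_dvd)
  have "q \<noteq> 0"
    using p Suc.prems(1) by auto
  then have "Polynomial.degree q = n"
    using Suc.hyps(2) p degree_mult_eq[of "[:-r, 1:]" q] by (simp del: mult_pCons_left)
  moreover have "\<rho> < nrm x" if "poly q x = 0" for x
    using that Suc.prems(3) p by simp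
  ultimately have IH: "nrm (poly.coeff q j) * \<rho> ^ j < nrm (poly.coeff q 0)" if "0 < j" for j
    using Suc.hyps(1)[of q j] \<open>q \<noteq> 0\<close> Suc.prems(2) that by blast
  have IH': "nrm (poly.coeff q j) * \<rho> ^ j \<le> nrm (poly.coeff q 0)" for j
    using IH[of j] by (cases j) auto
  have \<rho>: "\<rho> < nrm r"
    using Suc.prems(3) r by blast
  obtain j where i: "i = Suc j"
    using Suc.prems(4) gr0_conv_Suc by blast
  have q0: "0 < nrm (poly.coeff q 0)"
    using order_le_less_trans[OF mult_nonneg_nonneg[OF nrm_nonneg] IH[of 1]] Suc.prems(2)
    by (simp add: zero_le_power)
  have "poly.coeff p i = poly.coeff q j - r * poly.coeff q (Suc j)"
    by (simp add: p i)
  moreover have "nrm (poly.coeff q j) * \<rho> ^ i < nrm r * nrm (poly.coeff q 0)"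
  proof -
    have "nrm (poly.coeff q j) * \<rho> ^ i \<le> \<rho> * nrm (poly.coeff q 0)"
      using mult_left_mono[OF IH'[of j] Suc.prems(2)] by (simp add: i mult_ac)
    also have "\<dots> < nrm r * nrm (poly.coeff q 0)"
      using \<rho> q0 by simp
    finally show ?thesis .
  qed
  moreover have "nrm (r * poly.coeff q (Suc j)) * \<rho> ^ i < nrm r * nrm (poly.coeff q 0)"
    using IH[of "Suc j"] \<rho> Suc.prems(2) by (simp add: i nrm_mult mult_ac)
  ultimately have "nrm (poly.coeff p i) * \<rho> ^ i < nrm r * nrm (poly.coeff q 0)"
    using nrm_add_le[of "poly.coeff q j" "- (r * poly.coeff q (Suc j))"] Suc.prems(2)
    by (smt (verit, best) diff_conv_add_uminus mult_right_mono nrm_uminus zero_le_power)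
  then show ?case
    by (simp add: p nrm_mult)
qed

lemma no_root_deriv_bound:
  assumes "p \<noteq> 0" "0 \<le> \<rho>" "\<And>x. nrm (x - c) \<le> \<rho> \<Longrightarrow> poly p x \<noteq> 0"
  shows "nrm (poly (pderiv p) c) * \<rho> < nrm (poly p c)"
proof -
  let ?q = "pcompose p [:c, 1:]"
  have "?q \<noteq> 0"
    using assms(1) by (auto dest: pcompose_eq_0)
  moreover have "\<rho> < nrm x" if "poly ?q x = 0" for x
    using that assms(3)[of "c + x"] by (force simp: poly_pcompose)
  ultimately have "nrm (poly.coeff ?q 1) * \<rho> ^ 1 < nrm (poly.coeff ?q 0)"
    using assms(2) by (intro coeff_bound) auto
  then show ?thesis
    by (simp add: coeff_1_shift[unfolded One_nat_def] flip: poly_0_coeff_0) (simp add: poly_pcompose)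
qed

text \<open>Replaces Hensel's lemma: if no root lay within \<rho> of \<open>c\<close>, the constant
  Taylor coefficient at \<open>c\<close> would strictly dominate the linear one. The root comes from
  algebraic closedness, not from an iteration.\<close>

lemma newton_root:
  assumes "nrm (poly p c) \<le> nrm (poly (pderiv p) c) * \<rho>" "0 \<le> \<rho>"
  shows "\<exists>x. nrm (x - c) \<le> \<rho> \<and> poly p x = 0"
proof (cases "p = 0")
  case True
  then show ?thesis
    using assms(2) by (intro exI[of _ c]) simp
qed (use no_root_deriv_bound[of p \<rho> c] assms in force)

lemma root_near:
  assumes "nrm (poly p c) \<le> nrm (Polynomial.lead_coeff p) * \<rho> ^ Polynomial.degree p" "0 \<le> \<rho>"
    "Polynomial.degree p > 0"
  shows "\<exists>x. nrm (x - c) \<le> \<rho> \<and> poly p x = 0"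
proof (rule ccontr)
  assume no: "\<not> ?thesis"
  let ?q = "pcompose p [:c, 1:]"
  have "?q \<noteq> 0"
    using assms(3) by (auto dest: pcompose_eq_0)
  moreover have "\<rho> < nrm x" if "poly ?q x = 0" for x
    using that no by (force simp: poly_pcompose dest: spec[of _ "c + x"])
  ultimately have "nrm (poly.coeff ?q (Polynomial.degree p)) * \<rho> ^ Polynomial.degree p
      < nrm (poly.coeff ?q 0)"
    using assms by (intro coeff_bound) auto
  moreover have "poly.coeff ?q (Polynomial.degree p) = Polynomial.lead_coeff p"
    using lead_coeff_comp[of "[:c, 1:]" p] by (simp add: degree_pcompose)
  ultimately show False
    using assms(1) by (simp flip: poly_0_coeff_0) (simp add: poly_pcompose)
qed

lemma nth_root: "0 < n \<Longrightarrow> \<exists>y. y ^ n = (x :: 'a)"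
proof -
  assume n: "0 < n"
  let ?p = "Polynomial.monom 1 n + [:- x:]"
  have "Polynomial.degree ?p = n"
    using n by (subst degree_add_eq_left) (auto simp: Polynomial.degree_monom_eq)
  then obtain y where "poly ?p y = 0"
    using poly_root n by metis
  then show ?thesis
    by (auto simp: poly_monom intro!: exI[of _ y])
qed

end

subsection \<open>The field \<open>L\<close>\<close>

context completed_alg_closure
begin

lemma emb_0: "emb 0 = 0"
  using emb_add[of 0 0] by (metis add.right_neutral add_left_cancel)

lemma emb_minus: "emb (- x) = - emb x"
  using emb_add[of x "- x"] by (simp add: emb_0 eq_neg_iff_add_eq_0 add.commute)

lemma emb_diff: "emb (x - y) = emb x - emb y"
  using emb_add[of x "- y"] by (simp add: emb_minus)

lemma emb_eq_0_iff: "emb x = 0 \<longleftrightarrow> x = 0"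
proof
  assume "emb x = 0"
  show "x = 0"
  proof (rule ccontr)
    assume "x \<noteq> 0"
    then have "emb x * emb (inverse x) = 1"
      by (simp add: emb_1 flip: emb_mult)
    then show False
      using \<open>emb x = 0\<close> by simp
  qed
qed (simp add: emb_0)

lemma nonarchimedean_emb: "nonarchimedean_field (\<lambda>x. nrm (emb x))"
  by unfold_locales
    (simp_all add: nrm_nonneg nrm_eq_0_iff emb_eq_0_iff emb_mult nrm_mult emb_add nrm_add_le)

lemma valued_acf_emb: "valued_acf (\<lambda>x. nrm (emb x))"
proof (rule valued_acf.intro[OF nonarchimedean_emb], unfold_locales)
  fix p :: "complex fls alg_closure poly"
  assume "Polynomial.degree p > 0"
  then show "\<exists>x. poly p x = 0"
    by (rule alg_closed_imp_poly_has_root)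
qed

lemma poly_map_emb: "poly (map_poly emb p) (emb x) = emb (poly p x)"
  by (induction p) (simp_all add: map_poly_pCons emb_0 emb_add emb_mult)

lemma dense_approx:
  assumes "0 < \<delta>"
  shows "\<exists>y. nrm (emb y - x) < \<delta>"
proof -
  have "x \<in> mtopology closure_of range emb"
    using dense by simp
  then have "\<exists>y. y \<in> range emb \<and> y \<in> mball x \<delta>"
    using assms unfolding metric_closure_of by blast
  then obtain y where "y \<in> range emb" "y \<in> mball x \<delta>"
    by blast
  then show ?thesis
    using nrm_commute by (auto simp: ndist_def)
qed

section \<open>The completion is algebraically closed\<close>

lemma poly_close:
  assumes "\<forall>i. nrm (poly.coeff p i - poly.coeff q i) \<le> \<delta>" "nrm x \<le> B" "1 \<le> B"
    "Polynomial.degree p \<le> n" "Polynomial.degree q \<le> n"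
  shows "nrm (poly p x - poly q x) \<le> \<delta> * B ^ n"
  using assms(1,4,5)
proof (induction n arbitrary: p q)
  case 0
  then show ?case
    by (auto elim!: degree_eq_zeroE dest: spec[of _ 0])
next
  case (Suc n)
  obtain a p' where p: "p = pCons a p'"
    by (rule pCons_cases)
  obtain b q' where q: "q = pCons b q'"
    by (rule pCons_cases)
  have \<delta>: "0 \<le> \<delta>"
    using Suc.prems(1) nrm_nonneg order_trans by blast
  have "nrm (poly.coeff p' i - poly.coeff q' i) \<le> \<delta>" for i
    using Suc.prems(1)[rule_format, of "Suc i"] by (simp add: p q)
  then have IH: "nrm (poly p' x - poly q' x) \<le> \<delta> * B ^ n"
    using Suc.prems(2,3) by (intro Suc.IH) (auto simp: p q split: if_splits)
  have "nrm (a - b) \<le> \<delta>"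
    using Suc.prems(1)[rule_format, of 0] by (simp add: p q)
  also have "\<delta> * 1 \<le> \<delta> * B ^ Suc n"
    using \<delta> assms(3) by (intro mult_left_mono one_le_power) auto
  finally have "nrm (a - b) \<le> \<delta> * B ^ Suc n"
    by simp
  moreover have "nrm (x * (poly p' x - poly q' x)) \<le> \<delta> * B ^ Suc n"
    using mult_mono[OF assms(2) IH] assms(3) nrm_nonneg by (simp add: nrm_mult mult_ac)
  moreover have "poly p x - poly q x = (a - b) + x * (poly p' x - poly q' x)"
    by (simp add: p q algebra_simps)
  ultimately show ?case
    by (simp add: nrm_add_leI)
qed

lemma poly_Lipschitz_on_ball:
  "\<exists>C\<ge>0. \<forall>x y. nrm x \<le> B \<longrightarrow> nrm y \<le> B \<longrightarrow> nrm (poly p x - poly p y) \<le> C * nrm (x - y)"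
proof (induction p)
  case (pCons a p)
  then obtain C where C: "0 \<le> C"
    "\<And>x y. nrm x \<le> B \<Longrightarrow> nrm y \<le> B \<Longrightarrow> nrm (poly p x - poly p y) \<le> C * nrm (x - y)"
    by blast
  let ?D = "max (nrm (poly p 0)) (max (C * B) 0)"
  have "nrm (poly (pCons a p) x - poly (pCons a p) y) \<le> max ?D (B * C) * nrm (x - y)"
    if xy: "nrm x \<le> B" "nrm y \<le> B" for x y
  proof -
    have B: "0 \<le> B"
      using xy nrm_nonneg order_trans by blast
    have "nrm (poly p x) \<le> max (nrm (poly p x - poly p 0)) (nrm (poly p 0))"
      using nrm_add_le[of "poly p x - poly p 0" "poly p 0"] by simp
    moreover have "nrm (poly p x - poly p 0) \<le> C * B"
      using C(2)[of x 0] mult_left_mono[OF xy(1) C(1)] xy B by auto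
    ultimately have "nrm (poly p x) \<le> ?D"
      by linarith
    then have "nrm ((x - y) * poly p x) \<le> max ?D (B * C) * nrm (x - y)"
      using mult_left_mono[of "nrm (poly p x)" "max ?D (B * C)" "nrm (x - y)"] nrm_nonneg
      by (simp add: nrm_mult mult.commute)
    moreover have "nrm (y * (poly p x - poly p y)) \<le> max ?D (B * C) * nrm (x - y)"
    proof -
      have "nrm (y * (poly p x - poly p y)) \<le> B * (C * nrm (x - y))"
        using mult_mono[OF xy(2) C(2)[OF xy] B nrm_nonneg] by (simp add: nrm_mult)
      also have "\<dots> \<le> max ?D (B * C) * nrm (x - y)"
        unfolding mult.assoc[symmetric] by (intro mult_right_mono nrm_nonneg) simp
      finally show ?thesis .
    qed
    moreover have "poly (pCons a p) x - poly (pCons a p) y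
        = (x - y) * poly p x + y * (poly p x - poly p y)"
      by (simp add: algebra_simps)
    ultimately show ?thesis
      by (simp add: nrm_add_leI)
  qed
  then show ?case
    by (intro exI[of _ "max ?D (B * C)"]) auto
qed (intro exI[of _ 0]; simp)

text \<open>Approximate \<open>p\<close> by a polynomial \<open>q\<close> over the algebraic
  closure. If \<open>p\<close> is small at \<open>y\<close>, so is \<open>q\<close>, hence
  \<open>q\<close> has a root within \<rho> of \<open>y\<close>, and at that root \<open>p\<close>
  is as small as the approximation is good.\<close>

lemma root_step:
  assumes n: "Polynomial.degree p = n" "0 < n"
    and y: "nrm (emb y) \<le> B" "1 \<le> B" "nrm (poly p (emb y)) \<le> nrm (Polynomial.lead_coeff p) * \<rho> ^ n"
    and \<rho>: "0 < \<rho>" "\<rho> \<le> B" and \<eta>: "0 < \<eta>"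
  shows "\<exists>z. nrm (emb z - emb y) \<le> \<rho> \<and> nrm (poly p (emb z)) \<le> \<eta>"
proof -
  interpret K: valued_acf "\<lambda>x. nrm (emb x)"
    by (rule valued_acf_emb)
  have lc: "0 < nrm (Polynomial.lead_coeff p)"
    using n by (auto simp: nrm_pos_iff)
  \<comment> \<open>Three demands: the new value is at most \<eta>, \<open>q\<close> is still small
    at \<open>y\<close>, and the leading coefficient keeps its norm, so that \<open>q\<close> has
    the degree of \<open>p\<close>.\<close>
  define \<delta> where "\<delta> = min (min \<eta> (nrm (Polynomial.lead_coeff p) * \<rho> ^ n) / B ^ n) (nrm (Polynomial.lead_coeff p))"
  have \<delta>: "0 < \<delta>" "\<delta> \<le> nrm (Polynomial.lead_coeff p)" "\<delta> * B ^ n \<le> \<eta>" "\<delta> * B ^ n \<le> nrm (Polynomial.lead_coeff p) * \<rho> ^ n"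
  proof -
    have B: "0 < B ^ n"
      using y(2) by simp
    show "0 < \<delta>" "\<delta> \<le> nrm (Polynomial.lead_coeff p)"
      using lc \<rho> \<eta> B by (simp_all add: \<delta>_def)
    have "\<delta> \<le> min \<eta> (nrm (Polynomial.lead_coeff p) * \<rho> ^ n) / B ^ n"
      by (simp add: \<delta>_def)
    then have "\<delta> * B ^ n \<le> min \<eta> (nrm (Polynomial.lead_coeff p) * \<rho> ^ n)"
      using B by (simp add: pos_le_divide_eq)
    then show "\<delta> * B ^ n \<le> \<eta>" "\<delta> * B ^ n \<le> nrm (Polynomial.lead_coeff p) * \<rho> ^ n"
      by auto
  qed
  have "\<forall>i. \<exists>y. nrm (emb y - poly.coeff p i) < \<delta>"
    using dense_approx[OF \<delta>(1)] by blast
  then obtain k where k: "\<And>i. nrm (emb (k i) - poly.coeff p i) < \<delta>"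
    by metis
  define q where "q = (\<Sum>i\<le>n. Polynomial.monom (k i) i)"
  have cq: "poly.coeff q i = (if i \<le> n then k i else 0)" for i
  proof -
    have "poly.coeff q i = (\<Sum>j\<le>n. if j = i then k i else 0)"
      unfolding q_def coeff_sum by (intro sum.cong) auto
    then show ?thesis
      by simp
  qed
  have "nrm (emb (k n) - Polynomial.lead_coeff p) < nrm (Polynomial.lead_coeff p)"
    using k[of n] n \<delta>(2) by (metis order_less_le_trans)
  then have kn: "nrm (emb (k n)) = nrm (Polynomial.lead_coeff p)"
    by (rule nrm_eqI)
  then have "k n \<noteq> 0"
    using lc by (auto simp: emb_0)
  then have dq: "Polynomial.degree q = n"
    using cq by (intro antisym degree_le le_degree) auto
  have close: "nrm (poly p (emb z) - emb (poly q z)) \<le> \<delta> * B ^ n" if "nrm (emb z) \<le> B" for z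
  proof -
    have "nrm (poly p (emb z) - poly (map_poly emb q) (emb z)) \<le> \<delta> * B ^ n"
    proof (rule poly_close)
      show "\<forall>i. nrm (poly.coeff p i - poly.coeff (map_poly emb q) i) \<le> \<delta>"
        using k \<delta>(1) n
        by (auto simp: coeff_map_poly emb_0 cq coeff_eq_0 intro!: less_imp_le)
          (use nrm_commute in metis)
    qed (use that y n dq in \<open>simp_all add: degree_map_poly emb_eq_0_iff\<close>)
    then show ?thesis
      by (simp add: poly_map_emb)
  qed
  have "nrm (emb (poly q y)) \<le> nrm (Polynomial.lead_coeff p) * \<rho> ^ n"
  proof -
    have "emb (poly q y) = poly p (emb y) - (poly p (emb y) - emb (poly q y))"
      by simp
    then show ?thesis
      using close[OF y(1)] y(3) \<delta>(4) nrm_diff_leI[of "poly p (emb y)"] by (metis order_trans)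
  qed
  then have "\<exists>z. nrm (emb (z - y)) \<le> \<rho> \<and> poly q z = 0"
    using \<rho> n dq kn cq by (intro K.root_near) auto
  then obtain z where z: "nrm (emb z - emb y) \<le> \<rho>" "poly q z = 0"
    by (auto simp: emb_diff)
  have "nrm (emb z) \<le> B"
    using nrm_add_leI[of "emb z - emb y" B "emb y"] z(1) \<rho>(2) y(1) by simp
  then have "nrm (poly p (emb z)) \<le> \<eta>"
    using close[of z] z(2) \<delta>(3) by (simp add: emb_0)
  with z(1) show ?thesis
    by blast
qed

lemma exists_root_L:
  assumes "Polynomial.degree (p :: 'a poly) > 0"
  shows "\<exists>x. poly p x = 0"
proof -
  define n where "n = Polynomial.degree p"
  have n: "0 < n" "1 \<le> n"
    using assms by (auto simp: n_def)
  have lc: "0 < nrm (Polynomial.lead_coeff p)"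
    using assms by (auto simp: nrm_pos_iff)
  \<comment> \<open>\<open>B\<close> is chosen so that 0 can serve as the starting approximation
    with radius \<open>B\<close>; \<open>1 \<le> B\<close> gives
    \<open>B \<le> B ^ n\<close>.\<close>
  define B where "B = max 1 (nrm (poly p 0) / nrm (Polynomial.lead_coeff p))"
  have B: "1 \<le> B" "nrm (poly p 0) \<le> nrm (Polynomial.lead_coeff p) * B"
    using lc by (auto simp: B_def max_def field_simps)
  define \<rho> where "\<rho> k = B * (1/2) ^ k" for k :: nat
  have \<rho>: "0 < \<rho> k" "\<rho> k \<le> B" "\<rho> (Suc k) \<le> \<rho> k" for k
    using B by (auto simp: \<rho>_def mult_left_le power_le_one)
  let ?P = "\<lambda>k y. nrm (emb y) \<le> B \<and> nrm (poly p (emb y)) \<le> nrm (Polynomial.lead_coeff p) * \<rho> k ^ n"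
  have "\<exists>y. \<forall>k. ?P k (y k) \<and> nrm (emb (y (Suc k)) - emb (y k)) \<le> \<rho> k"
  proof (rule dependent_nat_choice)
    have "B ^ 1 \<le> B ^ n"
      using B n by (intro power_increasing) auto
    then have "nrm (Polynomial.lead_coeff p) * B \<le> nrm (Polynomial.lead_coeff p) * \<rho> 0 ^ n"
      using lc by (simp add: \<rho>_def)
    then have "?P 0 0"
      using B by (auto simp: emb_0)
    then show "\<exists>y. ?P 0 y"
      by blast
  next
    fix y k
    assume y: "?P k y"
    have "\<exists>z. nrm (emb z - emb y) \<le> \<rho> k
        \<and> nrm (poly p (emb z)) \<le> nrm (Polynomial.lead_coeff p) * \<rho> (Suc k) ^ n"
      using y n B \<rho> lc by (intro root_step[of p n y B]) (auto simp: n_def)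
    then obtain z where z: "nrm (emb z - emb y) \<le> \<rho> k"
      "nrm (poly p (emb z)) \<le> nrm (Polynomial.lead_coeff p) * \<rho> (Suc k) ^ n"
      by blast
    then have "nrm (emb z) \<le> B"
      using nrm_add_leI[of "emb z - emb y" B "emb y"] \<rho>(2)[of k] y by simp
    with z show "\<exists>z. ?P (Suc k) z \<and> nrm (emb z - emb y) \<le> \<rho> k"
      by blast
  qed
  then obtain y where y: "\<And>k. nrm (emb (y k)) \<le> B"
    "\<And>k. nrm (poly p (emb (y k))) \<le> nrm (Polynomial.lead_coeff p) * \<rho> k ^ n"
    "\<And>k. nrm (emb (y (Suc k)) - emb (y k)) \<le> \<rho> k"
    by blast
  have tail: "nrm (emb (y (k + j)) - emb (y k)) \<le> \<rho> k" for k j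
  proof (induction j)
    case (Suc j)
    have "\<rho> (k + j) \<le> \<rho> k"
      by (induction j) (use \<rho>(3) order_trans in auto)
    then show ?case
      using nrm_ultra[of "emb (y (Suc (k + j)))" "emb (y k)" "emb (y (k + j))"] Suc y(3)[of "k + j"]
      by simp
  qed (use \<rho>(1) in \<open>simp add: less_imp_le\<close>)
  have \<rho>0: "\<rho> \<longlonglongrightarrow> 0"
    unfolding \<rho>_def by (intro tendsto_mult_right_zero LIMSEQ_realpow_zero) auto
  have "MCauchy (\<lambda>k. emb (y k))"
    unfolding MCauchy_def
  proof (intro conjI allI impI)
    fix e :: real
    assume "0 < e"
    then obtain N where N: "\<rho> N < e"
      using order_tendstoD(2)[OF \<rho>0] by (metis eventually_sequentially order_refl)
    have "ndist (emb (y m)) (emb (y k)) < e" if "N \<le> m" "N \<le> k" for m k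
    proof -
      have "nrm (emb (y m) - emb (y N)) \<le> \<rho> N" "nrm (emb (y k) - emb (y N)) \<le> \<rho> N"
        using tail[of N "m - N"] tail[of N "k - N"] that by auto
      then show ?thesis
        using N nrm_ultra[of "emb (y m)" "emb (y k)" "emb (y N)"] nrm_commute[of "emb (y k)" "emb (y N)"]
        by (simp add: ndist_def)
    qed
    then show "\<exists>N. \<forall>m k. N \<le> m \<longrightarrow> N \<le> k \<longrightarrow> ndist (emb (y m)) (emb (y k)) < e"
      by blast
  qed simp
  then obtain x where "limitin mtopology (\<lambda>k. emb (y k)) x sequentially"
    using complete unfolding mcomplete_def by blast
  then have "\<forall>e>0. \<forall>\<^sub>F k in sequentially. ndist (emb (y k)) x < e"
    by (simp add: limitin_metric)
  then have lim: "(\<lambda>k. nrm (emb (y k) - x)) \<longlonglongrightarrow> 0"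
    by (simp add: tendsto_iff ndist_def nrm_nonneg)
  define B' where "B' = max B (nrm x)"
  obtain C where C: "0 \<le> C"
    "\<And>x y. nrm x \<le> B' \<Longrightarrow> nrm y \<le> B' \<Longrightarrow> nrm (poly p x - poly p y) \<le> C * nrm (x - y)"
    using poly_Lipschitz_on_ball[of B' p] by blast
  let ?f = "\<lambda>k. C * nrm (emb (y k) - x) + nrm (Polynomial.lead_coeff p) * \<rho> k ^ n"
  have "nrm (poly p x) \<le> ?f k" for k
  proof -
    have "nrm (poly p x - poly p (emb (y k))) \<le> C * nrm (x - emb (y k))"
      using y(1)[of k] by (intro C) (auto simp: B'_def)
    moreover have "nrm (poly p x) \<le> max (nrm (poly p x - poly p (emb (y k)))) (nrm (poly p (emb (y k))))"
      using nrm_add_le[of "poly p x - poly p (emb (y k))" "poly p (emb (y k))"] by simp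
    ultimately show ?thesis
      using y(2)[of k] C(1) nrm_nonneg[of "x - emb (y k)"] nrm_nonneg[of "poly p (emb (y k))"]
        mult_nonneg_nonneg[OF C(1) nrm_nonneg[of "x - emb (y k)"]] nrm_commute[of x "emb (y k)"]
      by (smt (verit))
  qed
  moreover have "?f \<longlonglongrightarrow> C * 0 + nrm (Polynomial.lead_coeff p) * 0 ^ n"
    by (intro tendsto_intros lim \<rho>0)
  ultimately have "nrm (poly p x) \<le> C * 0 + nrm (Polynomial.lead_coeff p) * 0 ^ n"
    by (intro tendsto_lowerbound) auto
  then have "poly p x = 0"
    using n(1) nrm_nonneg[of "poly p x"] nrm_eq_0_iff[of "poly p x"] by (simp add: zero_power)
  then show ?thesis
    by blast
qed

sublocale valued_acf nrm
  by unfold_locales (rule exists_root_L)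

end

subsection \<open>The residue field\<close>

lemma map_poly_add_hom:
  assumes "h 0 = 0" "\<And>x y. h (x + y) = h x + h y"
  shows "map_poly h (p + q) = map_poly h p + map_poly h q"
  by (rule poly_eqI) (simp add: coeff_map_poly assms)

lemma map_poly_mult_hom:
  fixes h :: "'a::comm_ring_1 \<Rightarrow> 'b::comm_ring_1"
  assumes "h 0 = 0" "\<And>x y. h (x + y) = h x + h y" "\<And>x y. h (x * y) = h x * h y"
  shows "map_poly h (p * q) = map_poly h p * map_poly h q"
proof (induction p)
  case (pCons a p)
  have "map_poly h (Polynomial.smult a q) = Polynomial.smult (h a) (map_poly h q)"
    by (rule poly_eqI) (simp add: coeff_map_poly assms)
  then show ?case
    using pCons.IH by (simp add: map_poly_add_hom[OF assms(1,2)] map_poly_pCons assms(1))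
qed simp

context completed_alg_closure
begin

definition cst :: "complex \<Rightarrow> 'a" where
  "cst c = emb (to_ac (fls_const c))"

lemma cst_0 [simp]: "cst 0 = 0"
  by (simp add: cst_def emb_0)

lemma cst_1 [simp]: "cst 1 = 1"
  by (simp add: cst_def emb_1)

lemma cst_add: "cst (c + d) = cst c + cst d"
  by (simp add: cst_def emb_add flip: fls_plus_const)

lemma cst_diff: "cst (c - d) = cst c - cst d"
  by (simp add: cst_def emb_diff flip: fls_minus_const)

lemma cst_mult: "cst (c * d) = cst c * cst d"
  by (simp add: cst_def emb_mult flip: fls_const_mult_const)

lemma nrm_cst: "nrm (cst c) = (if c = 0 then 0 else 1)"
  by (simp add: cst_def nrm_emb tadic_norm_def)

lemma nrm_cst_le1: "nrm (cst c) \<le> 1"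
  by (simp add: nrm_cst)

lemma cst_of_nat: "cst (of_nat n) = of_nat n"
  by (induction n) (simp_all add: cst_add)

text \<open>Residue characteristic 0 in usable form: numerals are units, so division by 2, 3 or 4
  never changes a norm.\<close>

lemma nrm_numeral [simp]: "nrm (numeral n) = 1"
  using nrm_cst[of "of_nat (numeral n)"] unfolding cst_of_nat by simp

lemma numeral_neq_0 [simp]: "(numeral n :: 'a) \<noteq> 0"
  using nrm_numeral[of n] by fastforce

lemma infinite_L: "infinite (UNIV :: 'a set)"
proof -
  have "inj cst"
  proof (rule injI)
    fix c d
    assume "cst c = cst d"
    then have "nrm (cst (c - d)) = 0"
      by (simp add: cst_diff)
    then show "c = d"
      by (simp add: nrm_cst split: if_splits)
  qed
  then show ?thesis
    using infinite_UNIV_char_0[where 'a = complex] finite_imageD[of cst UNIV]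
      finite_subset[OF subset_UNIV, of "range cst"] by blast
qed

lemma poly_ext: "(\<And>x. poly p x = poly q x) \<Longrightarrow> p = (q :: 'a poly)"
  using poly_roots_finite[of "p - q"] infinite_L by auto

lemma exists_small: "\<exists>x. x \<noteq> 0 \<and> nrm x < 1"
proof (intro exI conjI)
  have "nrm (emb (to_ac fls_X)) = exp (- 1)"
    by (simp add: nrm_emb tadic_norm_def)
  then show "nrm (emb (to_ac fls_X)) < 1" "emb (to_ac fls_X) \<noteq> 0"
    by auto
qed

lemma nrm_poly_less1:
  assumes "\<forall>i. nrm (poly.coeff p i) < 1" "nrm x \<le> 1"
  shows "nrm (poly p x) < 1"
  using assms(1)
proof (induction p)
  case (pCons a p)
  have "nrm a < 1" "\<forall>i. nrm (poly.coeff p i) < 1"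
    using pCons.prems by (metis coeff_pCons_0, metis coeff_pCons_Suc)
  then show ?case
    using pCons.IH assms(2) by (auto intro: nrm_add_lessI nrm_mult_less1')
qed simp

lemma map_poly_cst_mult: "map_poly cst (p * q) = map_poly cst p * map_poly cst q"
  by (rule map_poly_mult_hom) (simp_all add: cst_add cst_mult)

lemma poly_map_cst: "poly (map_poly cst q) (cst c) = cst (poly q c)"
  by (induction q) (simp_all add: map_poly_pCons cst_add cst_mult)

text \<open>Over the complex numbers \<open>q\<close> splits into linear factors; if the product is
  small at \<open>x\<close>, some factor is small there.\<close>

lemma near_complex_root:
  assumes "q \<noteq> 0" "nrm (poly (map_poly cst q) x) < 1"
  shows "\<exists>c. nrm (x - cst c) < 1"
  using assms
proof (induction "Polynomial.degree q" arbitrary: q)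
  case 0
  then obtain a where "q = [:a:]" "a \<noteq> 0"
    by (metis degree_eq_zeroE pCons_0_0)
  with 0 show ?case
    by (simp add: map_poly_pCons nrm_cst)
next
  case (Suc n)
  obtain r where "poly q r = 0"
    using alg_closed_imp_poly_has_root[of q] Suc.hyps(2) by auto
  then obtain p where p: "q = [:-r, 1:] * p"
    by (metis dvdE poly_eq_0_iff_dvd)
  have "p \<noteq> 0"
    using p Suc.prems(1) by auto
  then have d: "n = Polynomial.degree p"
    using Suc.hyps(2) p degree_mult_eq[of "[:-r, 1:]" p] by (simp del: mult_pCons_left)
  have "poly (map_poly cst q) x = (x - cst r) * poly (map_poly cst p) x"
    using cst_diff[of 0 r]
    unfolding p map_poly_cst_mult by (simp add: map_poly_pCons algebra_simps)
  then have "nrm (x - cst r) * nrm (poly (map_poly cst p) x) < 1"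
    using Suc.prems(2) by (simp add: nrm_mult)
  then have "nrm (x - cst r) < 1 \<or> nrm (poly (map_poly cst p) x) < 1"
    using mult_mono[of 1 "nrm (x - cst r)" 1 "nrm (poly (map_poly cst p) x)"] nrm_nonneg
    by force
  then show ?case
    using Suc.hyps(1)[OF d \<open>p \<noteq> 0\<close>] by blast
qed

lemma tadic_residue:
  assumes "nrm (emb (to_ac a)) \<le> 1"
  shows "nrm (emb (to_ac a) - cst (fls_nth a 0)) < 1"
proof -
  have neg: "fls_nth a k = 0" if "k < 0" for k
  proof (cases "a = 0")
    case False
    then have "0 \<le> fls_subdegree a"
      using assms by (simp add: nrm_emb tadic_norm_def)
    then show ?thesis
      using that by (intro fls_eq0_below_subdegree) simp
  qed simp
  let ?b = "a - fls_const (fls_nth a 0)"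
  have "tadic_norm ?b < 1"
  proof (cases "?b = 0")
    case False
    then have "1 \<le> fls_subdegree ?b"
      by (rule fls_subdegree_geI) (use neg in force)
    with False show ?thesis
      by (simp add: tadic_norm_def)
  qed (simp add: tadic_norm_def)
  then show ?thesis
    by (simp add: cst_def nrm_emb flip: emb_diff to_ac_diff)
qed

text \<open>Divide a polynomial over the Laurent series that annihilates \<open>x\<close> by its
  largest coefficient. Its reduction is then a nonzero complex polynomial nearly vanishing at
  \<open>x\<close>, so the residue of \<open>x\<close> is algebraic over the complex numbers, hence
  complex.\<close>

lemma residue_exists_emb:
  assumes "nrm (emb x) \<le> 1"
  shows "\<exists>c. nrm (emb x - cst c) < 1"
proof -
  let ?h = "\<lambda>a. emb (to_ac a)"
  obtain p :: "complex fls poly" where p: "p \<noteq> 0" "poly (map_poly to_ac p) x = 0"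
    by (rule alg_closure_algebraic)
  have fin: "finite ((\<lambda>i. nrm (?h (poly.coeff p i))) ` {..Polynomial.degree p})" (is "finite ?S")
    by simp
  have "Max ?S \<in> ?S"
    by (rule Max_in) auto
  then obtain i where i: "Max ?S = nrm (?h (poly.coeff p i))"
    by blast
  have le: "nrm (?h (poly.coeff p j)) \<le> nrm (?h (poly.coeff p i))" for j
  proof (cases "j \<le> Polynomial.degree p")
    case True
    then show ?thesis
      using Max_ge[OF fin] i by auto
  next
    case False
    then show ?thesis
      by (simp add: coeff_eq_0 emb_0 nrm_nonneg)
  qed
  have nz: "poly.coeff p i \<noteq> 0"
  proof
    assume "poly.coeff p i = 0"
    then have "nrm (?h (Polynomial.lead_coeff p)) \<le> 0"
      using le by (metis emb_0 nrm_0 to_ac_0)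
    then show False
      using p(1) nrm_nonneg[of "?h (Polynomial.lead_coeff p)"] by (auto simp: nrm_eq_0_iff emb_eq_0_iff)
  qed
  define q where "q = Polynomial.smult (inverse (poly.coeff p i)) p"
  have q1: "nrm (?h (poly.coeff q j)) \<le> 1" for j
  proof -
    have "nrm (?h (poly.coeff p i)) > 0"
      using nz by (simp add: nrm_pos_iff emb_eq_0_iff)
    then have "inverse (nrm (?h (poly.coeff p i))) * nrm (?h (poly.coeff p j)) \<le> 1"
      using le[of j] by (simp add: field_simps)
    moreover have "emb (inverse y) = inverse (emb y)" for y
    proof (cases "y = 0")
      case False
      then have "emb y * emb (inverse y) = 1"
        by (simp add: emb_1 flip: emb_mult)
      then show ?thesis
        by (simp add: inverse_unique)
    qed (simp add: emb_0)
    ultimately show ?thesis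
      by (simp add: q_def emb_mult nrm_mult nrm_inverse)
  qed
  define r where "r = map_poly (\<lambda>a. fls_nth a 0) q"
  have "poly.coeff r i = 1"
    using nz by (simp add: r_def q_def coeff_map_poly)
  then have "r \<noteq> 0"
    by auto
  have "poly (map_poly ?h q) (emb x) = 0"
  proof -
    have "map_poly ?h q = map_poly emb (map_poly to_ac q)"
      by (rule poly_eqI) (simp add: coeff_map_poly emb_0)
    moreover have "map_poly to_ac q = Polynomial.smult (to_ac (inverse (poly.coeff p i))) (map_poly to_ac p)"
      by (rule poly_eqI) (simp add: coeff_map_poly q_def)
    ultimately show ?thesis
      by (simp add: poly_map_emb p(2) emb_0)
  qed
  moreover have "nrm (poly (map_poly ?h q - map_poly cst r) (emb x)) < 1"
    by (rule nrm_poly_less1) (use assms tadic_residue[OF q1] in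
      \<open>simp_all add: coeff_map_poly emb_0 r_def\<close>)
  ultimately have "nrm (poly (map_poly cst r) (emb x)) < 1"
    by simp
  then show ?thesis
    by (rule near_complex_root[OF \<open>r \<noteq> 0\<close>])
qed

lemma residue_exists:
  assumes "nrm x \<le> 1"
  shows "\<exists>c. nrm (x - cst c) < 1"
proof -
  obtain y where y: "nrm (emb y - x) < 1"
    using dense_approx[of 1 x] by auto
  then have "nrm (emb y) \<le> 1"
    using nrm_add_leI[of "emb y - x" 1 x] assms by simp
  then obtain c where "nrm (emb y - cst c) < 1"
    using residue_exists_emb by blast
  then have "nrm (x - cst c) < 1"
    using y nrm_ultra[of x "cst c" "emb y"] nrm_commute[of x "emb y"] by simp
  then show ?thesis
    by blast
qed

abbreviation res :: "'a \<Rightarrow> complex" where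
  "res \<equiv> residue_class nrm emb"

lemma residue_unique:
  assumes "nrm (x - cst c) < 1" "nrm (x - cst d) < 1"
  shows "c = d"
proof -
  have "nrm (cst (c - d)) < 1"
    using nrm_diff_lessI[OF assms(2,1)] by (simp add: cst_diff)
  then show ?thesis
    by (simp add: nrm_cst split: if_splits)
qed

lemma res_eqI: "nrm (x - cst c) < 1 \<Longrightarrow> res x = c"
  unfolding residue_class_def
  by (rule the_equality) (auto simp: cst_def[symmetric] dest: residue_unique)

lemma res_close: "nrm x \<le> 1 \<Longrightarrow> nrm (x - cst (res x)) < 1"
  using residue_exists res_eqI by blast

lemma res_0 [simp]: "res 0 = 0"
  by (rule res_eqI) simp

lemma res_eq_0_iff: "nrm x \<le> 1 \<Longrightarrow> res x = 0 \<longleftrightarrow> nrm x < 1"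
  using res_close[of x] res_eqI[of x 0] by auto

lemma poly_res:
  assumes "\<forall>i. nrm (poly.coeff p i) \<le> 1"
  shows "poly (map_poly res p) c = 0 \<longleftrightarrow> nrm (poly p (cst c)) < 1"
proof -
  have "nrm (poly (p - map_poly cst (map_poly res p)) (cst c)) < 1"
    by (rule nrm_poly_less1) (use assms res_close in \<open>simp_all add: coeff_map_poly nrm_cst_le1\<close>)
  then have *: "nrm (poly p (cst c) - cst (poly (map_poly res p) c)) < 1"
    by (simp add: poly_map_cst)
  show ?thesis
  proof
    assume "nrm (poly p (cst c)) < 1"
    then have "nrm (cst (poly (map_poly res p) c)) < 1"
      using nrm_diff_lessI[OF _ *, of "poly p (cst c)"] by simp
    then show "poly (map_poly res p) c = 0"
      by (simp add: nrm_cst split: if_splits)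
  qed (use * in simp)
qed

end

subsection \<open>Cubic maps in homogeneous coordinates\<close>

datatype 'a cubic = Cubic (P0: 'a) (P1: 'a) (P2: 'a) (P3: 'a) (Q0: 'a) (Q1: 'a) (Q2: 'a) (Q3: 'a)

definition num :: "'a::field cubic \<Rightarrow> 'a poly" where
  "num f = [:P0 f, P1 f, P2 f, P3 f:]"

definition den :: "'a::field cubic \<Rightarrow> 'a poly" where
  "den f = [:Q0 f, Q1 f, Q2 f, Q3 f:]"

definition homP :: "'a::field cubic \<Rightarrow> 'a \<Rightarrow> 'a \<Rightarrow> 'a" where
  "homP f x y = P0 f * y ^ 3 + P1 f * x * y\<^sup>2 + P2 f * x\<^sup>2 * y + P3 f * x ^ 3"

definition homQ :: "'a::field cubic \<Rightarrow> 'a \<Rightarrow> 'a \<Rightarrow> 'a" where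
  "homQ f x y = Q0 f * y ^ 3 + Q1 f * x * y\<^sup>2 + Q2 f * x\<^sup>2 * y + Q3 f * x ^ 3"

text \<open>
  For a fixed point \<open>v\<close> of the homogeneous lift \<open>\<Phi>\<close>, say \<open>\<Phi> v = \<lambda> v\<close>, the Jacobian determinant
  of \<open>\<Phi>\<close> at \<open>v\<close> is \<open>3 \<lambda>\<^sup>2 \<mu>\<close>, where \<open>\<mu>\<close> is the multiplier; \<open>jac\<close> is a third of that determinant.
\<close>

definition jac :: "'a::field cubic \<Rightarrow> 'a \<Rightarrow> 'a \<Rightarrow> 'a" where
  "jac f x y =
     (P1 f * Q0 f - P0 f * Q1 f) * y ^ 4 + 2 * (P2 f * Q0 f - P0 f * Q2 f) * x * y ^ 3
     + (3 * (P3 f * Q0 f - P0 f * Q3 f) + P2 f * Q1 f - P1 f * Q2 f) * x\<^sup>2 * y\<^sup>2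
     + 2 * (P3 f * Q1 f - P1 f * Q3 f) * x ^ 3 * y + (P3 f * Q2 f - P2 f * Q3 f) * x ^ 4"

text \<open>Nonvanishing of the resultant, phrased without it: in this form it passes to conjugates
  by linear algebra.\<close>

definition nondeg :: "'a::field cubic \<Rightarrow> bool" where
  "nondeg f \<longleftrightarrow> (\<forall>x y. homP f x y = 0 \<longrightarrow> homQ f x y = 0 \<longrightarrow> x = 0 \<and> y = 0)"

lemma homP_1: "homP f z 1 = poly (num f) z"
  by (simp add: homP_def num_def expand_simps)

lemma homQ_1: "homQ f z 1 = poly (den f) z"
  by (simp add: homQ_def den_def expand_simps)

lemma jac_1:
  "jac f z 1 = poly (pderiv (num f)) z * poly (den f) z - poly (num f) z * poly (pderiv (den f)) z"
  by (simp add: jac_def den_def num_def pderiv_pCons expand_simps)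

lemma homP_scale: "homP f (c * x) (c * y) = c ^ 3 * homP f x y"
  by (simp add: homP_def expand_simps)

lemma homQ_scale: "homQ f (c * x) (c * y) = c ^ 3 * homQ f x y"
  by (simp add: homQ_def expand_simps)

lemma jac_scale: "jac f (c * x) (c * y) = c ^ 4 * jac f x y"
  by (simp add: jac_def expand_simps)

lemma poly_homog_subst_3:
  "poly (homog_subst 3 (num f) R S) z = homP f (poly R z) (poly S z)"
  "poly (homog_subst 3 (den f) R S) z = homQ f (poly R z) (poly S z)"
  by (simp_all add: homog_subst_def num_def den_def homP_def homQ_def poly_sum eval_nat_numeral
      algebra_simps)

lemma homog_subst_1: "homog_subst 1 [:b, a:] A B = Polynomial.smult b B + Polynomial.smult a A"
  by (simp add: homog_subst_def)

context completed_alg_closure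
begin

definition integral :: "'a cubic \<Rightarrow> bool" where
  "integral f \<longleftrightarrow> nrm (P0 f) \<le> 1 \<and> nrm (P1 f) \<le> 1 \<and> nrm (P2 f) \<le> 1 \<and> nrm (P3 f) \<le> 1
     \<and> nrm (Q0 f) \<le> 1 \<and> nrm (Q1 f) \<le> 1 \<and> nrm (Q2 f) \<le> 1 \<and> nrm (Q3 f) \<le> 1"

text \<open>The condition on \<open>P3\<close> and \<open>Q3\<close> is the absence of a hole at
  infinity. Holes in the closed unit disc are tested at points of \<open>L\<close> rather than of
  the residue field.\<close>

definition no_hole :: "'a cubic \<Rightarrow> bool" where
  "no_hole f \<longleftrightarrow> integral f \<and> (nrm (P3 f) = 1 \<or> nrm (Q3 f) = 1)
     \<and> (\<forall>c. nrm c \<le> 1 \<longrightarrow> nrm (poly (num f) c) = 1 \<or> nrm (poly (den f) c) = 1)"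

text \<open>The lifts satisfy g o M = k (M o f) for the matrix M; the scalar \<open>k\<close>
  reflects that a lift is determined up to a factor only. M may have any nonzero
  determinant.\<close>

definition conjugate_by :: "'a \<Rightarrow> 'a \<Rightarrow> 'a \<Rightarrow> 'a \<Rightarrow> 'a \<Rightarrow> 'a cubic \<Rightarrow> 'a cubic \<Rightarrow> bool" where
  "conjugate_by a b c d k f g \<longleftrightarrow> a * d - b * c \<noteq> 0 \<and> k \<noteq> 0 \<and>
     (\<forall>x y. homP g (a * x + b * y) (c * x + d * y) = k * (a * homP f x y + b * homQ f x y)
          \<and> homQ g (a * x + b * y) (c * x + d * y) = k * (c * homP f x y + d * homQ f x y))"

definition potentially_good :: "'a cubic \<Rightarrow> bool" where
  "potentially_good f \<longleftrightarrow> (\<exists>a b c d k g. conjugate_by a b c d k f g \<and> no_hole g)"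

lemma integral_coeff:
  assumes "integral f"
  shows "\<forall>i. nrm (poly.coeff (num f) i) \<le> 1" "\<forall>i. nrm (poly.coeff (den f) i) \<le> 1"
  using assms by (auto simp: integral_def num_def den_def coeff_pCons split: nat.split)

text \<open>A common factor of the two reductions has a complex root \<open>c\<close>, and then
  \<open>cst c\<close> is a hole.\<close>

lemma no_hole_good_reduction:
  assumes g: "no_hole g" and k: "k \<noteq> 0"
    and F: "F = (Polynomial.smult k (num g), Polynomial.smult k (den g))"
  shows "good_reduction nrm emb F"
proof -
  have int: "integral g" and lead: "nrm (P3 g) = 1 \<or> nrm (Q3 g) = 1"
    and roots: "\<And>c. nrm c \<le> 1 \<Longrightarrow> nrm (poly (num g) c) = 1 \<or> nrm (poly (den g) c) = 1"
    using g by (auto simp: no_hole_def)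
  note co = integral_coeff[OF int]
  have deg: "rat_degree (p, q) = 3"
    if "Polynomial.degree p \<le> 3" "Polynomial.degree q \<le> 3"
      "poly.coeff p 3 \<noteq> 0 \<or> poly.coeff q 3 \<noteq> 0" for p q :: "'b::field poly"
    using that le_degree[of p 3] le_degree[of q 3] by (auto simp: rat_degree_def max_def)
  have d3: "Polynomial.degree (num g) \<le> 3" "Polynomial.degree (den g) \<le> 3"
    "poly.coeff (num g) 3 = P3 g" "poly.coeff (den g) 3 = Q3 g"
    by (simp_all add: num_def den_def eval_nat_numeral)
  have lead': "P3 g \<noteq> 0 \<or> Q3 g \<noteq> 0"
    using lead by auto
  have degF: "rat_degree F = 3"
    unfolding F using d3 lead' k by (intro deg) auto
  have "coeff_norm nrm (num g, den g) = 1"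
    unfolding coeff_norm_def fst_conv snd_conv
  proof (rule Max_eqI)
    show "finite (nrm ` (set (coeffs (num g)) \<union> set (coeffs (den g))))"
      by simp
    fix y
    assume "y \<in> nrm ` (set (coeffs (num g)) \<union> set (coeffs (den g)))"
    then have "y \<in> nrm ` (range (poly.coeff (num g)) \<union> range (poly.coeff (den g)))"
      unfolding range_coeff by blast
    then show "y \<le> 1"
      using co by blast
  next
    have "x \<in> set (coeffs p)" if "x = poly.coeff p 3" "x \<noteq> 0" for x :: 'a and p
      using that range_coeff[of p] by blast
    then show "1 \<in> nrm ` (set (coeffs (num g)) \<union> set (coeffs (den g)))"
      using lead d3(3,4) by (metis UnI1 UnI2 image_eqI nrm_0 zero_neq_one)
  qed
  moreover have "rational_map 3 (map_ratmap res (num g, den g))"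
    unfolding rational_map_def map_ratmap_def fst_conv snd_conv
  proof
    let ?p = "map_poly res (num g)" and ?q = "map_poly res (den g)"
    have c3: "poly.coeff ?p 3 \<noteq> 0 \<or> poly.coeff ?q 3 \<noteq> 0"
      using lead int by (auto simp: coeff_map_poly d3 integral_def res_eq_0_iff)
    show "rat_degree (?p, ?q) = 3"
      using c3 d3 by (intro deg) (auto intro: order_trans[OF map_poly_degree_leq])
    show "coprime ?p ?q"
    proof (rule ccontr)
      assume "\<not> coprime ?p ?q"
      then obtain h where h: "h dvd ?p" "h dvd ?q" "\<not> is_unit h"
        by (rule not_coprimeE)
      then have "h \<noteq> 0"
        using c3 by auto
      then have "Polynomial.degree h > 0"
        using h(3) is_unit_iff_degree by blast
      then obtain c where "poly h c = 0"
        using alg_closed_imp_poly_has_root by blast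
      then have "poly ?p c = 0" "poly ?q c = 0"
        using h(1,2) by (auto elim!: dvdE)
      then show False
        using poly_res[OF co(1)] poly_res[OF co(2)] roots[of "cst c"] nrm_cst_le1 by force
    qed
  qed
  ultimately show ?thesis
    unfolding good_reduction_def degF
    using k F by (intro exI[of _ "inverse k"] exI[of _ "(num g, den g)"]) simp
qed

lemma mobius_conj_cubic:
  assumes "rat_degree (num f, den f) = 3" "a * d - b * c \<noteq> 0"
  shows "mobius_conj a b c d (num f, den f) =
    (Polynomial.smult b (homog_subst 3 (den f) [:- b, d:] [:a, - c:])
       + Polynomial.smult a (homog_subst 3 (num f) [:- b, d:] [:a, - c:]),
     Polynomial.smult d (homog_subst 3 (den f) [:- b, d:] [:a, - c:])
       + Polynomial.smult c (homog_subst 3 (num f) [:- b, d:] [:a, - c:]))"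
proof -
  have m1: "rat_degree (mobius a b c d) = 1"
    using assms(2) by (auto simp: rat_degree_def mobius_def)
  show ?thesis
    unfolding mobius_conj_def rat_comp_def m1 assms(1) fst_conv snd_conv
    by (simp only: mobius_def fst_conv snd_conv homog_subst_1)
qed

lemma potentially_good_imp:
  assumes f: "potentially_good f" and deg: "rat_degree (num f, den f) = 3"
  shows "potential_good_reduction nrm emb (num f, den f)"
proof -
  obtain a b c d k g where conj: "conjugate_by a b c d k f g" and g: "no_hole g"
    using f by (auto simp: potentially_good_def)
  define D where "D = a * d - b * c"
  have D: "D \<noteq> 0" and k: "k \<noteq> 0"
    and P: "\<And>x y. homP g (a * x + b * y) (c * x + d * y) = k * (a * homP f x y + b * homQ f x y)"
    and Q: "\<And>x y. homQ g (a * x + b * y) (c * x + d * y) = k * (c * homP f x y + d * homQ f x y)"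
    using conj by (auto simp: conjugate_by_def D_def)
  let ?R = "[:- b, d:]" and ?S = "[:a, - c:]"
  note mc = mobius_conj_cubic[OF deg D[unfolded D_def]]
  have ev: "poly ?R z = d * z - b" "poly ?S z = a - c * z" for z
    by (simp_all add: algebra_simps)
  \<comment> \<open>The matrix times its adjugate is \<open>D\<close> times the identity. The forms
    have degree 3, whence the factor \<open>D ^ 3\<close> below.\<close>
  have D1: "a * (d * z - b) + b * (a - c * z) = D * z" "c * (d * z - b) + d * (a - c * z) = D * 1" for z
    by (simp_all add: D_def algebra_simps)
  have "mobius_conj a b c d (num f, den f)
    = (Polynomial.smult (D ^ 3 / k) (num g), Polynomial.smult (D ^ 3 / k) (den g))"
    unfolding mc
  proof (intro arg_cong2[of _ _ _ _ Pair] poly_ext)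
    fix z
    show "poly (Polynomial.smult b (homog_subst 3 (den f) ?R ?S)
        + Polynomial.smult a (homog_subst 3 (num f) ?R ?S)) z = poly (Polynomial.smult (D ^ 3 / k) (num g)) z"
      using P[of "d * z - b" "a - c * z"] k unfolding D1 homP_scale homP_1
      by (simp add: poly_homog_subst_3 ev[simplified] field_simps del: poly_pCons)
        (simp add: algebra_simps)
    show "poly (Polynomial.smult d (homog_subst 3 (den f) ?R ?S)
        + Polynomial.smult c (homog_subst 3 (num f) ?R ?S)) z = poly (Polynomial.smult (D ^ 3 / k) (den g)) z"
      using Q[of "d * z - b" "a - c * z"] k unfolding D1 homQ_scale homQ_1
      by (simp add: poly_homog_subst_3 ev[simplified] field_simps del: poly_pCons)
        (simp add: algebra_simps)
  qed
  then have "good_reduction nrm emb (mobius_conj a b c d (num f, den f))"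
    using D k g by (intro no_hole_good_reduction) auto
  then show ?thesis
    using D unfolding potential_good_reduction_def D_def by blast
qed

end

subsection \<open>Repelling cycles in homogeneous coordinates\<close>

definition homP_dx :: "'a::field cubic \<Rightarrow> 'a \<Rightarrow> 'a \<Rightarrow> 'a" where
  "homP_dx f x y = P1 f * y\<^sup>2 + 2 * P2 f * x * y + 3 * P3 f * x\<^sup>2"

definition homP_dy :: "'a::field cubic \<Rightarrow> 'a \<Rightarrow> 'a \<Rightarrow> 'a" where
  "homP_dy f x y = 3 * P0 f * y\<^sup>2 + 2 * P1 f * x * y + P2 f * x\<^sup>2"

definition homQ_dx :: "'a::field cubic \<Rightarrow> 'a \<Rightarrow> 'a \<Rightarrow> 'a" where
  "homQ_dx f x y = Q1 f * y\<^sup>2 + 2 * Q2 f * x * y + 3 * Q3 f * x\<^sup>2"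

definition homQ_dy :: "'a::field cubic \<Rightarrow> 'a \<Rightarrow> 'a \<Rightarrow> 'a" where
  "homQ_dy f x y = 3 * Q0 f * y\<^sup>2 + 2 * Q1 f * x * y + Q2 f * x\<^sup>2"

lemma pderiv_homog_subst_3:
  "poly (pderiv (homog_subst 3 (num f) R S)) z =
     homP_dx f (poly R z) (poly S z) * poly (pderiv R) z + homP_dy f (poly R z) (poly S z) * poly (pderiv S) z"
  "poly (pderiv (homog_subst 3 (den f) R S)) z =
     homQ_dx f (poly R z) (poly S z) * poly (pderiv R) z + homQ_dy f (poly R z) (poly S z) * poly (pderiv S) z"
  by (simp_all add: homog_subst_def num_def den_def homP_dx_def homP_dy_def homQ_dx_def homQ_dy_def
      eval_nat_numeral pderiv_add pderiv_smult pderiv_mult algebra_simps)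

definition wronskian :: "'a::field ratmap \<Rightarrow> 'a \<Rightarrow> 'a" where
  "wronskian F z =
     poly (pderiv (fst F)) z * poly (snd F) z - poly (fst F) z * poly (pderiv (snd F)) z"

text \<open>Euler's relation for forms of degree 3, inserted into the Jacobian determinant; the
  factor 3 is the one removed in \<open>jac\<close>.\<close>

lemma hom_jac:
  "homP_dx f x y * homQ f x y - homP f x y * homQ_dx f x y = y * jac f x y"
  "homP_dy f x y * homQ f x y - homP f x y * homQ_dy f x y = - x * jac f x y"
  by (simp_all add: homP_dx_def homP_dy_def homQ_dx_def homQ_dy_def jac_def homP_def homQ_def
      expand_simps)

text \<open>The chain rule without denominators. By induction the Wronskian of an iterate is a
  product of values of \<open>jac\<close>.\<close>

lemma wronskian_comp:
  fixes f :: "'a::field cubic"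
  shows
  "wronskian (homog_subst 3 (num f) R S, homog_subst 3 (den f) R S) z
     = jac f (poly R z) (poly S z) * wronskian (R, S) z"
proof -
  have "(a * r + b * s) * q - p * (c * r + d * s) = (a * q - p * c) * r + (b * q - p * d) * s"
    for a b c d p q r s :: 'a
    by (simp add: algebra_simps)
  then show ?thesis
    unfolding wronskian_def fst_conv snd_conv pderiv_homog_subst_3 poly_homog_subst_3
    by (simp only: hom_jac) (simp add: algebra_simps)
qed

lemma affine_deriv_eq: "affine_deriv F z = wronskian F z / (poly (snd F) z)\<^sup>2"
  by (simp add: affine_deriv_def wronskian_def)

lemma jac_1': "jac f z 1 = wronskian (num f, den f) z"
  by (simp add: jac_1 wronskian_def)

lemma proj_point_scale: "c \<noteq> 0 \<Longrightarrow> proj_point (c * x) (c * y) = proj_point x y"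
  by (simp add: proj_point_def)

lemma proj_point_eq_iff:
  assumes "x \<noteq> 0 \<or> y \<noteq> 0" "x' \<noteq> 0 \<or> y' \<noteq> 0"
  shows "proj_point x y = proj_point x' y' \<longleftrightarrow> x * y' = x' * y"
  using assms by (auto simp: proj_point_def field_simps)

lemma nondeg_rat_degree:
  assumes "nondeg f"
  shows "rat_degree (num f, den f) = 3"
proof -
  have "P3 f \<noteq> 0 \<or> Q3 f \<noteq> 0"
    using assms[unfolded nondeg_def, rule_format, of 1 0] by (auto simp: homP_def homQ_def)
  then show ?thesis
    by (auto simp: rat_degree_def num_def den_def)
qed

lemma rat_apply_proj_point:
  assumes "rat_degree (num f, den f) = 3" "x \<noteq> 0 \<or> y \<noteq> 0"
  shows "rat_apply (num f, den f) (proj_point x y) = proj_point (homP f x y) (homQ f x y)"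
proof (cases "y = 0")
  case True
  then have "homP f x y = x ^ 3 * P3 f" "homQ f x y = x ^ 3 * Q3 f" "x \<noteq> 0"
    using assms(2) by (simp_all add: homP_def homQ_def)
  moreover have "poly.coeff (num f) 3 = P3 f" "poly.coeff (den f) 3 = Q3 f"
    by (simp_all add: num_def den_def eval_nat_numeral)
  ultimately show ?thesis
    using True assms(1) proj_point_scale[of "x ^ 3" "P3 f" "Q3 f"]
    by (simp add: proj_point_def[of x])
next
  case False
  then have "homP f x y = y ^ 3 * homP f (x / y) 1" "homQ f x y = y ^ 3 * homQ f (x / y) 1"
    by (simp_all flip: homP_scale homQ_scale)
  then show ?thesis
    using False proj_point_scale[of "y ^ 3"]
    by (simp add: proj_point_def[of x] homP_1 homQ_1)
qed

text \<open>The representatives form infinite periodic sequences, so that the base point can be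
  shifted along the cycle. The factor \<open>l i\<close> measures how the lift moves from one chosen
  representative to the next; distinctness is the nonvanishing of 2 by 2 determinants.\<close>

definition hom_cycle ::
  "'a::field cubic \<Rightarrow> nat \<Rightarrow> (nat \<Rightarrow> 'a) \<Rightarrow> (nat \<Rightarrow> 'a) \<Rightarrow> (nat \<Rightarrow> 'a) \<Rightarrow> bool" where
  "hom_cycle f n u v l \<longleftrightarrow> 0 < n \<and> n \<le> 3 \<and> (\<forall>i. u i \<noteq> 0 \<or> v i \<noteq> 0)
     \<and> (\<forall>i. u (i + n) = u i \<and> v (i + n) = v i \<and> l (i + n) = l i)
     \<and> (\<forall>i. homP f (u i) (v i) = l i * u (Suc i) \<and> homQ f (u i) (v i) = l i * v (Suc i))
     \<and> (\<forall>i j. 0 < j \<longrightarrow> j < n \<longrightarrow> u i * v (i + j) \<noteq> u (i + j) * v i)"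

context nonarchimedean_field
begin

text \<open>The multiplier of a cycle is the product of the \<open>jac\<close> values over the
  square of the product of the \<open>l i\<close>. The quotient depends neither on the
  representatives nor on the scaling of the lift.\<close>

definition repelling :: "'a cubic \<Rightarrow> bool" where
  "repelling f \<longleftrightarrow> (\<exists>n u v l. hom_cycle f n u v l
     \<and> (\<Prod>i<n. nrm (l i))\<^sup>2 < (\<Prod>i<n. nrm (jac f (u i) (v i))))"

lemma nrm_prod: "nrm (prod g A) = (\<Prod>i\<in>A. nrm (g i))"
  by (induction A rule: infinite_finite_induct) (simp_all add: nrm_mult nrm_1)

lemma hom_cycle_Suc:
  assumes "hom_cycle f n u v l"
  shows "hom_cycle f n (\<lambda>i. u (Suc i)) (\<lambda>i. v (Suc i)) (\<lambda>i. l (Suc i))"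
  using assms unfolding hom_cycle_def by (metis add_Suc)

lemma prod_shift_periodic:
  fixes h :: "nat \<Rightarrow> real"
  assumes "h n = h 0" "0 < n" "n \<le> 3"
  shows "(\<Prod>i<n. h (Suc i)) = (\<Prod>i<n. h i)"
proof -
  have "n = 1 \<or> n = 2 \<or> n = 3"
    using assms by auto
  then show ?thesis
    using assms(1) by (auto simp: eval_nat_numeral)
qed

end

context completed_alg_closure
begin

lemma multiplier_affine_cycle:
  assumes f: "nondeg f" and cyc: "hom_cycle f n u v l" and v0: "v 0 \<noteq> 0"
    and rep: "(\<Prod>i<n. nrm (l i))\<^sup>2 < (\<Prod>i<n. nrm (jac f (u i) (v i)))"
  shows "1 < nrm (multiplier (rat_iter n (num f, den f)) (proj_point (u 0) (v 0)))"
proof -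
  let ?F = "(num f, den f)" and ?z = "u 0 / v 0"
  have deg: "rat_degree ?F = 3"
    by (rule nondeg_rat_degree[OF f])
  have step: "homP f (u i) (v i) = l i * u (Suc i)" "homQ f (u i) (v i) = l i * v (Suc i)" for i
    using cyc by (auto simp: hom_cycle_def)
  have nz: "u i \<noteq> 0 \<or> v i \<noteq> 0" for i
    using cyc by (auto simp: hom_cycle_def)
  then have l: "l i \<noteq> 0" for i
    using f step[of i] unfolding nondeg_def by (metis mult_zero_left)
  \<comment> \<open>\<open>c k\<close> is the ratio between the value of the k-th iterated lift,
    started at \<open>(u 0 / v 0, 1)\<close>, and the chosen representative
    \<open>(u k, v k)\<close>.\<close>
  define c where "c = rec_nat (1 / v 0) (\<lambda>k r. r ^ 3 * l k)"
  have c: "c 0 = 1 / v 0" "c (Suc k) = c k ^ 3 * l k" for k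
    by (simp_all add: c_def)
  have c_nz: "c k \<noteq> 0" for k
    by (induction k) (simp_all add: c l v0)
  have it: "rat_iter (Suc k) ?F = (homog_subst 3 (num f) (fst (rat_iter k ?F)) (snd (rat_iter k ?F)),
      homog_subst 3 (den f) (fst (rat_iter k ?F)) (snd (rat_iter k ?F)))" for k
    by (simp add: rat_comp_def deg)
  have val: "poly (fst (rat_iter k ?F)) ?z = c k * u k \<and> poly (snd (rat_iter k ?F)) ?z = c k * v k" for k
  proof (induction k)
    case (Suc k)
    then show ?case
      unfolding it by (simp add: poly_homog_subst_3 homP_scale homQ_scale step c)
  qed (simp add: c v0)
  have wr: "wronskian (rat_iter k ?F) ?z = (\<Prod>i<k. c i ^ 4 * jac f (u i) (v i))" for k
  proof (induction k)
    case 0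
    show ?case
      by (simp add: wronskian_def pderiv_pCons)
  next
    case (Suc k)
    then show ?case
      unfolding it wronskian_comp using val[of k] by (simp add: jac_scale)
  qed
  \<comment> \<open>Telescoping: the square of \<open>c (Suc k) = c k ^ 3 * l k\<close> is the
    square of \<open>c k\<close> times \<open>c k ^ 4 * (l k)\<^sup>2\<close>.\<close>
  have cl: "(\<Prod>i<k. nrm (c i) ^ 4 * nrm (l i) ^ 2) = nrm (c k * v 0) ^ 2" for k
  proof (induction k)
    case (Suc k)
    then show ?case
      by (simp add: c nrm_mult nrm_power power_mult_distrib eval_nat_numeral mult_ac)
  qed (simp add: c v0)
  have vn: "v n = v 0"
    using cyc by (metis add_0 hom_cycle_def)
  have "nrm (multiplier (rat_iter n ?F) (proj_point (u 0) (v 0)))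
      = (\<Prod>i<n. nrm (c i) ^ 4 * nrm (jac f (u i) (v i))) / nrm (c n * v 0) ^ 2"
    using v0 val[of n]
    by (simp add: proj_point_def affine_deriv_eq wr vn nrm_divide nrm_power nrm_prod nrm_mult)
  also have "\<dots> = (\<Prod>i<n. nrm (c i) ^ 4) * (\<Prod>i<n. nrm (jac f (u i) (v i)))
      / ((\<Prod>i<n. nrm (c i) ^ 4) * (\<Prod>i<n. nrm (l i))\<^sup>2)"
    unfolding cl[symmetric] by (simp add: prod.distrib prod_power_distrib)
  also have "\<dots> = (\<Prod>i<n. nrm (jac f (u i) (v i))) / (\<Prod>i<n. nrm (l i))\<^sup>2"
    using c_nz by (simp add: nrm_eq_0_iff)
  also have "\<dots> > 1"
  proof -
    have "(\<Prod>i<n. nrm (l i))\<^sup>2 > 0"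
      using l by (simp add: nrm_eq_0_iff)
    then show ?thesis
      using rep by simp
  qed
  finally show ?thesis .
qed

lemma multiplier_at_infinity:
  fixes f :: "'a cubic"
  assumes f: "nondeg f" and Q3: "Q3 f = 0"
  shows "multiplier (rat_iter 1 (num f, den f)) Infinity = P3 f * Q2 f / (P3 f)\<^sup>2"
proof -
  note deg = nondeg_rat_degree[OF f]
  have "homog_subst 3 (num f) [:0, 1:] 1 = num f" "homog_subst 3 (den f) [:0, 1:] 1 = den f"
    by - (rule poly_ext, simp add: poly_homog_subst_3 homP_1 homQ_1)+
  then have it: "rat_iter 1 (num f, den f) = (num f, den f)"
    by (simp add: rat_comp_def deg)
  have m: "mobius_conj 0 1 1 0 (num f, den f)
    = (homog_subst 3 (den f) [:- 1, 0:] [:0, - 1:], homog_subst 3 (num f) [:- 1, 0:] [:0, - 1:])"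
    by (subst mobius_conj_cubic[OF deg]) simp_all
  show ?thesis
    unfolding it multiplier.simps m affine_deriv_eq wronskian_comp
    unfolding wronskian_def fst_conv snd_conv pderiv_homog_subst_3 poly_homog_subst_3
    by (simp add: homP_def homQ_def homP_dx_def homP_dy_def homQ_dx_def homQ_dy_def Q3 pderiv_pCons mult_ac)
qed

lemma repelling_imp:
  assumes f: "nondeg f" and rep: "repelling f"
  shows "\<exists>n C. n \<le> 3 \<and> repelling_cycle nrm (num f, den f) n C"
proof -
  let ?F = "(num f, den f)"
  note deg = nondeg_rat_degree[OF f]
  \<comment> \<open>At most one point of a cycle is infinite. If it is the base point and the period
    exceeds 1, the base point moves on by one; only a fixed point at infinity needs a separate
    computation.\<close>
  obtain n u v l where cyc: "hom_cycle f n u v l"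
    and big: "(\<Prod>i<n. nrm (l i))\<^sup>2 < (\<Prod>i<n. nrm (jac f (u i) (v i)))"
    and fin: "v 0 \<noteq> 0 \<or> n = 1"
  proof -
    obtain n u v l where c: "hom_cycle f n u v l"
      and b: "(\<Prod>i<n. nrm (l i))\<^sup>2 < (\<Prod>i<n. nrm (jac f (u i) (v i)))"
      using rep by (auto simp: repelling_def)
    have per: "u n = u 0" "v n = v 0" "l n = l 0" and n: "0 < n" "n \<le> 3"
      using c unfolding hom_cycle_def by (metis add_0)+
    show thesis
    proof (cases "v 0 \<noteq> 0 \<or> n = 1")
      case False
      then have "u 0 * v (0 + 1) \<noteq> u (0 + 1) * v 0"
        using c n unfolding hom_cycle_def by (metis less_one linorder_neqE_nat zero_less_one)
      then have "v (Suc 0) \<noteq> 0"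
        using False by auto
      moreover have "(\<Prod>i<n. nrm (l (Suc i)))\<^sup>2 < (\<Prod>i<n. nrm (jac f (u (Suc i)) (v (Suc i))))"
        using b prod_shift_periodic[of "\<lambda>i. nrm (l i)" n] n per
          prod_shift_periodic[of "\<lambda>i. nrm (jac f (u i) (v i))" n] by simp
      ultimately show thesis
        using that hom_cycle_Suc[OF c] by blast
    qed (use that c b in blast)
  qed
  have n: "0 < n" "n \<le> 3" and nz: "\<And>i. u i \<noteq> 0 \<or> v i \<noteq> 0"
    and step: "\<And>i. homP f (u i) (v i) = l i * u (Suc i)" "\<And>i. homQ f (u i) (v i) = l i * v (Suc i)"
    and dist: "\<And>i j. 0 < j \<Longrightarrow> j < n \<Longrightarrow> u i * v (i + j) \<noteq> u (i + j) * v i"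
    and per: "u n = u 0" "v n = v 0"
    using cyc unfolding hom_cycle_def by (auto, metis add_0, metis add_0)
  have l: "l i \<noteq> 0" for i
    using f step[of i] nz[of i] unfolding nondeg_def by (metis mult_zero_left)
  define pt where "pt i = proj_point (u i) (v i)" for i
  have ap: "rat_apply ?F (pt i) = pt (Suc i)" for i
    unfolding pt_def by (simp add: rat_apply_proj_point[OF deg nz] step proj_point_scale l)
  have ap_pow: "(rat_apply ?F ^^ k) (pt 0) = pt k" for k
    by (induction k) (simp_all add: ap)
  have pt_neq: "pt i \<noteq> pt (i + j)" if "0 < j" "j < n" for i j
    unfolding pt_def using proj_point_eq_iff[OF nz nz] dist[OF that] by blast
  have "inj_on pt {..<n}"
  proof (rule linorder_inj_onI)
    fix i j
    assume "i < j" "i \<in> {..<n}" "j \<in> {..<n}"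
    then show "pt i \<noteq> pt j"
      using pt_neq[of "j - i" i] by simp
  qed auto
  then have "card (pt ` {..<n}) = n"
    by (simp add: card_image)
  moreover have "pt n = pt 0"
    by (simp add: pt_def per)
  ultimately have cycle: "rigid_cycle ?F n (pt ` {..<n})"
    unfolding rigid_cycle_def using n by (intro conjI exI[of _ "pt 0"]) (simp_all add: ap_pow)
  have "1 < nrm (multiplier (rat_iter n ?F) (pt 0))"
  proof (cases "v 0 = 0")
    case False
    then show ?thesis
      unfolding pt_def by (rule multiplier_affine_cycle[OF f cyc _ big])
  next
    case True
    then have [simp]: "n = 1" and u0: "u 0 \<noteq> 0" and inf: "pt 0 = Infinity"
      using fin nz[of 0] by (auto simp: pt_def proj_point_def)
    have "l 0 * u 0 = P3 f * u 0 ^ 3" "Q3 f * u 0 ^ 3 = 0"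
      using step[of 0] per True by (simp_all add: homP_def homQ_def)
    then have Q3: "Q3 f = 0" and l0: "l 0 = P3 f * u 0 ^ 2"
      using u0 by (simp_all add: power3_eq_cube power2_eq_square)
    have P3: "P3 f \<noteq> 0"
      using l[of 0] l0 by auto
    have "nrm (P3 f) ^ 2 * nrm (u 0) ^ 4 < nrm (P3 f * Q2 f) * nrm (u 0) ^ 4"
      using big by (simp add: l0 True jac_def Q3 nrm_mult nrm_power power_mult_distrib flip: power_mult)
    then have "nrm (P3 f) ^ 2 < nrm (P3 f * Q2 f)"
      using nrm_nonneg[of "u 0"] by (meson mult_less_cancel_right_disj zero_le_power not_less)
    moreover have "0 < nrm (P3 f) ^ 2"
      using P3 by (simp add: nrm_eq_0_iff)
    ultimately show ?thesis
      using multiplier_at_infinity[OF f Q3] by (simp add: inf nrm_divide nrm_power pos_less_divide_eq)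
  qed
  then show ?thesis
    unfolding repelling_cycle_def using n cycle by blast
qed

end

subsection \<open>Changes of coordinate\<close>

definition translate :: "'a::field \<Rightarrow> 'a cubic \<Rightarrow> 'a cubic" where
  "translate c f = Cubic
     (P0 f + P1 f * c + P2 f * c\<^sup>2 + P3 f * c ^ 3 - c * (Q0 f + Q1 f * c + Q2 f * c\<^sup>2 + Q3 f * c ^ 3))
     (P1 f + 2 * P2 f * c + 3 * P3 f * c\<^sup>2 - c * (Q1 f + 2 * Q2 f * c + 3 * Q3 f * c\<^sup>2))
     (P2 f + 3 * P3 f * c - c * (Q2 f + 3 * Q3 f * c))
     (P3 f - c * Q3 f)
     (Q0 f + Q1 f * c + Q2 f * c\<^sup>2 + Q3 f * c ^ 3)
     (Q1 f + 2 * Q2 f * c + 3 * Q3 f * c\<^sup>2)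
     (Q2 f + 3 * Q3 f * c)
     (Q3 f)"

text \<open>The coordinate becomes z / s, and the lift is normalised so that \<open>P2\<close> and
  \<open>Q1\<close> are unchanged. The i-th coefficient of P gets weight i - 2 and that of Q weight
  i - 1; these are the weights of the diagonal torus that enter the stability test.\<close>

definition rescale :: "'a::field \<Rightarrow> 'a cubic \<Rightarrow> 'a cubic" where
  "rescale s f = Cubic (P0 f / s\<^sup>2) (P1 f / s) (P2 f) (P3 f * s) (Q0 f / s) (Q1 f) (Q2 f * s) (Q3 f * s\<^sup>2)"

definition smul :: "'a::field \<Rightarrow> 'a cubic \<Rightarrow> 'a cubic" where
  "smul k f = Cubic (k * P0 f) (k * P1 f) (k * P2 f) (k * P3 f) (k * Q0 f) (k * Q1 f) (k * Q2 f) (k * Q3 f)"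

definition invert :: "'a::field cubic \<Rightarrow> 'a cubic" where
  "invert f = Cubic (Q3 f) (Q2 f) (Q1 f) (Q0 f) (P3 f) (P2 f) (P1 f) (P0 f)"

lemma translate_simps [simp]:
  "P0 (translate c f) = P0 f + P1 f * c + P2 f * c\<^sup>2 + P3 f * c ^ 3
     - c * (Q0 f + Q1 f * c + Q2 f * c\<^sup>2 + Q3 f * c ^ 3)"
  "P1 (translate c f) = P1 f + 2 * P2 f * c + 3 * P3 f * c\<^sup>2 - c * (Q1 f + 2 * Q2 f * c + 3 * Q3 f * c\<^sup>2)"
  "P2 (translate c f) = P2 f + 3 * P3 f * c - c * (Q2 f + 3 * Q3 f * c)"
  "P3 (translate c f) = P3 f - c * Q3 f"
  "Q0 (translate c f) = Q0 f + Q1 f * c + Q2 f * c\<^sup>2 + Q3 f * c ^ 3"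
  "Q1 (translate c f) = Q1 f + 2 * Q2 f * c + 3 * Q3 f * c\<^sup>2"
  "Q2 (translate c f) = Q2 f + 3 * Q3 f * c"
  "Q3 (translate c f) = Q3 f"
  by (simp_all add: translate_def)

lemma rescale_simps [simp]:
  "P0 (rescale s f) = P0 f / s\<^sup>2" "P1 (rescale s f) = P1 f / s" "P2 (rescale s f) = P2 f"
  "P3 (rescale s f) = P3 f * s" "Q0 (rescale s f) = Q0 f / s" "Q1 (rescale s f) = Q1 f"
  "Q2 (rescale s f) = Q2 f * s" "Q3 (rescale s f) = Q3 f * s\<^sup>2"
  by (simp_all add: rescale_def)

lemma smul_simps [simp]:
  "P0 (smul k f) = k * P0 f" "P1 (smul k f) = k * P1 f" "P2 (smul k f) = k * P2 f"
  "P3 (smul k f) = k * P3 f" "Q0 (smul k f) = k * Q0 f" "Q1 (smul k f) = k * Q1 f"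
  "Q2 (smul k f) = k * Q2 f" "Q3 (smul k f) = k * Q3 f"
  by (simp_all add: smul_def)

lemma invert_simps [simp]:
  "P0 (invert f) = Q3 f" "P1 (invert f) = Q2 f" "P2 (invert f) = Q1 f" "P3 (invert f) = Q0 f"
  "Q0 (invert f) = P3 f" "Q1 (invert f) = P2 f" "Q2 (invert f) = P1 f" "Q3 (invert f) = P0 f"
  by (simp_all add: invert_def)

lemma translate_translate: "translate (- c) (translate c f) = f"
  by (rule cubic.expand) (simp add: expand_simps)

lemma rescale_rescale: "s \<noteq> 0 \<Longrightarrow> rescale (inverse s) (rescale s f) = f"
  by (rule cubic.expand) (simp add: field_simps)

lemma smul_smul: "k \<noteq> 0 \<Longrightarrow> smul (inverse k) (smul k f) = f"
  by (rule cubic.expand) simp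

lemma invert_invert: "invert (invert f) = f"
  by (rule cubic.expand) simp

context completed_alg_closure
begin

text \<open>In the chain rule for g o M = k (M o f) the determinant of M cancels, which leaves
  \<open>k\<^sup>2\<close>.\<close>

definition jac_conj :: "'a \<Rightarrow> 'a \<Rightarrow> 'a \<Rightarrow> 'a \<Rightarrow> 'a \<Rightarrow> 'a cubic \<Rightarrow> 'a cubic \<Rightarrow> bool" where
  "jac_conj a b c d k f g \<longleftrightarrow> conjugate_by a b c d k f g
     \<and> (\<forall>x y. jac g (a * x + b * y) (c * x + d * y) = k\<^sup>2 * jac f x y)"

lemma jac_det: "3 * jac f x y = homP_dx f x y * homQ_dy f x y - homP_dy f x y * homQ_dx f x y"
  by (simp add: jac_def homP_dx_def homP_dy_def homQ_dx_def homQ_dy_def expand_simps)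

lemma translate_conj: "jac_conj 1 (- c) 0 1 1 f (translate c f)"
proof -
  let ?g = "translate c f"
  have hom: "homP ?g x y = homP f (x + c * y) y - c * homQ f (x + c * y) y"
    "homQ ?g x y = homQ f (x + c * y) y" for x y
    by (simp_all add: homP_def homQ_def expand_simps)
  have d: "homP_dx ?g x y = homP_dx f (x + c * y) y - c * homQ_dx f (x + c * y) y"
    "homQ_dx ?g x y = homQ_dx f (x + c * y) y"
    "homP_dy ?g x y = c * (homP_dx f (x + c * y) y - c * homQ_dx f (x + c * y) y)
       + (homP_dy f (x + c * y) y - c * homQ_dy f (x + c * y) y)"
    "homQ_dy ?g x y = c * homQ_dx f (x + c * y) y + homQ_dy f (x + c * y) y" for x y
    by (simp_all add: homP_dx_def homQ_dx_def homP_dy_def homQ_dy_def algebra_simps power2_eq_square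
        power3_eq_cube)
  have "3 * jac ?g x y = 3 * jac f (x + c * y) y" for x y
    unfolding jac_det d by (simp add: algebra_simps)
  then have "jac ?g x y = jac f (x + c * y) y" for x y
    by simp
  then show ?thesis
    by (simp add: jac_conj_def conjugate_by_def hom)
qed

lemma rescale_conj:
  assumes "s \<noteq> 0"
  shows "jac_conj 1 0 0 s s f (rescale s f)"
proof -
  have "homP (rescale s f) x (s * y) = s * homP f x y" "homQ (rescale s f) x (s * y) = s * (s * homQ f x y)"
    for x y
    using assms by (simp_all add: homP_def homQ_def power2_eq_square power3_eq_cube divide_simps)
      (simp_all add: algebra_simps)
  moreover have "jac (rescale s f) x (s * y) = s\<^sup>2 * jac f x y" for x y
  proof -
    have "homP_dx (rescale s f) x (s * y) = s * homP_dx f x y"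
      "homP_dy (rescale s f) x (s * y) = homP_dy f x y"
      "homQ_dx (rescale s f) x (s * y) = s\<^sup>2 * homQ_dx f x y"
      "homQ_dy (rescale s f) x (s * y) = s * homQ_dy f x y"
      using assms by (simp_all add: homP_dx_def homQ_dx_def homP_dy_def homQ_dy_def power2_eq_square divide_simps)
        (simp_all add: algebra_simps)
    then have "3 * jac (rescale s f) x (s * y) = 3 * (s\<^sup>2 * jac f x y)"
      by (simp only: mult.left_commute[of 3 "s\<^sup>2"] jac_det) (simp only: algebra_simps power2_eq_square)
    then show ?thesis
      by simp
  qed
  ultimately show ?thesis
    using assms by (simp add: jac_conj_def conjugate_by_def)
qed

lemma smul_conj: "k \<noteq> 0 \<Longrightarrow> jac_conj 1 0 0 1 k f (smul k f)"
  by (simp add: jac_conj_def conjugate_by_def homP_def homQ_def jac_def algebra_simps power2_eq_square)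

lemma invert_conj: "jac_conj 0 1 1 0 1 f (invert f)"
  by (simp add: jac_conj_def conjugate_by_def homP_def homQ_def jac_def algebra_simps power2_eq_square)

lemma nondeg_conj:
  assumes "conjugate_by a b c d k f g" "nondeg f"
  shows "nondeg g"
  unfolding nondeg_def
proof (intro allI impI)
  fix x' y'
  assume z: "homP g x' y' = 0" "homQ g x' y' = 0"
  define D where "D = a * d - b * c"
  have D: "D \<noteq> 0" and k: "k \<noteq> 0"
    and P: "\<And>x y. homP g (a * x + b * y) (c * x + d * y) = k * (a * homP f x y + b * homQ f x y)"
    and Q: "\<And>x y. homQ g (a * x + b * y) (c * x + d * y) = k * (c * homP f x y + d * homQ f x y)"
    using assms(1) by (auto simp: conjugate_by_def D_def)
  let ?x = "d * x' - b * y'" and ?y = "a * y' - c * x'"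
  have M: "a * ?x + b * ?y = D * x'" "c * ?x + d * ?y = D * y'"
    by (simp_all add: D_def algebra_simps)
  have e: "a * homP f ?x ?y + b * homQ f ?x ?y = 0" "c * homP f ?x ?y + d * homQ f ?x ?y = 0"
    using P[of ?x ?y] Q[of ?x ?y] k z unfolding M homP_scale homQ_scale by auto
  have Dm: "D * p = d * (a * p + b * q) - b * (c * p + d * q)"
    "D * q = a * (c * p + d * q) - c * (a * p + b * q)" for p q
    by (simp_all add: D_def algebra_simps)
  have "D * homP f ?x ?y = 0"
    by (rule trans[OF Dm(1)[of _ "homQ f ?x ?y"]]) (simp only: e, simp)
  moreover have "D * homQ f ?x ?y = 0"
    by (rule trans[OF Dm(2)[of _ "homP f ?x ?y"]]) (simp only: e, simp)
  ultimately have "homP f ?x ?y = 0" "homQ f ?x ?y = 0"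
    using D by simp_all
  then have "?x = 0 \<and> ?y = 0"
    using assms(2) unfolding nondeg_def by blast
  then show "x' = 0 \<and> y' = 0"
    using M D by auto
qed

lemma potentially_good_conj:
  assumes "conjugate_by a b c d k f g" "potentially_good g"
  shows "potentially_good f"
proof -
  obtain a' b' c' d' k' h where h: "conjugate_by a' b' c' d' k' g h" "no_hole h"
    using assms(2) by (auto simp: potentially_good_def)
  define A B C E where "A = a' * a + b' * c" and "B = a' * b + b' * d"
    and "C = c' * a + d' * c" and "E = c' * b + d' * d"
  note defs = A_def B_def C_def E_def
  have M: "A * x + B * y = a' * (a * x + b * y) + b' * (c * x + d * y)"
    "C * x + E * y = c' * (a * x + b * y) + d' * (c * x + d * y)" for x y
    by (simp_all add: defs algebra_simps)
  have "A * E - B * C = (a' * d' - b' * c') * (a * d - b * c)"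
    by (simp add: defs algebra_simps)
  moreover have g: "homP g (a * x + b * y) (c * x + d * y) = k * (a * homP f x y + b * homQ f x y)"
    "homQ g (a * x + b * y) (c * x + d * y) = k * (c * homP f x y + d * homQ f x y)"
    and h': "homP h (a' * x + b' * y) (c' * x + d' * y) = k' * (a' * homP g x y + b' * homQ g x y)"
    "homQ h (a' * x + b' * y) (c' * x + d' * y) = k' * (c' * homP g x y + d' * homQ g x y)" for x y
    using assms(1) h(1) by (auto simp: conjugate_by_def)
  have "homP h (A * x + B * y) (C * x + E * y) = k' * k * (A * homP f x y + B * homQ f x y)"
    "homQ h (A * x + B * y) (C * x + E * y) = k' * k * (C * homP f x y + E * homQ f x y)" for x y
    unfolding M h' g by (simp_all add: defs algebra_simps)
  ultimately have "conjugate_by A B C E (k' * k) f h"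
    using assms(1) h(1) by (simp add: conjugate_by_def)
  with h(2) show ?thesis
    unfolding potentially_good_def by blast
qed

lemma repelling_conj:
  assumes conj: "jac_conj a b c d k f g" and rep: "repelling f"
  shows "repelling g"
proof -
  obtain n u v l where cyc: "hom_cycle f n u v l"
    and big: "(\<Prod>i<n. nrm (l i))\<^sup>2 < (\<Prod>i<n. nrm (jac f (u i) (v i)))"
    using rep by (auto simp: repelling_def)
  define u' where "u' i = a * u i + b * v i" for i
  define v' where "v' i = c * u i + d * v i" for i
  define l' where "l' i = k * l i" for i
  define D where "D = a * d - b * c"
  have D: "D \<noteq> 0" and k: "k \<noteq> 0"
    and P: "\<And>x y. homP g (a * x + b * y) (c * x + d * y) = k * (a * homP f x y + b * homQ f x y)"
    and Q: "\<And>x y. homQ g (a * x + b * y) (c * x + d * y) = k * (c * homP f x y + d * homQ f x y)"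
    and J: "\<And>x y. jac g (a * x + b * y) (c * x + d * y) = k\<^sup>2 * jac f x y"
    using conj by (auto simp: jac_conj_def conjugate_by_def D_def)
  have nz: "u' i \<noteq> 0 \<or> v' i \<noteq> 0" for i
  proof (rule ccontr)
    assume "\<not> ?thesis"
    moreover have "D * u i = d * u' i - b * v' i" "D * v i = a * v' i - c * u' i"
      by (simp_all add: D_def u'_def v'_def algebra_simps)
    ultimately show False
      using D cyc by (auto simp: hom_cycle_def)
  qed
  have det: "u' i * v' j - u' j * v' i = D * (u i * v j - u j * v i)" for i j
    by (simp add: D_def u'_def v'_def algebra_simps)
  have "hom_cycle g n u' v' l'"
    unfolding hom_cycle_def
  proof (intro conjI allI impI)
    fix i j
    assume "0 < j" "j < n"
    then have "u i * v (i + j) - u (i + j) * v i \<noteq> 0"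
      using cyc by (simp add: hom_cycle_def)
    then show "u' i * v' (i + j) \<noteq> u' (i + j) * v' i"
      using det[of i "i + j"] D by auto
  qed (use cyc nz in \<open>auto simp: hom_cycle_def u'_def v'_def l'_def P Q algebra_simps\<close>)
  moreover have "(\<Prod>i<n. nrm (l' i))\<^sup>2 < (\<Prod>i<n. nrm (jac g (u' i) (v' i)))"
  proof -
    have "(\<Prod>i<n. nrm (l' i))\<^sup>2 = (nrm k ^ n)\<^sup>2 * (\<Prod>i<n. nrm (l i))\<^sup>2"
      by (simp add: l'_def nrm_mult prod.distrib power_mult_distrib)
    also have "\<dots> < (nrm k ^ n)\<^sup>2 * (\<Prod>i<n. nrm (jac f (u i) (v i)))"
      using big k by (simp add: nrm_eq_0_iff)
    also have "\<dots> = (\<Prod>i<n. nrm (jac g (u' i) (v' i)))"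
      by (simp add: u'_def v'_def J nrm_mult nrm_power prod.distrib power_commutes flip: power_mult)
        (simp add: mult.commute)
    finally show ?thesis .
  qed
  ultimately show ?thesis
    unfolding repelling_def by blast
qed

text \<open>The dichotomy to be shown for every cubic. Carrying \<open>nondeg\<close> as a premise
  makes the cases in which a normal form drops in degree vacuous.\<close>

definition alternative :: "'a cubic \<Rightarrow> bool" where
  "alternative f \<longleftrightarrow> (nondeg f \<longrightarrow> potentially_good f \<or> repelling f)"

text \<open>Both directions are required: potential good reduction is pulled back from
  \<open>g\<close> to \<open>f\<close>, while a repelling cycle of \<open>g\<close> is pushed
  forward to \<open>f\<close>.\<close>

lemma alternative_conj:
  assumes "jac_conj a b c d k f g" "jac_conj a' b' c' d' k' g f" "alternative g"
  shows "alternative f"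
proof -
  have c: "conjugate_by a b c d k f g"
    using assms(1) by (simp add: jac_conj_def)
  show ?thesis
    using assms(3) nondeg_conj[OF c] potentially_good_conj[OF c] repelling_conj[OF assms(2)]
    by (auto simp: alternative_def)
qed

lemma alternative_translate: "alternative (translate c f) \<Longrightarrow> alternative f"
  using alternative_conj[OF translate_conj[of c f]] translate_conj[of "- c" "translate c f"]
  by (metis translate_translate)

lemma alternative_rescale: "s \<noteq> 0 \<Longrightarrow> alternative (rescale s f) \<Longrightarrow> alternative f"
  using alternative_conj[OF rescale_conj[of s f]] rescale_conj[of "inverse s" "rescale s f"]
  by (metis rescale_rescale inverse_nonzero_iff_nonzero)

lemma alternative_smul: "k \<noteq> 0 \<Longrightarrow> alternative (smul k f) \<Longrightarrow> alternative f"
  using alternative_conj[OF smul_conj[of k f]] smul_conj[of "inverse k" "smul k f"]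
  by (metis smul_smul inverse_nonzero_iff_nonzero)

lemma alternative_invert: "alternative (invert f) \<Longrightarrow> alternative f"
  using alternative_conj[OF invert_conj[of f] ] invert_conj[of "invert f"]
  by (metis invert_invert)

subsection \<open>Uniformly expanding maps on discs\<close>

text \<open>On the whole disc A/B has no pole, its derivative has norm exactly \<Lambda>, and
  distances to the centre grow at most by \<Lambda>. A pair of polynomials rather than a cubic is
  used because composites have higher degree.\<close>

definition expands :: "'a poly \<Rightarrow> 'a poly \<Rightarrow> 'a \<Rightarrow> real \<Rightarrow> real \<Rightarrow> bool" where
  "expands A B c \<rho> \<Lambda> \<longleftrightarrow> (\<forall>z. nrm (z - c) \<le> \<rho> \<longrightarrow> poly B z \<noteq> 0
     \<and> nrm (wronskian (A, B) z) = \<Lambda> * (nrm (poly B z))\<^sup>2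
     \<and> nrm (poly A z / poly B z - poly A c / poly B c) \<le> \<Lambda> * nrm (z - c))"

lemma expandsD:
  assumes "expands A B c \<rho> \<Lambda>" "nrm (z - c) \<le> \<rho>"
  shows "poly B z \<noteq> 0" "nrm (wronskian (A, B) z) = \<Lambda> * (nrm (poly B z))\<^sup>2"
    "nrm (poly A z / poly B z - poly A c / poly B c) \<le> \<Lambda> * nrm (z - c)"
  using assms by (auto simp: expands_def)

lemma hom_quotient:
  assumes "y \<noteq> 0"
  shows "homP f x y = y ^ 3 * poly (num f) (x / y)" "homQ f x y = y ^ 3 * poly (den f) (x / y)"
    "jac f x y = y ^ 4 * wronskian (num f, den f) (x / y)"
  using assms homP_scale[of f y "x / y" 1] homQ_scale[of f y "x / y" 1] jac_scale[of f y "x / y" 1]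
  by (simp_all add: homP_1 homQ_1 jac_1')

lemma expands_comp:
  assumes 1: "expands A B c \<rho> \<Lambda>" and 2: "expands (num f) (den f) (poly A c / poly B c) (\<Lambda> * \<rho>) \<Lambda>'"
    and \<Lambda>: "0 \<le> \<Lambda>" "0 \<le> \<Lambda>'" and \<rho>: "0 \<le> \<rho>"
  shows "expands (homog_subst 3 (num f) A B) (homog_subst 3 (den f) A B) c \<rho> (\<Lambda>' * \<Lambda>)"
    and "poly (homog_subst 3 (num f) A B) c / poly (homog_subst 3 (den f) A B) c
      = poly (num f) (poly A c / poly B c) / poly (den f) (poly A c / poly B c)"
proof -
  have val: "poly (homog_subst 3 (num f) A B) z / poly (homog_subst 3 (den f) A B) z
      = poly (num f) (poly A z / poly B z) / poly (den f) (poly A z / poly B z)"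
    if "nrm (z - c) \<le> \<rho>" for z
    using expandsD(1)[OF 1 that] by (simp add: poly_homog_subst_3 hom_quotient)
  then show "poly (homog_subst 3 (num f) A B) c / poly (homog_subst 3 (den f) A B) c
      = poly (num f) (poly A c / poly B c) / poly (den f) (poly A c / poly B c)"
    using \<rho> by simp
  show "expands (homog_subst 3 (num f) A B) (homog_subst 3 (den f) A B) c \<rho> (\<Lambda>' * \<Lambda>)"
    unfolding expands_def
  proof (intro allI impI conjI)
    fix z
    assume z: "nrm (z - c) \<le> \<rho>"
    note 1 = expandsD[OF 1 z]
    let ?v = "poly A z / poly B z"
    have v: "nrm (?v - poly A c / poly B c) \<le> \<Lambda> * \<rho>"
      using 1(3) mult_left_mono[OF z \<Lambda>(1)] by simp
    note 2 = expandsD[OF 2 v]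
    show "poly (homog_subst 3 (den f) A B) z \<noteq> 0"
      using 1(1) 2(1) by (simp add: poly_homog_subst_3 hom_quotient)
    show "nrm (wronskian (homog_subst 3 (num f) A B, homog_subst 3 (den f) A B) z)
        = \<Lambda>' * \<Lambda> * (nrm (poly (homog_subst 3 (den f) A B) z))\<^sup>2"
      unfolding wronskian_comp poly_homog_subst_3 hom_quotient(2,3)[OF 1(1)]
      by (simp add: nrm_mult 1(2) 2(2) nrm_power power2_eq_square eval_nat_numeral)
    show "nrm (poly (homog_subst 3 (num f) A B) z / poly (homog_subst 3 (den f) A B) z
        - poly (homog_subst 3 (num f) A B) c / poly (homog_subst 3 (den f) A B) c) \<le> \<Lambda>' * \<Lambda> * nrm (z - c)"
      using val[OF z] val[of c] \<rho> 2(3) mult_left_mono[OF 1(3) \<Lambda>(2)] by simp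
  qed
qed

text \<open>
  The polynomial \<open>A - z B\<close> is small at \<open>c\<close> while its derivative is dominated by the expanding term,
  so Newton's estimate produces a root.
\<close>

lemma expands_fixed_point:
  assumes ex: "expands A B c \<rho> \<Lambda>" and \<Lambda>: "1 < \<Lambda>" and \<rho>: "0 \<le> \<rho>"
    and close: "nrm (poly A c / poly B c - c) \<le> \<Lambda> * \<rho>"
  shows "\<exists>z. nrm (z - c) \<le> \<rho> \<and> poly A z = z * poly B z"
proof -
  let ?R = "A - [:0, 1:] * B" and ?d = "poly A c / poly B c - c"
  have Bc: "poly B c \<noteq> 0"
    using expandsD(1)[OF ex] \<rho> by simp
  then have b: "0 < nrm (poly B c)"
    by (simp add: nrm_pos_iff)
  have W: "nrm (wronskian (A, B) c) = \<Lambda> * (nrm (poly B c))\<^sup>2"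
    using expandsD(2)[OF ex] \<rho> by simp
  \<comment> \<open>Since \<open>B\<close> has no zero on the disc, its derivative at
    \<open>c\<close> is bounded. This keeps the term of the derivative of \<open>A - z B\<close>
    that carries the defect of \<open>c\<close> below the expanding term.\<close>
  have B': "nrm (poly (pderiv B) c) * \<rho> < nrm (poly B c)"
  proof (rule no_root_deriv_bound)
    show "B \<noteq> 0"
      using Bc by (metis poly_0)
  qed (use expandsD(1)[OF ex] \<rho> in auto)
  have R0: "poly ?R c = poly B c * ?d"
    using Bc by (simp add: field_simps)
  have "poly (pderiv ?R) c = wronskian (A, B) c / poly B c - poly B c + poly (pderiv B) c * ?d"
    using Bc by (simp add: wronskian_def pderiv_diff pderiv_mult pderiv_pCons field_simps)
  moreover have "nrm (wronskian (A, B) c / poly B c) = \<Lambda> * nrm (poly B c)"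
    using b by (simp add: nrm_divide W power2_eq_square)
  moreover have "nrm (poly B c) < \<Lambda> * nrm (poly B c)"
    using b \<Lambda> by simp
  moreover have "nrm (poly (pderiv B) c * ?d) < \<Lambda> * nrm (poly B c)"
  proof -
    have "nrm (poly (pderiv B) c * ?d) \<le> nrm (poly (pderiv B) c) * (\<Lambda> * \<rho>)"
      unfolding nrm_mult by (rule mult_left_mono[OF close nrm_nonneg])
    also have "\<dots> = \<Lambda> * (nrm (poly (pderiv B) c) * \<rho>)"
      by simp
    also have "\<dots> < \<Lambda> * nrm (poly B c)"
      using B' \<Lambda> by simp
    finally show ?thesis .
  qed
  ultimately have R1: "nrm (poly (pderiv ?R) c) = \<Lambda> * nrm (poly B c)"
    using nrm_diff_eq2[of "poly B c" "wronskian (A, B) c / poly B c"]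
    by (simp add: nrm_add_eq2)
  have "nrm (poly ?R c) \<le> nrm (poly (pderiv ?R) c) * \<rho>"
    unfolding R0 R1 using mult_left_mono[OF close nrm_nonneg[of "poly B c"]]
    by (simp add: nrm_mult mult_ac)
  then obtain z where "nrm (z - c) \<le> \<rho>" "poly ?R z = 0"
    using newton_root \<rho> by blast
  then show ?thesis
    by auto
qed

text \<open>Take \<open>x\<close> to be the value at \<open>c\<close>. Replacing \<open>A\<close> by
  the numerator \<open>R\<close> of A/B - x leaves the Wronskian unchanged, and \<open>R\<close>
  vanishes at \<open>c\<close>, so the term with the derivative of \<open>B\<close> is
  dominated.\<close>

lemma expandsI:
  fixes A B :: "'a poly" and x :: 'a
  defines "R \<equiv> A - Polynomial.smult x B"
  assumes Rc: "poly R c = 0" and \<beta>: "0 < \<beta>" and \<kappa>: "0 \<le> \<kappa>" and \<rho>: "0 \<le> \<rho>"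
    and disc: "\<And>z. nrm (z - c) \<le> \<rho> \<Longrightarrow> nrm (poly B z) = \<beta> \<and> nrm (poly (pderiv R) z) = \<kappa>
      \<and> nrm (poly R z) \<le> \<kappa> * nrm (z - c) \<and> nrm (z - c) * nrm (poly (pderiv B) z) < \<beta>"
    and \<kappa>0: "0 < \<kappa>"
  shows "expands A B c \<rho> (\<kappa> / \<beta>)"
  unfolding expands_def
proof (intro allI impI conjI)
  fix z
  assume z: "nrm (z - c) \<le> \<rho>"
  note d = disc[OF z]
  have Bz: "poly B z \<noteq> 0" and Bc: "poly B c \<noteq> 0"
    using d disc[of c] \<rho> \<beta> by auto
  show "poly B z \<noteq> 0"
    by (rule Bz)
  have "wronskian (A, B) z = poly (pderiv R) z * poly B z - poly R z * poly (pderiv B) z"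
    by (simp add: wronskian_def R_def pderiv_diff pderiv_smult algebra_simps)
  moreover have "nrm (poly R z * poly (pderiv B) z) < \<kappa> * \<beta>"
  proof -
    have "nrm (poly R z * poly (pderiv B) z) \<le> \<kappa> * nrm (z - c) * nrm (poly (pderiv B) z)"
      unfolding nrm_mult using d by (intro mult_right_mono nrm_nonneg) auto
    also have "\<dots> < \<kappa> * \<beta>"
      using d \<kappa>0 by simp
    finally show ?thesis .
  qed
  ultimately have "nrm (wronskian (A, B) z) = \<kappa> * \<beta>"
    using d by (simp add: nrm_mult nrm_diff_eq2)
  then show "nrm (wronskian (A, B) z) = \<kappa> / \<beta> * (nrm (poly B z))\<^sup>2"
    using d \<beta> by (simp add: power2_eq_square)
  have "poly A c / poly B c = x"
    using Rc Bc by (simp add: R_def)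
  then have "poly A z / poly B z - poly A c / poly B c = poly R z / poly B z"
    using Bz by (simp add: R_def field_simps)
  then show "nrm (poly A z / poly B z - poly A c / poly B c) \<le> \<kappa> / \<beta> * nrm (z - c)"
    using d \<beta> by (simp add: nrm_divide divide_right_mono)
qed

lemma nrm_of_nat_le1: "nrm (of_nat n) \<le> 1"
  using nrm_cst_le1[of "of_nat n"] by (simp add: cst_of_nat)

text \<open>The numerator of f - x has unit derivative at \<open>c\<close>, so the expansion comes
  from the small denominator. Within a radius below its norm all relevant norms are
  constant.\<close>

lemma expands_integral:
  assumes f: "integral f" and c: "nrm c \<le> 1" and x: "nrm x \<le> 1"
    and val: "poly (num f) c = x * poly (den f) c"
    and der: "nrm (poly (pderiv (num f)) c - x * poly (pderiv (den f)) c) = 1"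
    and \<rho>: "0 \<le> \<rho>" "\<rho> < nrm (poly (den f) c)"
  shows "expands (num f) (den f) c \<rho> (1 / nrm (poly (den f) c))"
proof (rule expandsI[where x = x])
  let ?R = "num f - Polynomial.smult x (den f)"
  note co = integral_coeff[OF f]
  have R: "\<forall>i. nrm (poly.coeff ?R i) \<le> 1"
    using co x by (auto intro!: nrm_diff_leI nrm_mult_le1)
  have R': "\<forall>i. nrm (poly.coeff (pderiv ?R) i) \<le> 1"
    using R nrm_of_nat_le1 unfolding coeff_pderiv by (auto intro!: nrm_mult_le1 simp del: of_nat_Suc)
  have B': "\<forall>i. nrm (poly.coeff (pderiv (den f)) i) \<le> 1"
    using co nrm_of_nat_le1 unfolding coeff_pderiv by (auto intro!: nrm_mult_le1 simp del: of_nat_Suc)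
  show Rc: "poly ?R c = 0"
    using val by simp
  show "0 < nrm (poly (den f) c)"
    using \<rho> by simp
  have b1: "nrm (poly (den f) c) \<le> 1"
    by (rule nrm_poly_le1[OF co(2) c])
  fix z
  assume z: "nrm (z - c) \<le> \<rho>"
  have z1: "nrm z \<le> 1"
    using nrm_add_leI[of "z - c" 1 c] z \<rho> b1 c by simp
  show "nrm (poly (den f) z) = nrm (poly (den f) c) \<and> nrm (poly (pderiv ?R) z) = 1
      \<and> nrm (poly ?R z) \<le> 1 * nrm (z - c)
      \<and> nrm (z - c) * nrm (poly (pderiv (den f)) z) < nrm (poly (den f) c)"
  proof (intro conjI)
    show "nrm (poly (den f) z) = nrm (poly (den f) c)"
      using nrm_poly_Lipschitz[OF co(2) z1 c] z \<rho> by (intro nrm_eqI) simp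
    have "nrm (poly (pderiv ?R) c) = 1"
      using der by (simp add: pderiv_diff pderiv_smult)
    then show "nrm (poly (pderiv ?R) z) = 1"
      using nrm_poly_Lipschitz[OF R' z1 c] z \<rho> b1 nrm_eqI[of "poly (pderiv ?R) z" "poly (pderiv ?R) c"]
      by simp
    show "nrm (poly ?R z) \<le> 1 * nrm (z - c)"
      using nrm_poly_Lipschitz[OF R z1 c] Rc by simp
    show "nrm (z - c) * nrm (poly (pderiv (den f)) z) < nrm (poly (den f) c)"
      using mult_left_le[OF nrm_poly_le1[OF B' z1] nrm_nonneg[of "z - c"]] z \<rho> by simp
  qed
qed (use \<rho> in auto)

subsection \<open>Two opposite holes exchanged by a map that is injective on them\<close>

text \<open>Both discs are seen in coordinates around 0: z near the hole 0 and 1/z near the hole at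
  infinity. Each passage expands by the inverse of its small denominator.\<close>

lemma repelling_2_cycle:
  assumes f: "nondeg f" and int: "nrm (P1 f) < 1" "nrm (Q2 f) < 1"
    and ends: "nrm (P0 f) < 1" "nrm (P3 f) < 1" "nrm (Q0 f) < 1" "nrm (Q3 f) < 1"
    and units: "nrm (P2 f) = 1" "nrm (Q1 f) = 1"
  shows "repelling f"
proof -
  \<comment> \<open>\<open>g\<close> is 1/f, with target coordinate at infinity, and
    \<open>h\<close> is v \<mapsto> f(1/v), with source coordinate at infinity; \<open>h\<close>
    after \<open>g\<close> is the second iterate.\<close>
  define g where "g = Cubic (Q0 f) (Q1 f) (Q2 f) (Q3 f) (P0 f) (P1 f) (P2 f) (P3 f)"
  define h where "h = Cubic (P3 f) (P2 f) (P1 f) (P0 f) (Q3 f) (Q2 f) (Q1 f) (Q0 f)"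
  have g: "num g = den f" "den g = num f"
    by (simp_all add: g_def num_def den_def)
  have h: "poly (num h) v = homP f 1 v" "poly (den h) v = homQ f 1 v"
    "wronskian (num h, den h) v = - jac f 1 v" for v
    by (simp_all add: h_def num_def den_def homP_def homQ_def jac_def wronskian_def pderiv_pCons
        expand_simps)
  have intg: "integral g" "integral h"
    using int ends units by (auto simp: integral_def g_def h_def)
  \<comment> \<open>A preimage of 0 near infinity, in the coordinate 1/z. The point \<open>c\<close>
    below is its preimage near 0, so two steps take \<open>c\<close> to 0, and the return defect is
    |c|.\<close>
  obtain v0 where v0: "nrm v0 \<le> nrm (P3 f)" "poly (num h) v0 = 0"
    using newton_root[of "num h" 0 "nrm (P3 f)"] units nrm_nonneg
    by (auto simp: num_def h_def pderiv_pCons)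
  have v0': "nrm v0 < 1"
    using v0(1) ends by linarith
  let ?R = "den f - Polynomial.smult v0 (num f)"
  have "nrm (Q1 f - v0 * P1 f) = 1"
    using nrm_diff_eq2[of "v0 * P1 f" "Q1 f"] nrm_mult_less1[OF v0', of "P1 f"] units int by simp
  moreover have r0: "nrm (Q0 f - v0 * P0 f) < 1"
    using ends v0' by (intro nrm_diff_lessI nrm_mult_less1) auto
  ultimately have "\<exists>c. nrm (c - 0) \<le> nrm (Q0 f - v0 * P0 f) \<and> poly ?R c = 0"
    by (intro newton_root) (simp_all add: nrm_nonneg num_def den_def pderiv_pCons)
  then obtain c where "nrm (c - 0) \<le> nrm (Q0 f - v0 * P0 f)" and Rc: "poly ?R c = 0"
    by blast
  then have c: "nrm c < 1" "poly ?R c = 0"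
    using r0 by simp_all
  have der1: "nrm (poly (pderiv (num g)) c - v0 * poly (pderiv (den g)) c) = 1"
  proof -
    have "poly (pderiv (num g)) c - v0 * poly (pderiv (den g)) c
      = Q1 f - (v0 * P1 f + (v0 * (2 * P2 f + 3 * P3 f * c) * c - (2 * Q2 f + 3 * Q3 f * c) * c))"
      unfolding g by (simp add: num_def den_def pderiv_pCons algebra_simps)
    moreover have "nrm (v0 * P1 f + (v0 * (2 * P2 f + 3 * P3 f * c) * c - (2 * Q2 f + 3 * Q3 f * c) * c)) < 1"
      using c v0' int ends units
      by (intro nrm_diff_lessI nrm_add_lessI nrm_mult_less1' nrm_add_leI nrm_mult_le1) auto
    ultimately show ?thesis
      using units by (simp add: nrm_diff_eq2)
  qed
  have der2: "nrm (poly (pderiv (num h)) v0 - 0 * poly (pderiv (den h)) v0) = 1"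
  proof -
    have "poly (pderiv (num h)) v0 = P2 f + (2 * P1 f + 3 * P0 f * v0) * v0"
      by (simp add: h_def num_def pderiv_pCons algebra_simps)
    moreover have "nrm ((2 * P1 f + 3 * P0 f * v0) * v0) < 1"
      using v0' int ends by (intro nrm_mult_less1' nrm_add_leI nrm_mult_le1) auto
    ultimately show ?thesis
      using units by (simp add: nrm_add_eq2)
  qed
  have "poly (num f) c \<noteq> 0"
    using f[unfolded nondeg_def, rule_format, of c 1] c(2) by (auto simp: homP_1 homQ_1)
  moreover have "poly (den h) v0 \<noteq> 0"
    using f[unfolded nondeg_def, rule_format, of 1 v0] v0(2) by (auto simp: h)
  ultimately have pos: "0 < nrm (poly (den g) c)" "0 < nrm (poly (den h) v0)"
    by (simp_all add: g nrm_pos_iff)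
  define \<pi>1 where "\<pi>1 = nrm (poly (den g) c)"
  define \<pi>2 where "\<pi>2 = nrm (poly (den h) v0)"
  have \<pi>: "0 < \<pi>1" "\<pi>1 < 1" "0 < \<pi>2" "\<pi>2 < 1"
  proof -
    have "poly (den g) c = P0 f + (P1 f + P2 f * c + P3 f * c * c) * c"
      unfolding g by (simp add: num_def algebra_simps)
    moreover have "nrm \<dots> < 1"
      using c int ends units by (intro nrm_add_lessI nrm_mult_less1' nrm_add_leI nrm_mult_le1) auto
    ultimately show "\<pi>1 < 1"
      by (simp add: \<pi>1_def)
    have "poly (den h) v0 = Q3 f + (Q2 f + Q1 f * v0 + Q0 f * v0 * v0) * v0"
      by (simp add: h_def den_def algebra_simps)
    moreover have "nrm \<dots> < 1"
      using v0' int ends units by (intro nrm_add_lessI nrm_mult_less1' nrm_add_leI nrm_mult_le1) auto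
    ultimately show "\<pi>2 < 1"
      by (simp add: \<pi>2_def)
  qed (use pos in \<open>auto simp: \<pi>1_def \<pi>2_def\<close>)
  \<comment> \<open>The smallest radius whose image under the expansion 1 / (\<pi>1 \<pi>2) covers
    the return defect |c|.\<close>
  define \<rho> where "\<rho> = nrm c * \<pi>1 * \<pi>2"
  have \<rho>: "0 \<le> \<rho>" "\<rho> < \<pi>1" "1 / \<pi>1 * \<rho> < \<pi>2" "0 \<le> 1 / \<pi>1 * \<rho>"
  proof -
    have 2: "nrm c * \<pi>2 < \<pi>2"
      using c(1) \<pi> by simp
    then have "nrm c * \<pi>2 < 1"
      using \<pi>(4) by linarith
    then have "\<pi>1 * (nrm c * \<pi>2) < \<pi>1 * 1"
      using \<pi>(1) by (rule mult_strict_left_mono)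
    then show "\<rho> < \<pi>1"
      by (simp add: \<rho>_def mult_ac)
    show "0 \<le> \<rho>" "1 / \<pi>1 * \<rho> < \<pi>2" "0 \<le> 1 / \<pi>1 * \<rho>"
      using \<pi> 2 nrm_nonneg[of c] by (simp_all add: \<rho>_def)
  qed
  have val1: "poly (num g) c = v0 * poly (den g) c"
    using c(2) by (simp add: g)
  have e1: "expands (num g) (den g) c \<rho> (1 / \<pi>1)"
    unfolding \<pi>1_def using c v0' intg val1 der1 \<rho>
    by (intro expands_integral[of g c v0]) (auto simp: \<pi>1_def)
  have gc: "poly (num g) c / poly (den g) c = v0"
    using val1 pos(1) by auto
  have e2: "expands (num h) (den h) v0 (1 / \<pi>1 * \<rho>) (1 / \<pi>2)"
    unfolding \<pi>2_def using v0 v0' intg der2 \<rho>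
    by (intro expands_integral[of h v0 0]) (auto simp: \<pi>2_def)
  let ?A = "homog_subst 3 (num h) (num g) (den g)" and ?B = "homog_subst 3 (den h) (num g) (den g)"
  have e: "expands ?A ?B c \<rho> (1 / \<pi>2 * (1 / \<pi>1))" "poly ?A c / poly ?B c = 0"
    using expands_comp[OF e1, of h "1 / \<pi>2"] e2 \<pi> \<rho> v0 unfolding gc by auto
  have "\<exists>z. nrm (z - c) \<le> \<rho> \<and> poly ?A z = z * poly ?B z"
  proof (rule expands_fixed_point[OF e(1)])
    have "\<pi>2 * \<pi>1 < 1"
      using \<pi> mult_strict_mono[of \<pi>2 1 \<pi>1 1] by simp
    then show "1 < 1 / \<pi>2 * (1 / \<pi>1)"
      using \<pi> by (simp add: less_divide_eq)
    show "nrm (poly ?A c / poly ?B c - c) \<le> 1 / \<pi>2 * (1 / \<pi>1) * \<rho>"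
      unfolding e(2) using \<pi> by (simp add: \<rho>_def)
  qed (rule \<rho>)
  then obtain z where z: "nrm (z - c) \<le> \<rho>" "poly ?A z = z * poly ?B z"
    by blast
  define v where "v = poly (den f) z / poly (num f) z"
  note z1 = expandsD[OF e1 z(1), unfolded gc, unfolded g, folded v_def]
  have vv: "nrm (v - v0) \<le> 1 / \<pi>1 * \<rho>"
    using z1(3) mult_left_mono[OF z(1), of "1 / \<pi>1"] \<pi> by simp
  note z2 = expandsD[OF e2 vv]
  have v_back: "homP f 1 v = z * homQ f 1 v"
  proof -
    have "poly (num f) z ^ 3 * homP f 1 v = z * (poly (num f) z ^ 3 * homQ f 1 v)"
      using z(2) z1(1) unfolding poly_homog_subst_3 g
      by (simp add: hom_quotient h flip: v_def)
    then show ?thesis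
      using z1(1) by simp
  qed
  have small: "nrm z < 1" "nrm v < 1"
    using nrm_add_lessI[of "z - c" 1 c] nrm_add_lessI[of "v - v0" 1 v0] z(1) vv \<rho> \<pi> c(1) v0' by simp_all
  then have zv: "z * v \<noteq> 1"
    using nrm_mult_less1[of z v] by force
  define U where "U i = (if even i then z else 1)" for i :: nat
  define V where "V i = (if even i then 1 else v)" for i :: nat
  define l where "l i = (if even i then poly (num f) z else homQ f 1 v)" for i :: nat
  have "hom_cycle f 2 U V l"
    unfolding hom_cycle_def
  proof (intro conjI allI impI)
    fix i j :: nat
    assume "0 < j" "j < 2"
    then have "j = 1"
      by simp
    then show "U i * V (i + j) \<noteq> U (i + j) * V i"
      using zv by (auto simp: U_def V_def mult.commute)
  qed (use z1(1) v_back in \<open>auto simp: U_def V_def l_def homP_1 homQ_1 v_def\<close>)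
  moreover have "(\<Prod>i<2. nrm (l i))\<^sup>2 < (\<Prod>i<2. nrm (jac f (U i) (V i)))"
  proof -
    have "wronskian (den f, num f) z = - jac f z 1"
      by (simp add: jac_1' wronskian_def)
    then have "nrm (jac f z 1) = 1 / \<pi>1 * (nrm (poly (num f) z))\<^sup>2"
      using z1(2) by simp
    moreover have "nrm (jac f 1 v) = 1 / \<pi>2 * (nrm (homQ f 1 v))\<^sup>2"
      using z2(2) by (simp add: h)
    moreover have "0 < (nrm (poly (num f) z))\<^sup>2 * (nrm (homQ f 1 v))\<^sup>2" (is "0 < ?a")
      using z1(1) z2(1) by (simp add: h nrm_eq_0_iff)
    moreover have "\<pi>1 * \<pi>2 < 1"
      using \<pi> mult_strict_mono[of \<pi>1 1 \<pi>2 1] by simp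
    then have "?a * (\<pi>1 * \<pi>2) < ?a"
      using \<open>0 < ?a\<close> by (metis mult.right_neutral mult_strict_left_mono)
    then have "?a < ?a / (\<pi>1 * \<pi>2)"
      using \<pi> by (simp add: pos_less_divide_eq)
    ultimately show ?thesis
      by (simp add: numeral_2_eq_2 l_def U_def V_def power_mult_distrib mult_ac)
  qed
  ultimately show ?thesis
    unfolding repelling_def by blast
qed

end

subsection \<open>Perturbations of the squaring map\<close>

text \<open>
  For \<open>f = (z - w\<^sub>1) (z - w\<^sub>2) (z - w\<^sub>3) / (z (1 + q z))\<close> the equation \<open>f z = x\<close> reads
  \<open>fibre w\<^sub>1 w\<^sub>2 w\<^sub>3 q x z = 0\<close>.
\<close>

definition fibre :: "'a::field \<Rightarrow> 'a \<Rightarrow> 'a \<Rightarrow> 'a \<Rightarrow> 'a \<Rightarrow> 'a \<Rightarrow> 'a" where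
  "fibre w1 w2 w3 q x z = (z - w1) * (z - w2) * (z - w3) - x * z * (1 + q * z)"

lemma fibre_swap:
  "fibre w1 w2 w3 q x z = fibre w2 w1 w3 q x z" "fibre w1 w2 w3 q x z = fibre w3 w2 w1 q x z"
  by (simp_all add: fibre_def mult_ac)

lemma fibre_vieta:
  assumes "a + b + c = w1 + w2 + w3 + x * q" "a * b + a * c + b * c = w1 * w2 + w1 * w3 + w2 * w3 - x"
    "a * b * c = w1 * w2 * w3"
  shows "fibre w1 w2 w3 q x z = (z - a) * (z - b) * (z - c)"
proof -
  have "(z - a) * (z - b) * (z - c)
      = z ^ 3 - (a + b + c) * z\<^sup>2 + (a * b + a * c + b * c) * z - a * b * c"
    by (simp add: expand_simps)
  then show ?thesis
    unfolding assms by (simp add: fibre_def expand_simps)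
qed

lemma mult_less_le:
  fixes x :: real
  assumes "0 \<le> x" "x < y" "z \<le> y'" "0 < y'"
  shows "x * z < y * y'"
  using assms mult_left_mono[of z y' x] mult_strict_right_mono[of x y y'] by linarith

lemma pair_products:
  fixes x y z :: real
  assumes "0 \<le> x" "x \<le> y" "y \<le> z"
  shows "x * y \<le> y * z" "x * z \<le> y * z"
  using assms mult_left_mono[of x z y] mult_right_mono[of x y z] by (auto simp: mult.commute)

context completed_alg_closure
begin

section \<open>Cubic equations and the sizes of their roots\<close>

lemma nrm_one_add: "nrm x < 1 \<Longrightarrow> nrm (1 + x) = 1"
  by (simp add: nrm_add_eq2)

lemma quadratic_split:
  assumes "a ^ 3 - s * a\<^sup>2 + p * a - d = 0"
  shows "\<exists>b c. a + b + c = s \<and> a * b + a * c + b * c = p \<and> a * b * c = (d :: 'a)"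
proof -
  have "Polynomial.degree [:p - a * (s - a), - (s - a), 1:] = 2"
    by simp
  then obtain b where b: "poly [:p - a * (s - a), - (s - a), 1:] b = 0"
    using poly_root[of "[:p - a * (s - a), - (s - a), 1:]"] by auto
  define c where "c = s - a - b"
  have bc: "b * c = p - a * (s - a)"
    using b by (simp add: c_def algebra_simps)
  show ?thesis
  proof (intro exI conjI)
    show "a + b + c = s"
      by (simp add: c_def)
    have "a * b + a * c + b * c = a * (s - a) + b * c"
      by (simp add: c_def algebra_simps)
    then show "a * b + a * c + b * c = p"
      by (simp add: bc)
    show "a * b * c = d"
      using assms unfolding mult.assoc bc by (simp add: expand_simps)
  qed
qed

text \<open>The ordering key \<open>h\<close> is arbitrary: the norm in some applications, the
  distance to a centroid in another.\<close>

lemma cubic_split: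
  fixes h :: "'a \<Rightarrow> real"
  shows "\<exists>a b c. a + b + c = s \<and> a * b + a * c + b * c = p \<and> a * b * c = d \<and> h a \<le> h b \<and> h b \<le> h c"
proof -
  have "Polynomial.degree [:- d, p, - s, 1:] = 3"
    by simp
  then obtain a where "poly [:- d, p, - s, 1:] a = 0"
    using poly_root[of "[:- d, p, - s, 1:]"] by auto
  then have "a ^ 3 - s * a\<^sup>2 + p * a - d = 0"
    by (simp add: expand_simps)
  then obtain b c where abc: "s = a + b + c" "p = a * b + a * c + b * c" "d = a * b * c"
    using quadratic_split by metis
  show ?thesis
  proof -
    consider "h a \<le> h b \<and> h b \<le> h c" | "h b \<le> h a \<and> h a \<le> h c" | "h a \<le> h c \<and> h c \<le> h b"
      | "h c \<le> h b \<and> h b \<le> h a" | "h b \<le> h c \<and> h c \<le> h a" | "h c \<le> h a \<and> h a \<le> h b"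
      by linarith
    then show ?thesis
    proof cases
      case 1
      then show ?thesis
        by - (rule exI[of _ a], rule exI[of _ b], rule exI[of _ c], simp add: abc algebra_simps)
    next
      case 2
      then show ?thesis
        by - (rule exI[of _ b], rule exI[of _ a], rule exI[of _ c], simp add: abc algebra_simps)
    next
      case 3
      then show ?thesis
        by - (rule exI[of _ a], rule exI[of _ c], rule exI[of _ b], simp add: abc algebra_simps)
    next
      case 4
      then show ?thesis
        by - (rule exI[of _ c], rule exI[of _ b], rule exI[of _ a], simp add: abc algebra_simps)
    next
      case 5
      then show ?thesis
        by - (rule exI[of _ b], rule exI[of _ c], rule exI[of _ a], simp add: abc algebra_simps)
    next
      case 6
      then show ?thesis
        by - (rule exI[of _ c], rule exI[of _ a], rule exI[of _ b], simp add: abc algebra_simps)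
    qed
  qed
qed

text \<open>In an ultrametric sum with cancellation the largest norm occurs at least twice.\<close>

lemma max_pair:
  assumes "nrm a \<le> nrm b" "nrm b \<le> nrm c" "nrm (a + b + c) < nrm c"
  shows "nrm b = nrm c"
proof (rule ccontr)
  assume "nrm b \<noteq> nrm c"
  then have "nrm (a + b) < nrm c"
    using assms by (intro nrm_add_lessI) auto
  then show False
    using assms(3) nrm_add_eq[of "a + b" c] by simp
qed

text \<open>Preimages of a point of norm \<open>r\<close> under a perturbed squaring map: two of
  them have norm sqrt r and are nearly opposite. As 2 is a unit, they are at full distance from each
  other.\<close>

lemma large_roots:
  assumes t: "0 < t" "t < 1" and r: "r = t\<^sup>2"
    and s: "nrm (a + b + c) \<le> r" and p: "nrm (a * b + a * c + b * c) = r" and d: "nrm (a * b * c) \<le> r ^ 3"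
    and ord: "nrm a \<le> nrm b" "nrm b \<le> nrm c"
  shows "nrm b = t" "nrm c = t" "nrm a < t" "nrm (b - c) = t"
proof -
  have r01: "0 < r" "r < t" "r\<^sup>2 < t"
  proof -
    show "0 < r" "r < t"
      using t by (simp_all add: r power2_eq_square)
    then show "r\<^sup>2 < t"
      using t mult_strict_mono[of r t r 1] by (simp add: power2_eq_square)
  qed
  have c: "nrm c \<le> t"
  proof (rule ccontr)
    assume "\<not> ?thesis"
    then have c: "t < nrm c"
      by simp
    have bc: "nrm b = nrm c"
      by (rule max_pair) (use ord s r01 c in auto)
    have c2: "r < (nrm c)\<^sup>2"
      using c t unfolding r by (intro power_strict_mono) auto
    have "nrm a * r \<le> nrm a * (nrm c)\<^sup>2"
      using c2 nrm_nonneg by (intro mult_left_mono) auto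
    also have "\<dots> \<le> r\<^sup>2 * r"
      using d by (simp add: nrm_mult bc power2_eq_square power3_eq_cube mult.assoc)
    finally have "nrm a < nrm c"
      using r01 c by simp
    moreover have "nrm (b + c) \<le> nrm c"
      using bc by (intro nrm_add_leI) auto
    ultimately have "nrm (a * (b + c)) < nrm (b * c)"
      using nrm_nonneg c t unfolding nrm_mult bc by (intro mult_less_le) auto
    then have "nrm (a * (b + c) + b * c) = (nrm c)\<^sup>2"
      by (simp add: nrm_add_eq nrm_mult bc power2_eq_square)
    then show False
      using p c2 by (simp add: algebra_simps)
  qed
  have b: "t \<le> nrm b"
  proof (rule ccontr)
    assume "\<not> ?thesis"
    then have b: "nrm b < t"
      by simp
    have bc: "nrm b * nrm c < r"
      using mult_left_mono[OF c nrm_nonneg[of b]] mult_strict_right_mono[OF b t(1)]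
      unfolding r power2_eq_square by linarith
    moreover have "nrm a * nrm b \<le> nrm b * nrm c" "nrm a * nrm c \<le> nrm b * nrm c"
      using ord nrm_nonneg by (intro pair_products; simp)+
    ultimately have "nrm (a * b + a * c + b * c) < r"
      by (intro nrm_add_lessI) (simp_all add: nrm_mult)
    then show False
      using p by simp
  qed
  show b': "nrm b = t" and c': "nrm c = t"
    using b c ord by auto
  have "nrm a * r \<le> r\<^sup>2 * r"
    using d by (simp add: nrm_mult b' c' r power2_eq_square power3_eq_cube mult.assoc)
  then show a: "nrm a < t"
    using r01 by simp
  have "nrm (b + c) < t"
    using nrm_diff_lessI[of "a + b + c" t a] s r01 a by simp
  then have "nrm (2 * b - (b + c)) = t"
    using nrm_diff_eq2[of "b + c" "2 * b"] by (simp add: nrm_mult b')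
  then show "nrm (b - c) = t"
    by (simp add: algebra_simps)
qed

text \<open>Preimages of a point of norm \<open>t\<close>: near the pole 0 the map behaves like a
  constant of norm \<open>m\<close> divided by z, hence a root of norm \<open>m / t\<close>. About
  the other two only the lower bounds and the product matter.\<close>

lemma small_root:
  assumes t: "0 < t" "t < 1" and s: "nrm (a + b + c) \<le> 1" and p: "nrm (a * b + a * c + b * c) = t"
    and d: "nrm (a * b * c) = m" "m < t\<^sup>2" "0 < m" and ord: "nrm a \<le> nrm b" "nrm b \<le> nrm c"
  shows "nrm a = m / t" "nrm b * nrm c = t" "t \<le> nrm b" "t \<le> nrm c"
proof -
  have abc: "nrm a * (nrm b * nrm c) = m"
    using d(1) by (simp add: nrm_mult mult.assoc)
  have t2: "t\<^sup>2 < 1"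
    using t by (simp add: power_less_one_iff)
  have c: "nrm c \<le> 1"
  proof (rule ccontr)
    assume "\<not> ?thesis"
    then have c: "1 < nrm c"
      by simp
    have bc: "nrm b = nrm c"
      by (rule max_pair) (use ord s c in auto)
    have c2: "1 < nrm c * nrm c"
      using c by (metis mult_strict_mono mult.right_neutral less_trans zero_less_one less_imp_le)
    have "nrm a * 1 \<le> nrm a * (nrm c * nrm c)"
      using c2 nrm_nonneg by (intro mult_left_mono) auto
    then have "nrm a < nrm c"
      using abc d t2 c by (simp add: bc)
    moreover have "nrm (b + c) \<le> nrm c"
      using bc by (intro nrm_add_leI) auto
    ultimately have "nrm (a * (b + c)) < nrm (b * c)"
      using nrm_nonneg c unfolding nrm_mult bc by (intro mult_less_le) auto
    then have "nrm (a * (b + c) + b * c) = nrm c * nrm c"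
      by (simp add: nrm_add_eq nrm_mult bc)
    then show False
      using p t c2 by (simp add: algebra_simps)
  qed
  have "nrm a * nrm b \<le> nrm b * nrm c" "nrm a * nrm c \<le> nrm b * nrm c"
    using ord nrm_nonneg by (intro pair_products; simp)+
  then have bct: "t \<le> nrm b * nrm c"
    unfolding p[symmetric] by (intro nrm_add_leI) (simp_all add: nrm_mult)
  have "nrm a * t \<le> nrm a * (nrm b * nrm c)"
    using bct nrm_nonneg by (intro mult_left_mono) auto
  then have "nrm a * t < t * t"
    using abc d by (simp add: power2_eq_square)
  then have a: "nrm a < t"
    using t by simp
  have "nrm (b + c) \<le> 1"
    using c ord by (intro nrm_add_leI) auto
  then have "nrm (a * (b + c)) < nrm (b * c)"
    using a bct mult_left_le[of "nrm (b + c)" "nrm a"] nrm_nonneg by (simp add: nrm_mult)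
  then have "nrm (a * (b + c) + b * c) = nrm b * nrm c"
    by (simp add: nrm_add_eq nrm_mult)
  then show bc: "nrm b * nrm c = t"
    using p by (simp add: algebra_simps)
  then show "nrm a = m / t"
    using abc t by (simp add: field_simps)
  show "t \<le> nrm b"
    using bc c mult_left_le[OF c nrm_nonneg[of b]] by simp
  then show "t \<le> nrm c"
    using ord by simp
qed

text \<open>
  The point \<open>w\<close> is a preimage of \<open>x\<close>, close to \<open>u\<close>, that is well separated from the other preimages;
  the last condition makes the constructed cycle repelling.
\<close>

definition good_preimage :: "('a \<Rightarrow> 'a) \<Rightarrow> real \<Rightarrow> real \<Rightarrow> 'a \<Rightarrow> bool" where
  "good_preimage C r \<theta> u \<longleftrightarrow> (\<exists>w a b. (\<forall>z. C z = (z - w) * (z - a) * (z - b)) \<and> nrm (w - u) < r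
     \<and> nrm (w - u) \<le> nrm (w - a) \<and> nrm (w - u) \<le> nrm (w - b) \<and> \<theta> < nrm (w - a) * nrm (w - b))"

section \<open>Well separated preimages of a point close to the pole\<close>

lemma fibre_root_split:
  fixes w1 :: 'a
  assumes "fibre w1 w2 w3 q x a = 0"
  shows "\<exists>b c. a + b + c = w1 + w2 + w3 + x * q
    \<and> a * b + a * c + b * c = w1 * w2 + w1 * w3 + w2 * w3 - x \<and> (\<forall>z. fibre w1 w2 w3 q x z = (z - a) * (z - b) * (z - c))"
proof -
  have "a ^ 3 - (w1 + w2 + w3 + x * q) * a\<^sup>2 + (w1 * w2 + w1 * w3 + w2 * w3 - x) * a - w1 * w2 * w3 = 0"
    using assms by (simp add: fibre_def expand_simps)
  from quadratic_split[OF this] show ?thesis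
    using fibre_vieta by blast
qed

lemma fibre_newton:
  assumes "nrm (fibre u v s q x u) \<le> nrm ((u - v) * (u - s) - x * (1 + 2 * q * u)) * \<rho>" "0 \<le> \<rho>"
  shows "\<exists>w. nrm (w - u) \<le> \<rho> \<and> fibre u v s q x w = 0"
proof -
  let ?p = "[:- (u * v * s), u * v + u * s + v * s - x, - (u + v + s + x * q), 1:]"
  have p: "poly ?p z = fibre u v s q x z" for z
    by (simp add: fibre_def algebra_simps)
  have "poly (pderiv ?p) u = (u - v) * (u - s) - x * (1 + 2 * q * u)"
    by (simp add: pderiv_pCons algebra_simps)
  then show ?thesis
    using newton_root[of ?p u \<rho>] assms unfolding p by simp
qed

text \<open>Newton's estimate moves the zero \<open>u\<close> of \<open>f\<close> by at most
  \<theta> r / \<gamma> < \<delta>, so \<open>w\<close> keeps its distances to \<open>v\<close> and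
  \<open>s\<close>. Vieta's formulas then control sum and product of \<open>w - a\<close> and
  \<open>w - b\<close>. Here every \<open>x\<close> of norm \<theta> is admissible.\<close>

lemma good_preimage_isolated:
  assumes r: "nrm u = r" "nrm v \<le> r" "nrm s \<le> r" "r < 1" and q: "nrm q \<le> 1" and x: "nrm x = \<theta>"
    and \<delta>: "\<delta> \<le> nrm (u - v)" "\<delta> \<le> nrm (u - s)" "0 \<le> \<delta>"
    and big: "\<theta> * r < nrm (u - v) * nrm (u - s) * \<delta>"
  shows "good_preimage (fibre u v s q x) r \<theta> u"
proof -
  define \<gamma> where "\<gamma> = nrm (u - v) * nrm (u - s)"
  have \<theta>0: "0 \<le> \<theta>" and r0: "0 \<le> r"
    using x r nrm_nonneg by auto
  have le: "nrm (u - v) \<le> r" "nrm (u - s) \<le> r"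
    using r by (auto intro: nrm_diff_leI)
  have pos: "0 < \<gamma>" "0 < \<delta>" "0 < r"
  proof -
    have "0 < \<gamma> * \<delta>"
      using big mult_nonneg_nonneg[OF \<theta>0 r0] by (simp add: \<gamma>_def)
    then show "0 < \<gamma>" "0 < \<delta>"
      using \<delta>(3) by (auto simp: zero_less_mult_iff)
    then show "0 < r"
      using \<delta> le by linarith
  qed
  have \<gamma>: "\<theta> < \<gamma>"
  proof -
    have "\<gamma> * \<delta> \<le> \<gamma> * r"
      using pos \<delta> le by (intro mult_left_mono) auto
    then have "\<theta> * r < \<gamma> * r"
      using big by (simp add: \<gamma>_def)
    then show ?thesis
      using pos by simp
  qed
  have n1: "nrm (1 + q * z) = 1" "nrm (1 + 2 * q * z) = 1" if "nrm z \<le> r" for z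
    using that q r by (auto intro!: nrm_one_add nrm_mult_less1' simp: mult.assoc)
  have "nrm ((u - v) * (u - s) - x * (1 + 2 * q * u)) = \<gamma>"
    using \<gamma> n1(2)[of u] r x by (subst nrm_diff_eq2) (simp_all add: nrm_mult \<gamma>_def)
  moreover have "nrm (fibre u v s q x u) = \<theta> * r"
    using n1(1)[of u] r x by (simp add: fibre_def nrm_mult)
  ultimately obtain w where w: "nrm (w - u) \<le> \<theta> * r / \<gamma>" "fibre u v s q x w = 0"
    using fibre_newton[of u v s q x "\<theta> * r / \<gamma>"] \<theta>0 r0 pos by auto
  have wu: "nrm (w - u) < \<delta>"
  proof -
    have "\<theta> * r / \<gamma> < \<delta>"
      using big pos by (simp add: pos_divide_less_eq \<gamma>_def mult_ac)
    with w(1) show ?thesis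
      by simp
  qed
  have wr: "nrm (w - u) < r" "nrm w \<le> r"
    using wu \<delta> le nrm_add_leI[of "w - u" r u] r by auto
  have wv: "nrm (w - v) = nrm (u - v)" "nrm (w - s) = nrm (u - s)"
    using nrm_eqI[of "w - v" "u - v"] nrm_eqI[of "w - s" "u - s"] wu \<delta> by auto
  obtain a b where ab: "w + a + b = u + v + s + x * q"
    "w * a + w * b + a * b = u * v + u * s + v * s - x"
    "\<And>z. fibre u v s q x z = (z - w) * (z - a) * (z - b)"
    using fibre_root_split[OF w(2)] by blast
  have sum: "(w - a) + (w - b) = (w - u) + (w - v) + (w - s) - x * q"
    using ab(1) by (simp add: algebra_simps)
  have prod: "(w - a) * (w - b) = (w - v) * (w - s) + ((w - u) * ((w - v) + (w - s)) - x * (1 + 2 * q * w))"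
  proof -
    have e1: "a + b = u + v + s + x * q - w"
      using ab(1) by (simp add: algebra_simps)
    have e2: "a * b = u * v + u * s + v * s - x - w * (a + b)"
      using ab(2) by (simp add: algebra_simps)
    have "(w - a) * (w - b) = w * w - w * (a + b) + a * b"
      by (simp add: algebra_simps)
    also have "\<dots> = w * w - w * (u + v + s + x * q - w)
        + (u * v + u * s + v * s - x - w * (u + v + s + x * q - w))"
      by (simp only: e2) (simp only: e1)
    also have "\<dots> = (w - v) * (w - s) + ((w - u) * ((w - v) + (w - s)) - x * (1 + 2 * q * w))"
      by (simp add: algebra_simps)
    finally show ?thesis .
  qed
  define \<Delta> where "\<Delta> = max (nrm (u - v)) (nrm (u - s))"
  have \<gamma>\<Delta>: "\<gamma> \<ge> \<delta> * \<Delta>" "\<theta> \<le> \<Delta>" "\<delta> \<le> \<Delta>"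
  proof -
    show "\<gamma> \<ge> \<delta> * \<Delta>" "\<delta> \<le> \<Delta>"
      using \<delta> mult_right_mono[OF \<delta>(1) nrm_nonneg[of "u - s"]] mult_right_mono[OF \<delta>(2) nrm_nonneg[of "u - v"]]
      by (auto simp: \<gamma>_def \<Delta>_def max_def mult.commute)
    have "\<gamma> \<le> \<Delta> * 1"
      unfolding \<gamma>_def \<Delta>_def using le r nrm_nonneg by (intro mult_mono) (auto simp: max_def)
    then show "\<theta> \<le> \<Delta>"
      using \<gamma> by simp
  qed
  have vs: "nrm ((w - v) + (w - s)) \<le> \<Delta>"
    by (rule nrm_add_leI) (simp_all add: wv \<Delta>_def)
  have "nrm ((w - u) * ((w - v) + (w - s))) < \<gamma>"
  proof -
    have "nrm ((w - u) * ((w - v) + (w - s))) \<le> nrm (w - u) * \<Delta>"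
      unfolding nrm_mult using vs nrm_nonneg by (intro mult_left_mono) auto
    also have "\<dots> < \<delta> * \<Delta>"
      using wu pos \<gamma>\<Delta> by (intro mult_strict_right_mono) auto
    finally show ?thesis
      using \<gamma>\<Delta> by simp
  qed
  then have "nrm ((w - u) * ((w - v) + (w - s)) - x * (1 + 2 * q * w)) < \<gamma>"
    using \<gamma> n1(2)[OF wr(2)] x by (intro nrm_diff_lessI) (simp_all add: nrm_mult)
  then have P: "nrm (w - a) * nrm (w - b) = \<gamma>"
    using prod nrm_add_eq2[of "(w - u) * ((w - v) + (w - s)) - x * (1 + 2 * q * w)" "(w - v) * (w - s)"]
    by (simp add: wv \<gamma>_def flip: nrm_mult) (simp add: wv nrm_mult)
  have S: "nrm ((w - a) + (w - b)) \<le> \<Delta>"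
  proof -
    have "nrm (w - u) \<le> \<Delta>" "nrm (w - v) \<le> \<Delta>" "nrm (w - s) \<le> \<Delta>"
      using wu \<gamma>\<Delta> by (simp_all add: wv \<Delta>_def)
    moreover have "nrm (x * q) \<le> \<Delta>"
      using \<gamma>\<Delta> x mult_left_le[OF q \<theta>0] by (simp add: nrm_mult)
    ultimately show ?thesis
      unfolding sum by (intro nrm_diff_leI[OF nrm_add_leI[OF nrm_add_leI]])
  qed
  \<comment> \<open>If one of two numbers were below \<delta>, the product \<gamma> \<ge> \<delta>
    \<Delta> would force the other above \<Delta>, and then also the sum.\<close>
  have far: "\<delta> \<le> nrm y" if "nrm y * nrm y' = \<gamma>" "nrm (y + y') \<le> \<Delta>" for y y'
  proof (rule ccontr)
    assume "\<not> ?thesis"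
    then have y: "nrm y < \<delta>"
      by simp
    have "\<Delta> < nrm y'"
    proof (rule ccontr)
      assume "\<not> ?thesis"
      then have "nrm y * nrm y' \<le> nrm y * \<Delta>"
        using nrm_nonneg by (intro mult_left_mono) auto
      also have "\<dots> < \<delta> * \<Delta>"
        using y pos \<gamma>\<Delta> by (intro mult_strict_right_mono) auto
      finally show False
        using that(1) \<gamma>\<Delta> by simp
    qed
    then have "nrm (y + y') = nrm y'"
      using y \<gamma>\<Delta> by (intro nrm_add_eq) auto
    then show False
      using that(2) \<open>\<Delta> < nrm y'\<close> by simp
  qed
  have "\<delta> \<le> nrm (w - a)" "\<delta> \<le> nrm (w - b)"
    using far[OF P S] far[of "w - b" "w - a"] P S by (simp_all add: mult.commute add.commute)
  then show ?thesis
    unfolding good_preimage_def using ab(3) wr wu P \<gamma> by (intro exI[of _ w] exI[of _ a] exI[of _ b]) auto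
qed

text \<open>Two zeros are too close to be told apart at scale \<kappa> = sqrt \<theta>. The lower
  bound at their midpoint \<open>n\<close> excludes a nearly double root: \<open>n - b\<close> and
  \<open>n - c\<close> almost cancel, but their product is at least \<theta> in norm, so
  \<open>b\<close> and \<open>c\<close> are at least \<kappa> apart. One of them is within \<kappa>
  of \<open>w3\<close>.\<close>

lemma good_preimage_pair:
  assumes r: "nrm w1 < r" "nrm w2 = r" "nrm w3 = r" "r < 1" and q: "nrm q \<le> 1" and x: "nrm x = \<theta>"
    and \<theta>: "0 < \<theta>" "\<theta> < r\<^sup>2" and close: "(nrm (w2 - w3))\<^sup>2 \<le> \<theta>"
    and n: "n = (w2 + w3) / 2" "\<theta> * r \<le> nrm (fibre w1 w2 w3 q x n)"
  shows "good_preimage (fibre w1 w2 w3 q x) r \<theta> w3"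
proof -
  have r0: "0 < r"
    using r nrm_nonneg[of w1] by linarith
  define \<kappa> where "\<kappa> = sqrt \<theta>"
  have \<kappa>: "\<kappa> * \<kappa> = \<theta>" "0 < \<kappa>" "\<kappa> < r" "\<theta> < \<kappa>" "nrm (w2 - w3) \<le> \<kappa>"
  proof -
    show "\<kappa> * \<kappa> = \<theta>" "0 < \<kappa>"
      using \<theta> by (simp_all add: \<kappa>_def)
    show \<kappa>r: "\<kappa> < r"
      using \<theta> r0 by (simp add: \<kappa>_def real_less_lsqrt)
    show "\<theta> < \<kappa>"
      using \<kappa>r r \<open>0 < \<kappa>\<close> mult_strict_left_mono[of \<kappa> 1 \<kappa>] unfolding \<open>\<kappa> * \<kappa> = \<theta>\<close> by simp
    show "nrm (w2 - w3) \<le> \<kappa>"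
      using close by (simp add: \<kappa>_def real_le_rsqrt)
  qed
  have "n - w3 = (w2 - w3) / 2"
    by (simp add: n field_simps)
  then have "nrm (n - w3) = nrm (w2 - w3)"
    by (simp only: nrm_divide) simp
  then have "nrm (n - w3) < nrm w3"
    using \<kappa> r by linarith
  then have nr: "nrm n = r"
    using nrm_eqI r by metis
  have n1: "nrm (1 + q * z) = 1" "nrm (1 + 2 * q * z) = 1" if "nrm z \<le> r" for z
    using that q r by (auto intro!: nrm_one_add nrm_mult_less1' simp: mult.assoc)
  have w12: "nrm (w1 - w2) = r" "nrm (w1 - w3) = r"
    using r by (simp_all add: nrm_diff_eq)
  have "nrm ((w1 - w2) * (w1 - w3) - x * (1 + 2 * q * w1)) = r\<^sup>2"
    using \<theta> n1(2)[of w1] r x w12 by (subst nrm_diff_eq2) (simp_all add: nrm_mult power2_eq_square)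
  moreover have "nrm (fibre w1 w2 w3 q x w1) = \<theta> * nrm w1"
    using n1(1)[of w1] r x by (simp add: fibre_def nrm_mult)
  ultimately obtain a where a: "nrm (a - w1) \<le> \<theta> * nrm w1 / r\<^sup>2" "fibre w1 w2 w3 q x a = 0"
    using fibre_newton[of w1 w2 w3 q x "\<theta> * nrm w1 / r\<^sup>2"] \<theta> r0 nrm_nonneg[of w1] by auto
  have aw: "nrm (a - w1) < \<kappa>"
  proof -
    have "\<kappa> * nrm w1 < r * r"
      using \<kappa> r nrm_nonneg by (intro mult_strict_mono) auto
    then have "\<kappa> * (\<kappa> * nrm w1) < \<kappa> * r\<^sup>2"
      using \<kappa> by (simp add: power2_eq_square)
    then have "\<theta> * nrm w1 / r\<^sup>2 < \<kappa>"
      using r0 by (simp add: pos_divide_less_eq mult.assoc flip: \<kappa>(1))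
    with a(1) show ?thesis
      by simp
  qed
  have ar: "nrm a < r"
    using nrm_add_lessI[of "a - w1" r w1] aw \<kappa> r by simp
  obtain b c where bc: "a + b + c = w1 + w2 + w3 + x * q"
    "\<And>z. fibre w1 w2 w3 q x z = (z - a) * (z - b) * (z - c)"
    using fibre_root_split[OF a(2)] by blast
  have "(n - b) + (n - c) = (a - w1) - x * q"
    using bc(1) by (simp add: n algebra_simps)
  moreover have "nrm (x * q) < \<kappa>"
    using mult_left_le[OF q, of \<theta>] \<kappa>(4) \<theta> unfolding nrm_mult x by linarith
  ultimately have sum: "nrm ((n - b) + (n - c)) < \<kappa>"
    using aw by (simp add: nrm_diff_lessI)
  have na: "nrm (n - a) = r"
    using ar nr by (simp add: nrm_diff_eq2)
  have "\<kappa> * \<kappa> * r \<le> nrm (n - b) * nrm (n - c) * r"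
    using n(2) unfolding bc(2) by (simp add: nrm_mult na mult_ac \<kappa>(1))
  then have prod: "\<kappa> * \<kappa> \<le> nrm (n - b) * nrm (n - c)"
    using r0 by simp
  have big: "\<kappa> \<le> nrm y" if "nrm (y + y') < \<kappa>" "\<kappa> * \<kappa> \<le> nrm y * nrm y'" for y y'
  proof (rule ccontr)
    assume "\<not> ?thesis"
    then have y: "nrm y < \<kappa>"
      by simp
    then have "nrm y' < \<kappa>"
      using that(1) nrm_diff_lessI[of "y + y'" \<kappa> y] by simp
    then have "nrm y * nrm y' < \<kappa> * \<kappa>"
      using y nrm_nonneg by (intro mult_strict_mono') auto
    then show False
      using that(2) by simp
  qed
  have nb: "\<kappa> \<le> nrm (n - b)"
    by (rule big[OF sum prod])
  \<comment> \<open>Two nearly opposite elements differ by about twice one of them, and 2 is a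
    unit.\<close>
  have dd: "nrm (y - y') = nrm y" if "nrm (y + y') < nrm y" for y y'
    using nrm_diff_eq2[of "y + y'" "2 * y"] that by (simp add: nrm_mult)
  have "nrm ((n - b) - (n - c)) = nrm (n - b)"
    by (rule dd[OF less_le_trans[OF sum nb]])
  then have R: "\<kappa> \<le> nrm (b - c)"
    using nb nrm_commute[of b c] by simp
  have "nrm (w3 - a) = r"
    using ar r by (simp add: nrm_diff_eq2)
  moreover have "nrm (fibre w1 w2 w3 q x w3) = \<theta> * r"
    using n1(1)[of w3] r x by (simp add: fibre_def nrm_mult)
  ultimately have w3bc: "nrm (w3 - b) * nrm (w3 - c) = \<kappa> * \<kappa>"
    using r0 unfolding bc(2) by (simp add: nrm_mult \<kappa>(1) mult_ac)
  have fin: "good_preimage (fibre w1 w2 w3 q x) r \<theta> w3"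
    if z: "\<And>z. fibre w1 w2 w3 q x z = (z - w) * (z - w') * (z - a)"
      and "\<kappa> \<le> nrm (w - w')" "nrm (w - w3) \<le> \<kappa>" for w w'
  proof -
    have "nrm w = r"
      using nrm_eqI[of w w3] that \<kappa> r by simp
    then have wa: "nrm (w - a) = r"
      using ar by (simp add: nrm_diff_eq2)
    have "\<theta> < \<kappa> * r"
      using \<kappa> by (simp flip: \<kappa>(1))
    also have "\<dots> \<le> nrm (w - w') * nrm (w - a)"
      unfolding wa using that r0 by (intro mult_right_mono) auto
    finally have th: "\<theta> < nrm (w - w') * nrm (w - a)" .
    show ?thesis
      unfolding good_preimage_def
      by (rule exI[of _ w], rule exI[of _ w'], rule exI[of _ a]) (use z that th wa \<kappa> in auto)
  qed
  show ?thesis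
  proof (cases "nrm (w3 - b) \<le> \<kappa>")
    case True
    show ?thesis
      by (rule fin[of b c]) (use True R nrm_commute[of b w3] bc(2) in \<open>auto simp: mult_ac\<close>)
  next
    case False
    have "nrm (w3 - c) \<le> \<kappa>"
    proof (rule ccontr)
      assume "\<not> ?thesis"
      then have "\<kappa> * \<kappa> < nrm (w3 - b) * nrm (w3 - c)"
        using False \<kappa> by (intro mult_strict_mono) auto
      then show False
        using w3bc by simp
    qed
    then show ?thesis
      by (intro fin[of c b]) (use R nrm_commute[of b c] nrm_commute[of c w3] bc(2) in \<open>auto simp: mult_ac\<close>)
  qed
qed

lemma nrm_mean_close:
  assumes close: "nrm (w1 - w2) \<le> \<kappa>" "nrm (w1 - w3) \<le> \<kappa>" "nrm (w2 - w3) \<le> \<kappa>"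
  shows "nrm ((w1 + w2 + w3) / 3 - w3) \<le> \<kappa>" "nrm ((w1 + w2 + w3) / 3 - w2) \<le> \<kappa>"
    "nrm ((w1 + w2 + w3) / 3 - w1) \<le> \<kappa>"
proof -
  let ?n = "(w1 + w2 + w3) / 3"
  have "?n - w3 = ((w1 - w3) + (w2 - w3)) / 3" "?n - w2 = ((w1 - w2) - (w2 - w3)) / 3"
    "?n - w1 = - ((w1 - w2) + (w1 - w3)) / 3"
    by (simp_all add: field_simps)
  then have "nrm (?n - w3) = nrm ((w1 - w3) + (w2 - w3))" "nrm (?n - w2) = nrm ((w1 - w2) - (w2 - w3))"
    "nrm (?n - w1) = nrm ((w1 - w2) + (w1 - w3))"
    by (simp_all only: nrm_divide nrm_uminus nrm_numeral div_by_1)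
  then show "nrm (?n - w3) \<le> \<kappa>" "nrm (?n - w2) \<le> \<kappa>" "nrm (?n - w1) \<le> \<kappa>"
    using nrm_add_leI[OF close(2,3)] nrm_diff_leI[OF close(1,3)] nrm_add_leI[OF close(1,2)] by simp_all
qed

lemma good_preimage_triple:
  assumes r: "nrm w1 = r" "nrm w2 = r" "nrm w3 = r" "r < 1" and q: "nrm q \<le> 1" and x: "nrm x = \<theta>"
    and \<theta>: "0 < \<theta>" "\<theta> < r\<^sup>2" and \<kappa>3: "\<kappa> ^ 3 = \<theta> * r" "0 < \<kappa>"
    and close: "nrm (w1 - w2) \<le> \<kappa>" "nrm (w1 - w3) \<le> \<kappa>" "nrm (w2 - w3) \<le> \<kappa>"
    and n: "n = (w1 + w2 + w3) / 3" "nrm (fibre w1 w2 w3 q x n) = \<theta> * r"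
  shows "good_preimage (fibre w1 w2 w3 q x) r \<theta> w3"
proof -
  have r0: "0 < r"
    using r nrm_nonneg[of w1] \<theta> by (cases "r = 0") auto
  have \<kappa>: "\<kappa> < r" "\<theta> < \<kappa>" "\<theta> < \<kappa>\<^sup>2"
  proof -
    have "\<kappa> ^ 3 < r ^ 3"
      unfolding \<kappa>3 using \<theta> r0 by (simp add: power3_eq_cube power2_eq_square)
    then show \<kappa>r: "\<kappa> < r"
      using r0 by (intro power_less_imp_less_base[of \<kappa> 3 r]) auto
    have "\<theta> * r < \<kappa>\<^sup>2 * r"
      using \<kappa>r \<kappa>3(2) unfolding \<kappa>3(1)[symmetric] by (simp add: power2_eq_square power3_eq_cube)
    then show "\<theta> < \<kappa>\<^sup>2"
      using r0 by simp
    also have "\<kappa>\<^sup>2 < \<kappa>"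
      using \<kappa>r r(4) \<kappa>3(2) by (simp add: power2_eq_square)
    finally show "\<theta> < \<kappa>" .
  qed
  note nw = nrm_mean_close[OF close, folded n(1)]
  have nr: "nrm n = r"
    using nrm_eqI[of n w3] nw \<kappa> r by simp
  have n1: "nrm (1 + 2 * q * n) = 1"
    using nr q r by (auto intro!: nrm_one_add nrm_mult_less1' simp: mult.assoc)
  obtain a b c where abc: "a + b + c = w1 + w2 + w3 + x * q"
    "a * b + a * c + b * c = w1 * w2 + w1 * w3 + w2 * w3 - x" "a * b * c = w1 * w2 * w3"
    and ord: "nrm (n - a) \<le> nrm (n - b)" "nrm (n - b) \<le> nrm (n - c)"
    using cubic_split[of "w1 + w2 + w3 + x * q" "w1 * w2 + w1 * w3 + w2 * w3 - x" "w1 * w2 * w3" "\<lambda>z. nrm (n - z)"]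
    by blast
  have C: "fibre w1 w2 w3 q x z = (z - a) * (z - b) * (z - c)" for z
    by (rule fibre_vieta[OF abc])
  define M where "M = nrm (n - c)"
  have "(n - a) + (n - b) + (n - c) = 3 * n - (a + b + c)"
    by (simp add: algebra_simps)
  also have "\<dots> = - (x * q)"
  proof -
    have "3 * n = w1 + w2 + w3"
      by (simp add: n)
    then show ?thesis
      unfolding abc by simp
  qed
  finally have "nrm ((n - a) + (n - b) + (n - c)) \<le> \<theta>"
    using x q \<theta> mult_left_le[of "nrm q" \<theta>] by (simp add: nrm_mult)
  then have sum: "nrm ((n - a) + (n - b) + (n - c)) < \<kappa>"
    using \<kappa> by simp
  have prod: "nrm (n - a) * nrm (n - b) * M = \<kappa> ^ 3"
    using n(2) unfolding C by (simp add: nrm_mult M_def \<kappa>3)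
  have \<kappa>M: "\<kappa> \<le> M"
  proof (rule ccontr)
    assume "\<not> ?thesis"
    then have "nrm (n - a) < \<kappa>" "nrm (n - b) < \<kappa>" "M < \<kappa>"
      using ord by (auto simp: M_def)
    then have "nrm (n - a) * nrm (n - b) * M < \<kappa> * \<kappa> * \<kappa>"
      using nrm_nonneg by (intro mult_strict_mono') (auto simp: M_def)
    then show False
      using prod by (simp add: power3_eq_cube)
  qed
  have bM: "nrm (n - b) = M"
    unfolding M_def by (rule max_pair[OF ord]) (use sum \<kappa>M in \<open>simp add: M_def\<close>)
  have pairs: "nrm ((n - a) * (n - b) + (n - a) * (n - c) + (n - b) * (n - c)) < r\<^sup>2"
  proof -
    have "(n - a) * (n - b) + (n - a) * (n - c) + (n - b) * (n - c)
        = 3 * n * n - 2 * n * (a + b + c) + (a * b + a * c + b * c)"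
      by (simp add: algebra_simps)
    also have "\<dots> = (n - w1) * (n - w2) + (n - w1) * (n - w3) + (n - w2) * (n - w3) - x * (1 + 2 * q * n)"
      unfolding abc by (simp add: algebra_simps)
    finally have eq: "(n - a) * (n - b) + (n - a) * (n - c) + (n - b) * (n - c) = \<dots>" .
    have "\<kappa> * \<kappa> < r * r"
      using \<kappa> \<kappa>3(2) by (intro mult_strict_mono) auto
    then have "nrm y * nrm y' < r\<^sup>2" if "nrm y \<le> \<kappa>" "nrm y' \<le> \<kappa>" for y y'
      using mult_mono[OF that] \<kappa>3(2) nrm_nonneg by (simp add: power2_eq_square)
    then show ?thesis
      unfolding eq using nw x \<theta> n1 by (intro nrm_diff_lessI nrm_add_lessI) (simp_all add: nrm_mult)
  qed
  have Mr: "M < r"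
  proof (cases "nrm (n - a) < M")
    case True
    have "nrm ((n - b) + (n - c)) \<le> M"
      using bM by (intro nrm_add_leI) (auto simp: M_def)
    then have "nrm ((n - a) * ((n - b) + (n - c))) < M * M"
      unfolding nrm_mult using True nrm_nonneg \<kappa>M \<kappa>3(2) by (intro mult_less_le) auto
    then have "nrm ((n - a) * ((n - b) + (n - c)) + (n - b) * (n - c)) = M * M"
      by (subst nrm_add_eq) (simp_all add: nrm_mult bM M_def)
    then have "M * M < r * r"
      using pairs unfolding distrib_left by (simp only: power2_eq_square)
    moreover have "r * r \<le> M * M" if "r \<le> M"
      using that r0 by (intro mult_mono) auto
    ultimately show ?thesis
      by linarith
  next
    case False
    then have "nrm (n - a) = M"
      using ord bM by simp
    then have "M ^ 3 = \<kappa> ^ 3"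
      using prod by (simp add: bM power3_eq_cube)
    then show ?thesis
      using \<kappa> \<kappa>3(2) nrm_nonneg[of "n - c"] by (simp add: M_def power_eq_iff_eq_base)
  qed
  have le: "nrm (y - y') \<le> M" if "nrm (n - y) \<le> M" "nrm (n - y') \<le> M" for y y'
    using nrm_diff_leI[OF that(2,1)] by simp
  have nM: "nrm (n - a) \<le> M" "nrm (n - b) \<le> M" "nrm (n - c) \<le> M"
    using ord bM by (auto simp: M_def)
  have fin: "good_preimage (fibre w1 w2 w3 q x) r \<theta> w3"
    if z: "\<And>z. fibre w1 w2 w3 q x z = (z - w) * (z - w') * (z - w'')"
      and w: "nrm (w - w') = M" "nrm (w - w'') = M" "nrm (n - w) \<le> M" for w w' w''
  proof -
    have ww: "nrm (w - w3) \<le> M"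
      using nrm_diff_leI[of "n - w3" M "n - w"] w nw \<kappa>M by simp
    have "\<theta> < M * M"
      using \<kappa>(3) mult_mono[OF \<kappa>M \<kappa>M] \<kappa>3(2) \<kappa>M by (simp add: power2_eq_square)
    then show ?thesis
      unfolding good_preimage_def
      by - (rule exI[of _ w], rule exI[of _ w'], rule exI[of _ w''], use z w ww Mr in auto)
  qed
  have iso: "nrm (y - y'') = M" if "nrm (y - y') = M" "nrm (y' - y'') < M" for y y' y''
    using nrm_add_eq2[of "y' - y''" "y - y'"] that by simp
  \<comment> \<open>If \<open>a\<close> were closer than M to both others, the small sum of the
    offsets from \<open>n\<close> would make 3 (n - a) smaller than M, against |n - a| = M and 3
    being a unit.\<close>
  have two: "nrm (a - b) = M \<or> nrm (a - c) = M"
  proof (cases "nrm (n - a) < M")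
    case True
    then have "nrm ((n - b) - (n - a)) = M"
      using nrm_diff_eq2[of "n - a" "n - b"] unfolding bM by blast
    then show ?thesis
      by simp
  next
    case False
    show ?thesis
    proof (rule ccontr)
      assume no: "\<not> ?thesis"
      then have lt: "nrm (a - b) < M" "nrm (a - c) < M"
        using le[OF nM(1,2)] le[OF nM(1,3)] by auto
      have "nrm (((n - a) + (n - b) + (n - c)) - (a - b) - (a - c)) < M"
        by (rule nrm_diff_lessI[OF nrm_diff_lessI[OF less_le_trans[OF sum \<kappa>M] lt(1)] lt(2)])
      moreover have "((n - a) + (n - b) + (n - c)) - (a - b) - (a - c) = 3 * (n - a)"
        by (simp add: algebra_simps)
      ultimately have "nrm (3 * (n - a)) < M"
        by metis
      then show False
        using False unfolding nrm_mult by simp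
    qed
  qed
  consider "nrm (a - b) = M" "nrm (a - c) = M" | "nrm (a - b) = M" "nrm (a - c) < M"
    | "nrm (a - b) < M" "nrm (a - c) = M"
    using two le[OF nM(1,2)] le[OF nM(1,3)] by linarith
  then show ?thesis
  proof cases
    case 1
    show ?thesis
      by (rule fin[of a b c]) (use 1 C nM in auto)
  next
    case 2
    have "nrm (b - c) = M"
      using iso[of b a c] 2 nrm_commute[of a b] by simp
    then show ?thesis
      by (intro fin[of b a c]) (use 2 C nM nrm_commute[of a b] in \<open>auto simp: mult_ac\<close>)
  next
    case 3
    have "nrm (c - b) = M"
      using iso[of c a b] 3 nrm_commute[of a c] by simp
    then show ?thesis
      by (intro fin[of c a b]) (use 3 C nM nrm_commute[of a c] in \<open>auto simp: mult_ac\<close>)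
  qed
qed

text \<open>The gain from having two candidates: the fibres over \<open>x\<close> and
  \<open>y\<close> differ by exactly \<theta> r at \<open>n\<close>, so they cannot both be smaller
  there.\<close>

lemma fibre_large:
  assumes "nrm n = r" "r < 1" "nrm q \<le> 1" "nrm (x - y) = \<theta>"
  shows "\<theta> * r \<le> nrm (fibre w1 w2 w3 q x n) \<or> \<theta> * r \<le> nrm (fibre w1 w2 w3 q y n)"
proof (rule ccontr)
  assume "\<not> ?thesis"
  then have "nrm (fibre w1 w2 w3 q y n - fibre w1 w2 w3 q x n) < \<theta> * r"
    by (intro nrm_diff_lessI) auto
  moreover have "fibre w1 w2 w3 q y n - fibre w1 w2 w3 q x n = (x - y) * n * (1 + q * n)"
    by (simp add: fibre_def algebra_simps)
  moreover have "nrm (1 + q * n) = 1"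
    using assms by (intro nrm_one_add nrm_mult_less1') auto
  ultimately show False
    using assms by (simp add: nrm_mult)
qed

text \<open>The order of quantifiers matters: \<open>u\<close> is fixed from the position of the
  zeros alone, since the two candidates for \<open>x\<close> are later constructed from
  \<open>u\<close>. The cases record how the zeros of maximal norm cluster.\<close>

lemma good_preimage_exists:
  assumes ord: "nrm w1 \<le> nrm w2" "nrm w2 \<le> nrm w3" and r: "nrm w3 = r" "0 < r" "r < 1"
    and q: "nrm q \<le> 1" and \<theta>: "0 < \<theta>" "\<theta> < r\<^sup>2"
  shows "\<exists>u. nrm u = r \<and> (\<forall>x y. nrm x = \<theta> \<longrightarrow> nrm y = \<theta> \<longrightarrow> nrm (x - y) = \<theta> \<longrightarrow>
    good_preimage (fibre w1 w2 w3 q x) r \<theta> u \<or> good_preimage (fibre w1 w2 w3 q y) r \<theta> u)"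
proof -
  have sw: "fibre w1 w2 w3 q x = fibre w3 w2 w1 q x" "fibre w1 w2 w3 q x = fibre w2 w1 w3 q x" for x
    by (rule ext, rule fibre_swap)+
  have le: "nrm (y - y') \<le> r" if "nrm y \<le> r" "nrm y' \<le> r" for y y'
    using nrm_diff_leI that by blast
  have wr: "nrm w1 \<le> r" "nrm w2 \<le> r" "nrm w3 \<le> r"
    using ord r by auto
  consider "nrm w2 < r" | "nrm w1 < r" "nrm w2 = r" | "nrm w1 = r" "nrm w2 = r"
    using wr ord by fastforce
  then show ?thesis
  proof cases
    case 1
    then have d: "nrm (w3 - w2) = r" "nrm (w3 - w1) = r"
      using ord r by (simp_all add: nrm_diff_eq2)
    have "good_preimage (fibre w1 w2 w3 q x) r \<theta> w3" if "nrm x = \<theta>" for x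
      unfolding sw(1) using wr r q that d \<theta>
      by (intro good_preimage_isolated[where \<delta> = r]) (simp_all add: power2_eq_square)
    then show ?thesis
      using r by blast
  next
    case 2
    then have d: "nrm (w3 - w1) = r"
      using r by (simp add: nrm_diff_eq2)
    show ?thesis
    \<comment> \<open>With one far zero at distance \<open>r\<close>, the condition for an isolated
      zero becomes \<theta> r < r |w3 - w2|^2.\<close>
    proof (cases "\<theta> < (nrm (w3 - w2))\<^sup>2")
      case True
      have "good_preimage (fibre w1 w2 w3 q x) r \<theta> w3" if "nrm x = \<theta>" for x
        unfolding sw(1)
      proof (rule good_preimage_isolated[where \<delta> = "nrm (w3 - w2)"])
        show "\<theta> * r < nrm (w3 - w2) * nrm (w3 - w1) * nrm (w3 - w2)"
          using True r(2) by (simp add: d power2_eq_square mult_ac)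
      qed (use wr r q that d le nrm_nonneg in auto)
      then show ?thesis
        using r by blast
    next
      case False
      then have close: "(nrm (w2 - w3))\<^sup>2 \<le> \<theta>"
        using nrm_commute[of w2 w3] by simp
      then have "nrm (w2 - w3) < r"
        using \<theta> r by (meson le_less_trans less_imp_le power_less_imp_less_base)
      then have "nrm ((w2 - w3) / 2 + w3) = r"
        using r by (subst nrm_add_eq) (simp_all add: nrm_divide)
      moreover have "(w2 - w3) / 2 + w3 = (w2 + w3) / 2"
        by (simp add: field_simps)
      ultimately have "nrm ((w2 + w3) / 2) = r"
        by simp
      then show ?thesis
        using good_preimage_pair[OF 2(1) 2(2) r(1) r(3) q _ \<theta> close refl] fibre_large[OF _ r(3) q] r(1)
        by blast
    qed
  next
    case 3
    \<comment> \<open>The scale at which a cube of distances equals \<theta> r: a separation above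
      \<kappa> permits the isolated case, otherwise all three zeros form one cluster.\<close>
    define \<kappa> where "\<kappa> = root 3 (\<theta> * r)"
    have \<kappa>: "\<kappa> ^ 3 = \<theta> * r" "0 < \<kappa>"
      using \<theta> r by (simp_all add: \<kappa>_def odd_real_root_pow)
    have \<kappa>r: "\<kappa> < r"
    proof -
      have "\<kappa> ^ 3 < r ^ 3"
        unfolding \<kappa> using \<theta> r by (simp add: power3_eq_cube power2_eq_square)
      then show ?thesis
        using r by (intro power_less_imp_less_base[of \<kappa> 3 r]) auto
    qed
    show ?thesis
    proof (cases "nrm (w1 - w2) \<le> \<kappa> \<and> nrm (w1 - w3) \<le> \<kappa> \<and> nrm (w2 - w3) \<le> \<kappa>")
      case True
      define n where "n = (w1 + w2 + w3) / 3"
      have nw: "nrm (n - w3) \<le> \<kappa>" "nrm (n - w2) \<le> \<kappa>" "nrm (n - w1) \<le> \<kappa>"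
        unfolding n_def using True nrm_mean_close by blast+
      have nr: "nrm n = r"
        using nrm_eqI[of n w3] nw \<kappa>r r by simp
      have n1: "nrm (1 + q * n) = 1"
        using nr q r by (intro nrm_one_add nrm_mult_less1') auto
      have up: "nrm (fibre w1 w2 w3 q x n) \<le> \<theta> * r" if "nrm x = \<theta>" for x
      proof -
        have "nrm ((n - w1) * (n - w2) * (n - w3)) \<le> \<kappa> * \<kappa> * \<kappa>"
          unfolding nrm_mult using nw \<kappa>(2) nrm_nonneg by (intro mult_mono) auto
        then show ?thesis
          unfolding fibre_def using that nr n1 \<kappa>(1)
          by (intro nrm_diff_leI) (simp_all add: nrm_mult power3_eq_cube)
      qed
      have "good_preimage (fibre w1 w2 w3 q x) r \<theta> w3"
        if "nrm x = \<theta>" "\<theta> * r \<le> nrm (fibre w1 w2 w3 q x n)" for x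
        using good_preimage_triple[OF 3 r(1) r(3) q that(1) \<theta> \<kappa>(1,2) _ _ _ n_def] True up[OF that(1)] that(2)
        by simp
      then show ?thesis
        using fibre_large[OF nr r(3) q] r(1) by blast
    next
      case False
      define R where "R = max (nrm (w1 - w2)) (max (nrm (w1 - w3)) (nrm (w2 - w3)))"
      have R: "\<kappa> < R" "nrm (w1 - w2) \<le> R" "nrm (w1 - w3) \<le> R" "nrm (w2 - w3) \<le> R"
        using False by (auto simp: R_def)
      have R3: "\<theta> * r < R * R * R"
      proof -
        have "\<kappa> ^ 3 < R ^ 3"
          using R \<kappa> by (intro power_strict_mono) auto
        then show ?thesis
          unfolding \<kappa>(1) by (simp add: power3_eq_cube)
      qed
      have iso: "good_preimage (fibre u v s q x) r \<theta> u"
        if "nrm u = r" "nrm v = r" "nrm s = r" "nrm (u - v) = R" "nrm (u - s) = R" "nrm x = \<theta>" for u v s x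
        using that r q R3 nrm_nonneg[of "u - v"] by (intro good_preimage_isolated[where \<delta> = R]) auto
      have eq: "nrm (a - c) = R" if "nrm (a - b) = R" "nrm (b - c) < R" for a b c
        using nrm_add_eq2[of "b - c" "a - b"] that by simp
      \<comment> \<open>Ultrametric triangles are isosceles with the two longest sides equal, so
        some zero has distance \<open>R\<close> from both others.\<close>
      consider "nrm (w1 - w2) = R" "nrm (w1 - w3) = R" | "nrm (w1 - w2) = R" "nrm (w2 - w3) = R"
        | "nrm (w1 - w3) = R" "nrm (w2 - w3) = R"
      proof -
        have "nrm (w1 - w2) = R \<or> nrm (w1 - w3) = R \<or> nrm (w2 - w3) = R"
          by (auto simp: R_def max_def)
        moreover have "nrm (w1 - w3) = R" if "nrm (w1 - w2) = R" "nrm (w2 - w3) \<noteq> R"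
          using eq[of w1 w2 w3] that R by simp
        moreover have "nrm (w1 - w2) = R" if "nrm (w1 - w3) = R" "nrm (w2 - w3) \<noteq> R"
          using eq[of w1 w3 w2] that R nrm_commute[of w2 w3] by simp
        moreover have "nrm (w1 - w2) = R" if "nrm (w2 - w3) = R" "nrm (w1 - w3) \<noteq> R"
          using eq[of w2 w3 w1] that R nrm_commute[of w3 w1] nrm_commute[of w2 w1] by simp
        ultimately show thesis
          using that by blast
      qed
      then show ?thesis
      proof cases
        case 1
        then show ?thesis
          using iso[of w1 w2 w3] 3 r by blast
      next
        case 2
        then show ?thesis
          using iso[of w2 w1 w3] 3 r nrm_commute[of w1 w2] unfolding sw(2) by metis
      next
        case c: 3
        then show ?thesis
          using iso[of w3 w2 w1] 3 r nrm_commute[of w3 w2] nrm_commute[of w3 w1] unfolding sw(1) by metis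
      qed
    qed
  qed
qed

text \<open>Differentiate (z - c)(z - a)(z - b) / (z (1 + q z)) at \<open>c\<close>. The derivative
  keeps its norm as long as the disc meets neither the pole 0 nor the other preimages
  \<open>a\<close> and \<open>b\<close>.\<close>

lemma expands_fibre:
  assumes f: "num f - Polynomial.smult x (den f) = [:- c, 1:] * [:- a, 1:] * [:- b, 1:]"
    and den: "den f = [:0, 1, q:]" and q: "nrm q \<le> 1" and c: "nrm c < 1"
    and \<rho>: "0 \<le> \<rho>" "\<rho> < nrm c" "\<rho> < nrm (c - a)" "\<rho> < nrm (c - b)"
  shows "expands (num f) (den f) c \<rho> (nrm (c - a) * nrm (c - b) / nrm c)"
    and "poly (num f) c / poly (den f) c = x"
proof -
  have R: "poly (num f - Polynomial.smult x (den f)) z = (z - c) * (z - a) * (z - b)" for z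
    unfolding f by (simp add: algebra_simps)
  have R': "poly (pderiv (num f - Polynomial.smult x (den f))) z
      = (z - a) * (z - b) + (z - c) * ((z - a) + (z - b))" for z
    unfolding f by (simp add: pderiv_mult pderiv_pCons algebra_simps)
  have pos: "0 < nrm (c - a) * nrm (c - b)" "0 < nrm c"
    using \<rho> by (auto intro!: mult_pos_pos)
  have disc: "nrm z = nrm c" "nrm (poly (den f) z) = nrm c" "nrm (poly (pderiv (den f)) z) \<le> 1"
    if "nrm (z - c) \<le> \<rho>" for z
  proof -
    show z: "nrm z = nrm c"
      using that \<rho> by (intro nrm_eqI) simp
    have "nrm (1 + q * z) = 1"
      using z c q by (intro nrm_one_add nrm_mult_less1') auto
    moreover have "poly (den f) z = z * (1 + q * z)"
      by (simp add: den algebra_simps)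
    ultimately show "nrm (poly (den f) z) = nrm c"
      by (simp add: nrm_mult z)
    have "poly (pderiv (den f)) z = 1 + 2 * q * z"
      by (simp add: den pderiv_pCons algebra_simps)
    then show "nrm (poly (pderiv (den f)) z) \<le> 1"
      using z c q by (auto intro!: nrm_add_leI nrm_mult_le1)
  qed
  show "expands (num f) (den f) c \<rho> (nrm (c - a) * nrm (c - b) / nrm c)"
  proof (rule expandsI[where x = x])
    fix z
    assume z: "nrm (z - c) \<le> \<rho>"
    have za: "nrm (z - a) = nrm (c - a)" "nrm (z - b) = nrm (c - b)"
      using z \<rho> nrm_eqI[of "z - a" "c - a"] nrm_eqI[of "z - b" "c - b"] by auto
    have "nrm ((z - c) * ((z - a) + (z - b))) < nrm (c - a) * nrm (c - b)"
    proof -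
      have "nrm ((z - a) + (z - b)) \<le> max (nrm (c - a)) (nrm (c - b))"
        using za nrm_add_le by metis
      then have "nrm ((z - c) * ((z - a) + (z - b))) \<le> nrm (z - c) * max (nrm (c - a)) (nrm (c - b))"
        unfolding nrm_mult by (intro mult_left_mono nrm_nonneg)
      also have "\<dots> < min (nrm (c - a)) (nrm (c - b)) * max (nrm (c - a)) (nrm (c - b))"
        using z \<rho> by (intro mult_strict_right_mono) auto
      finally show ?thesis
        by (simp add: min_def max_def mult.commute split: if_splits)
    qed
    then show "nrm (poly (den f) z) = nrm c
        \<and> nrm (poly (pderiv (num f - Polynomial.smult x (den f))) z) = nrm (c - a) * nrm (c - b)
        \<and> nrm (poly (num f - Polynomial.smult x (den f)) z) \<le> nrm (c - a) * nrm (c - b) * nrm (z - c)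
        \<and> nrm (z - c) * nrm (poly (pderiv (den f)) z) < nrm c"
      using disc[OF z] z \<rho> mult_left_le[OF disc(3)[OF z] nrm_nonneg[of "z - c"]]
      unfolding R R' by (simp add: nrm_add_eq2 nrm_mult za mult_ac)
  qed (use \<rho> pos in \<open>simp_all add: R del: poly_diff\<close>)
  have "poly (den f) c \<noteq> 0"
    using disc(2)[of c] \<rho> by auto
  then show "poly (num f) c / poly (den f) c = x"
    using R[of c] by simp
qed

text \<open>The norms along the cycle are t = sqrt r, then r, then \<theta> = m / t. The derivatives
  at the three points have norms t, |w - d| |w - e| / r and t / \<theta>; their product is |w - d|
  |w - e| / \<theta>.\<close>

lemma repelling_3_cycle:
  assumes f: "P0 f = - (w1 * w2 * w3)" "P1 f = w1 * w2 + w1 * w3 + w2 * w3" "P2 f = - (w1 + w2 + w3)"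
    "P3 f = 1" "Q0 f = 0" "Q1 f = 1" "Q2 f = q" "Q3 f = 0"
    and ord: "nrm w1 \<le> nrm w2" "nrm w2 \<le> nrm w3" "nrm w3 < 1" "w1 \<noteq> 0" and q: "nrm q \<le> 1"
  shows "repelling f"
proof -
  define r where "r = nrm w3"
  define t where "t = sqrt r"
  define m where "m = nrm (w1 * w2 * w3)"
  define \<theta> where "\<theta> = m / t"
  let ?C = "fibre w1 w2 w3 q"
  have w1: "0 < nrm w1"
    using ord by (simp add: nrm_pos_iff)
  have r: "0 < r" "r < 1" "nrm w1 \<le> r" "nrm w2 \<le> r" "nrm w3 = r"
    using ord w1 by (auto simp: r_def)
  have t: "0 < t" "t < 1" "r = t\<^sup>2" "t * t = r"
    using r by (simp_all add: t_def)
  have rt: "r < t"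
    using mult_strict_left_mono[OF t(2,1)] unfolding t(4) by simp
  have r2: "r\<^sup>2 < r"
    using mult_strict_left_mono[OF r(2,1)] unfolding power2_eq_square by simp
  have m: "0 < m" "m \<le> r ^ 3" "m < r"
  proof -
    have "0 < nrm w2" "0 < nrm w3"
      using w1 ord by linarith+
    then show "0 < m"
      using w1 by (simp add: m_def nrm_mult)
    have "nrm w1 * nrm w2 * nrm w3 \<le> r * r * r"
      using r nrm_nonneg by (intro mult_mono) auto
    then show m3: "m \<le> r ^ 3"
      by (simp add: m_def nrm_mult power3_eq_cube)
    have "r ^ 3 < r"
      using power_strict_decreasing[of 1 3 r] r by simp
    with m3 show "m < r"
      by simp
  qed
  have \<theta>: "0 < \<theta>" "\<theta> < r\<^sup>2" "\<theta> * t = m"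
  proof -
    show "0 < \<theta>" "\<theta> * t = m"
      using m t by (simp_all add: \<theta>_def)
    have "r ^ 3 = r\<^sup>2 * t * t"
      using t(4) by (simp add: power3_eq_cube power2_eq_square mult.assoc)
    then have "m / t \<le> r\<^sup>2 * t"
      using m t by (simp add: pos_divide_le_eq)
    also have "\<dots> < r\<^sup>2"
      using r t by simp
    finally show "\<theta> < r\<^sup>2"
      by (simp add: \<theta>_def)
  qed
  have \<sigma>: "nrm (w1 + w2 + w3) \<le> r" "nrm (w1 * w2 + w1 * w3 + w2 * w3) \<le> r\<^sup>2"
  proof -
    show "nrm (w1 + w2 + w3) \<le> r"
      using r by (intro nrm_add_leI) auto
    have "nrm (y * y') \<le> r\<^sup>2" if "nrm y \<le> r" "nrm y' \<le> r" for y y'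
      using mult_mono[OF that] r nrm_nonneg by (simp add: nrm_mult power2_eq_square)
    then show "nrm (w1 * w2 + w1 * w3 + w2 * w3) \<le> r\<^sup>2"
      using r by (intro nrm_add_leI) auto
  qed
  have n1: "nrm (1 + q * z) = 1" if "nrm z < 1" for z
    using that q by (intro nrm_one_add nrm_mult_less1') auto
  have large: "\<exists>a b c. (\<forall>z. ?C u z = (z - a) * (z - b) * (z - c)) \<and> nrm a < t \<and> nrm b = t
      \<and> nrm c = t \<and> nrm (b - c) = t" if u: "nrm u = r" for u
  proof -
    obtain a b c where abc: "a + b + c = w1 + w2 + w3 + u * q"
      "a * b + a * c + b * c = w1 * w2 + w1 * w3 + w2 * w3 - u" "a * b * c = w1 * w2 * w3"
      and ord': "nrm a \<le> nrm b" "nrm b \<le> nrm c"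
      using cubic_split[of "w1 + w2 + w3 + u * q" "w1 * w2 + w1 * w3 + w2 * w3 - u" "w1 * w2 * w3" nrm]
      by blast
    have s: "nrm (a + b + c) \<le> r"
      unfolding abc using \<sigma> u q r mult_left_le[of "nrm q" r] by (intro nrm_add_leI) (simp_all add: nrm_mult)
    have p: "nrm (a * b + a * c + b * c) = r"
      unfolding abc using \<sigma> u r2 by (simp add: nrm_diff_eq)
    have d: "nrm (a * b * c) \<le> r ^ 3"
      using m by (simp add: abc m_def)
    show ?thesis
      using large_roots[OF t(1,2,3) s p d ord'] fibre_vieta[OF abc] by blast
  qed
  have small: "\<exists>x a b. (\<forall>z. ?C y z = (z - x) * (z - a) * (z - b)) \<and> nrm x = \<theta> \<and> nrm a * nrm b = t
      \<and> t \<le> nrm a \<and> t \<le> nrm b" if y: "nrm y = t" for y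
  proof -
    obtain a b c where abc: "a + b + c = w1 + w2 + w3 + y * q"
      "a * b + a * c + b * c = w1 * w2 + w1 * w3 + w2 * w3 - y" "a * b * c = w1 * w2 * w3"
      and ord': "nrm a \<le> nrm b" "nrm b \<le> nrm c"
      using cubic_split[of "w1 + w2 + w3 + y * q" "w1 * w2 + w1 * w3 + w2 * w3 - y" "w1 * w2 * w3" nrm]
      by blast
    have s: "nrm (a + b + c) \<le> 1"
      unfolding abc using \<sigma> y q r t by (intro nrm_add_leI nrm_mult_le1) simp_all
    have p: "nrm (a * b + a * c + b * c) = t"
      unfolding abc using \<sigma> y r2 rt by (simp add: nrm_diff_eq)
    have d: "nrm (a * b * c) = m" "m < t\<^sup>2"
      using m t by (simp_all add: abc m_def)
    show ?thesis
      using small_root[OF t(1,2) s p d m(1) ord'] fibre_vieta[OF abc] unfolding \<theta>_def by blast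
  qed
  \<comment> \<open>The orbit is built backwards from the zero \<open>u\<close>: its two preimages
    \<open>y2\<close> and \<open>y3\<close> of norm \<open>t\<close>, then for each of these the
    preimage near the pole.\<close>
  obtain u where u: "nrm u = r" and sel: "\<And>x y. nrm x = \<theta> \<Longrightarrow> nrm y = \<theta> \<Longrightarrow> nrm (x - y) = \<theta> \<Longrightarrow>
    good_preimage (?C x) r \<theta> u \<or> good_preimage (?C y) r \<theta> u"
    using good_preimage_exists[OF ord(1,2) r(5) r(1,2) q \<theta>(1,2)] by blast
  obtain y1 y2 y3 where y: "\<And>z. ?C u z = (z - y1) * (z - y2) * (z - y3)"
    "nrm y2 = t" "nrm y3 = t" "nrm (y2 - y3) = t"
    using large[OF u] by blast
  obtain x2 a2 b2 where x2: "\<And>z. ?C y2 z = (z - x2) * (z - a2) * (z - b2)" "nrm x2 = \<theta>"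
    "nrm a2 * nrm b2 = t" "t \<le> nrm a2" "t \<le> nrm b2"
    using small[OF y(2)] by blast
  obtain x3 a3 b3 where x3: "\<And>z. ?C y3 z = (z - x3) * (z - a3) * (z - b3)" "nrm x3 = \<theta>"
    "nrm a3 * nrm b3 = t" "t \<le> nrm a3" "t \<le> nrm b3"
    using small[OF y(3)] by blast
  have \<theta>t: "\<theta> < t" "\<theta> < r"
    using \<theta> r2 rt by auto
  \<comment> \<open>This rewrites the fibre equation as x (K - y) = w1 w2 w3 with K smaller than y,
    that is, x is close to - w1 w2 w3 / y.\<close>
  define K where "K x y = x\<^sup>2 - (w1 + w2 + w3) * x + (w1 * w2 + w1 * w3 + w2 * w3) - y * (q * x)" for x y
  have K: "nrm (K x y) < t" "x * (K x y - y) = w1 * w2 * w3"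
    if "nrm x = \<theta>" "nrm y = t" "?C y x = 0" for x y
  proof -
    have "nrm (x\<^sup>2) < t" "nrm ((w1 + w2 + w3) * x) < t" "nrm (y * (q * x)) < t"
    proof -
      have "\<theta> * \<theta> < t * 1"
        using \<theta> \<theta>t t by (intro mult_strict_mono) auto
      then show "nrm (x\<^sup>2) < t"
        by (simp add: power2_eq_square nrm_mult that)
      have "nrm (w1 + w2 + w3) * \<theta> < 1 * t"
        using \<sigma> r \<theta> \<theta>t nrm_nonneg by (intro mult_strict_mono) auto
      then show "nrm ((w1 + w2 + w3) * x) < t"
        by (simp add: nrm_mult that)
      have "nrm (q * x) < 1"
        using q that \<theta>t t by (intro nrm_mult_less1') auto
      then show "nrm (y * (q * x)) < t"
        using t by (simp add: nrm_mult[of y] that)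
    qed
    moreover have "nrm (w1 * w2 + w1 * w3 + w2 * w3) < t"
      using \<sigma> r2 rt by simp
    ultimately show "nrm (K x y) < t"
      unfolding K_def by (intro nrm_diff_lessI[OF nrm_add_lessI[OF nrm_diff_lessI]])
    have "x * (K x y - y) - w1 * w2 * w3 = ?C y x"
      by (simp add: K_def fibre_def algebra_simps power2_eq_square)
    then show "x * (K x y - y) = w1 * w2 * w3"
      using that(3) by simp
  qed
  \<comment> \<open>Inversion carries the full separation of \<open>y2\<close> and \<open>y3\<close>
    over to \<open>x2\<close> and \<open>x3\<close>.\<close>
  have xd: "nrm (x2 - x3) = \<theta>"
  proof -
    have C0: "?C y2 x2 = 0" "?C y3 x3 = 0"
      by (simp_all add: x2(1) x3(1))
    note K2 = K[OF x2(2) y(2) C0(1)] and K3 = K[OF x3(2) y(3) C0(2)]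
    let ?A = "K x2 y2 - y2" and ?B = "K x3 y3 - y3"
    have n: "nrm ?A = t" "nrm ?B = t"
      using K2 K3 y by (simp_all add: nrm_diff_eq)
    have "nrm ((K x3 y3 - K x2 y2) + (y2 - y3)) = t"
      using K2(1) K3(1) y(4) nrm_diff_lessI[of "K x3 y3" t "K x2 y2"] by (subst nrm_add_eq) auto
    moreover have "(K x3 y3 - K x2 y2) + (y2 - y3) = ?B - ?A"
      by simp
    ultimately have BA: "nrm (?B - ?A) = t"
      by metis
    have "(x2 - x3) * (?A * ?B) = (x2 * ?A) * ?B - (x3 * ?B) * ?A"
      by (simp only: algebra_simps)
    also have "\<dots> = w1 * w2 * w3 * (?B - ?A)"
      unfolding K2(2) K3(2) by (simp only: right_diff_distrib)
    finally have "nrm (x2 - x3) * (t * t) = m * t"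
      using n BA m_def by (metis nrm_mult)
    then have "nrm (x2 - x3) * t = m"
      using t(1) by (metis mult.assoc mult_right_cancel less_irrefl)
    then show ?thesis
      using t(1) by (simp add: \<theta>_def field_simps)
  qed
  obtain x y a b where x: "\<And>z. ?C y z = (z - x) * (z - a) * (z - b)" "nrm x = \<theta>"
    "nrm a * nrm b = t" "t \<le> nrm a" "t \<le> nrm b" and yy: "nrm y = t" "?C u y = 0"
    and good: "good_preimage (?C x) r \<theta> u"
    using sel[OF x2(2) x3(2) xd]
  proof
    assume "good_preimage (?C x2) r \<theta> u"
    then show thesis
      using that[of y2 x2 a2 b2] x2 y by simp
  next
    assume "good_preimage (?C x3) r \<theta> u"
    then show thesis
      using that[of y3 x3 a3 b3] x3 y by simp
  qed
  obtain w d e where w: "\<And>z. ?C x z = (z - w) * (z - d) * (z - e)" "nrm (w - u) < r"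
    "nrm (w - u) \<le> nrm (w - d)" "nrm (w - u) \<le> nrm (w - e)" "\<theta> < nrm (w - d) * nrm (w - e)"
    using good unfolding good_preimage_def by blast
  have wr: "nrm w = r"
    using nrm_eqI[of w u] w u by simp
  \<comment> \<open>Now \<open>w\<close> maps to \<open>x\<close> and \<open>x\<close> to
    \<open>y\<close>, but \<open>y\<close> maps to \<open>u\<close> instead of \<open>w\<close>. The
    point \<open>c\<close> is the preimage of \<open>w\<close> nearest to \<open>y\<close>; three
    steps take it to \<open>y\<close>, which leaves the return defect |y - c|.\<close>
  obtain c c1 c2 where c: "\<And>z. ?C w z = (z - c) * (z - c1) * (z - c2)" "nrm c = t"
    "nrm (c - c1) = t" "nrm (c - c2) = t" "nrm (y - c) * t = nrm (w - u)"
  proof -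
    obtain a b c where abc: "\<And>z. ?C w z = (z - a) * (z - b) * (z - c)" "nrm a < t" "nrm b = t"
      "nrm c = t" "nrm (b - c) = t"
      using large[OF wr] by blast
    have "?C w y = ?C u y + (u - w) * y * (1 + q * y)"
      by (simp add: fibre_def algebra_simps)
    then have "nrm (?C w y) = nrm (w - u) * t"
      using n1[of y] yy t nrm_commute[of u w] by (simp add: nrm_mult)
    moreover have "nrm (y - a) = t"
      using abc yy by (simp add: nrm_diff_eq2)
    ultimately have prod: "nrm (y - b) * nrm (y - c) = nrm (w - u)"
      using t unfolding abc(1) by (simp add: nrm_mult mult_ac)
    have le: "nrm (y - b) \<le> t" "nrm (y - c) \<le> t"
      using abc yy by (auto intro: nrm_diff_leI)
    have "t \<le> max (nrm (y - b)) (nrm (y - c))"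
      using nrm_ultra[of b c y] abc(5) nrm_commute[of b y] by simp
    moreover have ba: "nrm (b - a) = t" "nrm (c - a) = t"
      using abc by (simp_all add: nrm_diff_eq2)
    ultimately consider "nrm (y - b) = t" | "nrm (y - c) = t"
      using le by linarith
    then show thesis
    proof cases
      case 1
      show thesis
        by (rule that[of c a b]) (use 1 abc ba prod nrm_commute[of b c] in \<open>auto simp: mult_ac\<close>)
    next
      case 2
      show thesis
        by (rule that[of b a c]) (use 2 abc ba prod in \<open>auto simp: mult_ac\<close>)
    qed
  qed
  define \<Lambda>w where "\<Lambda>w = nrm (w - d) * nrm (w - e) / nrm w"
  define \<Lambda> where "\<Lambda> = t / \<theta> * (\<Lambda>w * t)"
  have \<Lambda>: "\<Lambda> = nrm (w - d) * nrm (w - e) / \<theta>" "1 < \<Lambda>" "0 < \<Lambda>w"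
  proof -
    have "\<Lambda> = nrm (w - d) * nrm (w - e) * (t * t) / (\<theta> * r)"
      by (simp add: \<Lambda>_def \<Lambda>w_def wr)
    then show "\<Lambda> = nrm (w - d) * nrm (w - e) / \<theta>"
      using r by (simp add: t(4))
    then show "1 < \<Lambda>"
      using w(5) \<theta> by simp
    show "0 < \<Lambda>w"
      using w(5) \<theta> r unfolding \<Lambda>w_def wr by simp
  qed
  have de: "0 < nrm (w - d)" "0 < nrm (w - e)"
    using w(5) \<theta>(1) nrm_nonneg[of "w - d"] nrm_nonneg[of "w - e"] by (auto simp: zero_less_mult_iff less_le)
  \<comment> \<open>The least radius for which the expansion \<Lambda> covers the return defect. The
    conditions in \<open>good_preimage\<close> keep its images inside the admissible discs around
    \<open>w\<close> and \<open>x\<close>.\<close>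
  define \<rho> where "\<rho> = nrm (y - c) / \<Lambda>"
  have yc: "nrm (y - c) = nrm (w - u) / t"
    using c(5) t by (simp add: field_simps)
  have \<rho>0: "0 \<le> \<rho>"
    using \<Lambda>(2) nrm_nonneg by (simp add: \<rho>_def)
  have small1: "s / \<Lambda> < b" if "s \<le> b" "0 < b" "0 \<le> s" for s b
  proof (cases "s = 0")
    case False
    then have "s / \<Lambda> < s"
      using \<Lambda>(2) that by (simp add: pos_divide_less_eq)
    with that show ?thesis
      by simp
  qed (use that in simp)
  have \<rho>t: "\<rho> < t"
  proof -
    have "nrm (y - c) \<le> t"
      using yy c by (intro nrm_diff_leI) auto
    then show ?thesis
      unfolding \<rho>_def using t nrm_nonneg by (intro small1) auto
  qed
  have \<rho>w: "t * \<rho> = nrm (w - u) / \<Lambda>"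
    using t by (simp add: \<rho>_def yc)
  have \<rho>w': "t * \<rho> < nrm w" "t * \<rho> < nrm (w - d)" "t * \<rho> < nrm (w - e)" "0 \<le> t * \<rho>"
    unfolding \<rho>w using w(2,3,4) wr de r nrm_nonneg \<Lambda>(2) by (auto intro!: small1)
  have \<rho>x: "\<Lambda>w * t * \<rho> < \<theta>" "0 \<le> \<Lambda>w * t * \<rho>"
  proof -
    have "\<Lambda>w * t * \<rho> = \<Lambda>w * nrm (w - u) / \<Lambda>"
      using \<rho>w by (simp add: mult.assoc)
    also have "\<dots> = \<theta> * nrm (w - u) / r"
      using de \<theta> by (simp add: \<Lambda>(1) \<Lambda>w_def wr)
    also have "\<dots> < \<theta>"
      using w(2) \<theta> r by (simp add: pos_divide_less_eq)
    finally show "\<Lambda>w * t * \<rho> < \<theta>" .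
    show "0 \<le> \<Lambda>w * t * \<rho>"
      using \<Lambda>(3) t \<rho>0 by simp
  qed
  have den: "den f = [:0, 1, q:]"
    by (simp add: den_def f)
  have split: "num f - Polynomial.smult s (den f) = [:- a, 1:] * [:- b, 1:] * [:- c, 1:]"
    if "\<And>z. ?C s z = (z - a) * (z - b) * (z - c)" for s a b c
  proof (rule poly_ext)
    fix z
    have "poly (num f - Polynomial.smult s (den f)) z = ?C s z"
      by (simp add: num_def den fibre_def f algebra_simps)
    then show "poly (num f - Polynomial.smult s (den f)) z = poly ([:- a, 1:] * [:- b, 1:] * [:- c, 1:]) z"
      unfolding that by (simp add: algebra_simps)
  qed
  have e1: "expands (num f) (den f) c \<rho> t" "poly (num f) c / poly (den f) c = w"
    using expands_fibre[OF split[OF c(1)] den q _ \<rho>0] c(2,3,4) t(1,2) \<rho>t by simp_all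
  have e2: "expands (num f) (den f) w (t * \<rho>) \<Lambda>w" "poly (num f) w / poly (den f) w = x"
    using expands_fibre[OF split[OF w(1)] den q _ \<rho>w'(4) \<rho>w'(1,2,3)] wr r by (simp_all add: \<Lambda>w_def)
  have xab: "nrm (x - a) = nrm a" "nrm (x - b) = nrm b"
    using x \<theta>t by (simp_all add: nrm_diff_eq)
  have e3: "expands (num f) (den f) x (\<Lambda>w * t * \<rho>) (t / \<theta>)" "poly (num f) x / poly (den f) x = y"
    using expands_fibre[OF split[OF x(1)] den q _ \<rho>x(2)] \<rho>x(1) \<theta>t t(1,2) x(2,3,4,5) xab by simp_all
  let ?A1 = "homog_subst 3 (num f) (num f) (den f)" and ?B1 = "homog_subst 3 (den f) (num f) (den f)"
  let ?A2 = "homog_subst 3 (num f) ?A1 ?B1" and ?B2 = "homog_subst 3 (den f) ?A1 ?B1"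
  have g1: "expands ?A1 ?B1 c \<rho> (\<Lambda>w * t)" "poly ?A1 c / poly ?B1 c = x"
    using expands_comp[OF e1(1), of f \<Lambda>w] e1(2) e2 t(1) \<Lambda>(3) \<rho>0 by simp_all
  have g2: "expands ?A2 ?B2 c \<rho> \<Lambda>" "poly ?A2 c / poly ?B2 c = y"
    using expands_comp[OF g1(1), of f "t / \<theta>"] g1(2) e3 t(1) \<Lambda>(3) \<rho>0 \<theta> by (simp_all add: \<Lambda>_def)
  have "\<exists>z. nrm (z - c) \<le> \<rho> \<and> poly ?A2 z = z * poly ?B2 z"
    by (rule expands_fixed_point[OF g2(1) \<Lambda>(2) \<rho>0]) (use \<Lambda>(2) in \<open>simp add: g2(2) \<rho>_def\<close>)
  then obtain z where z: "nrm (z - c) \<le> \<rho>" "poly ?A2 z = z * poly ?B2 z"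
    by blast
  define w' where "w' = poly (num f) z / poly (den f) z"
  define x' where "x' = poly (num f) w' / poly (den f) w'"
  note z1 = expandsD[OF e1(1) z(1), unfolded e1(2), folded w'_def]
  have ww: "nrm (w' - w) \<le> t * \<rho>"
    using z1(3) mult_left_mono[OF z(1), of t] t(1) by linarith
  note z2 = expandsD[OF e2(1) ww, unfolded e2(2), folded x'_def]
  have xx: "nrm (x' - x) \<le> \<Lambda>w * t * \<rho>"
    using z2(3) mult_left_mono[OF ww, of \<Lambda>w] \<Lambda>(3) unfolding mult.assoc by linarith
  note z3 = expandsD[OF e3(1) xx, unfolded e3(2)]
  have "poly ?A1 z / poly ?B1 z = x'"
    using z1(1) by (simp add: poly_homog_subst_3 hom_quotient x'_def flip: w'_def)
  moreover have "poly ?B1 z \<noteq> 0" "poly ?B2 z \<noteq> 0"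
    using expandsD(1)[OF g1(1) z(1)] expandsD(1)[OF g2(1) z(1)] by auto
  ultimately have zx: "poly (num f) x' / poly (den f) x' = z"
    using z(2) unfolding poly_homog_subst_3(1)[of f ?A1] poly_homog_subst_3(2)[of f ?A1]
    by (simp add: hom_quotient field_simps)
  have steps: "poly (num f) z = poly (den f) z * w'" "poly (num f) w' = poly (den f) w' * x'"
    "poly (num f) x' = poly (den f) x' * z"
  proof -
    have "p / q = s \<Longrightarrow> q \<noteq> 0 \<Longrightarrow> p = q * s" for p q s :: 'a
      by (simp add: divide_eq_eq mult.commute)
    from this[OF w'_def[symmetric] z1(1)] this[OF x'_def[symmetric] z2(1)] this[OF zx z3(1)]
    show "poly (num f) z = poly (den f) z * w'" "poly (num f) w' = poly (den f) w' * x'"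
      "poly (num f) x' = poly (den f) x' * z" .
  qed
  have norms: "nrm z = t" "nrm w' = r" "nrm x' = \<theta>"
    using nrm_eqI[of z c] nrm_eqI[of w' w] nrm_eqI[of x' x] z(1) ww xx \<rho>t \<rho>w'(1) \<rho>x(1) c(2) wr x(2)
    by simp_all
  define U where "U i = (if i mod 3 = 0 then z else if i mod 3 = 1 then w' else x')" for i :: nat
  have U_val: "i mod 3 = 0 \<Longrightarrow> U i = z" "i mod 3 = 1 \<Longrightarrow> U i = w'" "i mod 3 = 2 \<Longrightarrow> U i = x'" for i
    by (simp_all add: U_def)
  have U_norm: "nrm (U i) = (if i mod 3 = 0 then t else if i mod 3 = 1 then r else \<theta>)" for i
    by (simp add: U_def norms)
  have "hom_cycle f 3 U (\<lambda>_. 1) (\<lambda>i. poly (den f) (U i))"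
    unfolding hom_cycle_def
  proof (intro conjI allI impI)
    fix i j :: nat
    assume "0 < j" "j < 3"
    then have j: "j = 1 \<or> j = 2"
      by auto
    have "i mod 3 = 0 \<or> i mod 3 = 1 \<or> i mod 3 = 2"
      by presburger
    moreover have "(i + j) mod 3 = (i mod 3 + j) mod 3"
      by (simp add: mod_add_left_eq)
    \<comment> \<open>The three points have pairwise different norms t > r > \<theta>, so the period
      is exactly 3.\<close>
    ultimately have "nrm (U i) \<noteq> nrm (U (i + j))"
      using j \<theta>t rt unfolding U_norm by (elim disjE) auto
    then show "U i * 1 \<noteq> U (i + j) * 1"
      by auto
  next
    fix i :: nat
    have "i mod 3 = 0 \<and> Suc i mod 3 = 1 \<or> i mod 3 = 1 \<and> Suc i mod 3 = 2
      \<or> i mod 3 = 2 \<and> Suc i mod 3 = 0"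
      by presburger
    then consider "i mod 3 = 0" "Suc i mod 3 = 1" | "i mod 3 = 1" "Suc i mod 3 = 2"
      | "i mod 3 = 2" "Suc i mod 3 = 0"
      by (elim disjE conjE)
    then have "poly (num f) (U i) = poly (den f) (U i) * U (Suc i)"
      by cases (simp_all only: U_val steps)
    then show "homP f (U i) 1 = poly (den f) (U i) * U (Suc i)"
      by (simp add: homP_1)
  next
    fix i :: nat
    show "homQ f (U i) 1 = poly (den f) (U i) * 1"
      by (simp add: homQ_1)
    have "(i + 3) mod 3 = i mod 3"
      by simp
    then show "U (i + 3) = U i"
      unfolding U_def by (simp only:)
    then show "poly (den f) (U (i + 3)) = poly (den f) (U i)"
      by (simp only:)
  qed simp_all
  moreover have "(\<Prod>i<3. nrm (poly (den f) (U i)))\<^sup>2 < (\<Prod>i<3. nrm (jac f (U i) 1))"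
  proof -
    let ?p = "nrm (poly (den f) z) * nrm (poly (den f) w') * nrm (poly (den f) x')"
    have 3: "(\<Prod>i<3. g i) = g 0 * g 1 * g 2" for g :: "nat \<Rightarrow> real"
      by (simp add: eval_nat_numeral)
    have U: "U 0 = z" "U 1 = w'" "U 2 = x'"
      by (simp_all add: U_def)
    have "(\<Prod>i<3. nrm (jac f (U i) 1)) = \<Lambda> * ?p\<^sup>2"
      unfolding 3 U jac_1' z1(2) z2(2) z3(2) \<Lambda>_def power_mult_distrib by (simp only: mult_ac)
    moreover have "(\<Prod>i<3. nrm (poly (den f) (U i))) = ?p"
      unfolding 3 U ..
    moreover have "0 < ?p\<^sup>2"
      using z1(1) z2(1) z3(1) by (simp add: nrm_eq_0_iff)
    ultimately show ?thesis
      using \<Lambda>(2) by simp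
  qed
  ultimately show ?thesis
    unfolding repelling_def by blast
qed

subsection \<open>Reductions of degree one with two holes\<close>

lemmas le1_intros = nrm_add_leI nrm_diff_leI nrm_mult_le1 nrm_power_le1

lemma repelling_fixed_point:
  assumes "u \<noteq> 0 \<or> v \<noteq> 0" "homP f u v = l * u" "homQ f u v = l * v" "(nrm l)\<^sup>2 < nrm (jac f u v)"
  shows "repelling f"
proof -
  have "hom_cycle f 1 (\<lambda>_. u) (\<lambda>_. v) (\<lambda>_. l)"
    using assms by (simp add: hom_cycle_def)
  moreover have "(\<Prod>i<(1::nat). nrm l)\<^sup>2 < (\<Prod>i<(1::nat). nrm (jac f u v))"
    using assms(4) by simp
  ultimately show ?thesis
    unfolding repelling_def by blast
qed

lemma nondegD:
  assumes "nondeg f"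
  shows "P3 f \<noteq> 0 \<or> Q3 f \<noteq> 0" "P0 f \<noteq> 0 \<or> Q0 f \<noteq> 0"
    "poly (num f) z = 0 \<Longrightarrow> poly (den f) z \<noteq> 0"
proof -
  show "P3 f \<noteq> 0 \<or> Q3 f \<noteq> 0" "P0 f \<noteq> 0 \<or> Q0 f \<noteq> 0"
    using assms[unfolded nondeg_def, rule_format, of 1 0] assms[unfolded nondeg_def, rule_format, of 0 1]
    by (auto simp: homP_def homQ_def)
  show "poly (den f) z \<noteq> 0" if "poly (num f) z = 0"
    using that assms[unfolded nondeg_def, rule_format, of z 1] by (auto simp: homP_1 homQ_1)
qed

text \<open>The numerator is monic with small lower coefficients, so its roots lie in the open unit
  disc. None is 0, because 0 is already a zero of the denominator.\<close>

lemma alternative_squaring: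
  assumes Q: "Q0 f = 0" "Q1 f = 1" "Q3 f = 0" "nrm (Q2 f) \<le> 1"
    and P: "P3 f = 1" "nrm (P0 f) < 1" "nrm (P1 f) < 1" "nrm (P2 f) < 1"
  shows "alternative f"
  unfolding alternative_def
proof (intro impI disjI2)
  assume f: "nondeg f"
  obtain a b c where abc: "a + b + c = - P2 f" "a * b + a * c + b * c = P1 f" "a * b * c = - P0 f"
    and ord: "nrm a \<le> nrm b" "nrm b \<le> nrm c"
    using cubic_split[of "- P2 f" "P1 f" "- P0 f" nrm] by blast
  have "nrm c < 1"
  proof (rule ccontr)
    assume "\<not> ?thesis"
    then have c: "1 \<le> nrm c"
      by simp
    have "c ^ 3 = (a + b + c) * c\<^sup>2 - (a * b + a * c + b * c) * c + a * b * c"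
      by (simp add: expand_simps)
    also have "\<dots> = c\<^sup>2 * (- P2 f) - c * P1 f - P0 f"
      unfolding abc by (simp add: mult.commute)
    finally have "c ^ 3 = c\<^sup>2 * (- P2 f) - c * P1 f - P0 f" .
    moreover have "nrm (c\<^sup>2 * (- P2 f)) < nrm (c\<^sup>2)" "nrm (c * P1 f) < nrm (c\<^sup>2)" "nrm (P0 f) < nrm (c\<^sup>2)"
    proof -
      have "nrm (c\<^sup>2) = nrm c * nrm c"
        by (simp add: power2_eq_square nrm_mult)
      then have c2: "nrm c * 1 \<le> nrm (c\<^sup>2)"
        using mult_left_mono[OF c nrm_nonneg[of c]] by simp
      show "nrm (c\<^sup>2 * (- P2 f)) < nrm (c\<^sup>2)"
        unfolding nrm_mult using P c c2 mult_strict_left_mono[of "nrm (P2 f)" 1 "nrm (c\<^sup>2)"] by simp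
      have "nrm c * nrm (P1 f) < nrm c * 1"
        using P c by (intro mult_strict_left_mono) auto
      then show "nrm (c * P1 f) < nrm (c\<^sup>2)"
        unfolding nrm_mult using c2 by linarith
      show "nrm (P0 f) < nrm (c\<^sup>2)"
        using P c c2 by linarith
    qed
    ultimately have "nrm (c ^ 3) < nrm (c\<^sup>2)"
      by (metis nrm_diff_lessI)
    then show False
      using c power_increasing[of 2 3 "nrm c"] by (simp add: nrm_power)
  qed
  moreover have "a \<noteq> 0"
    using nondegD(2)[OF f] Q abc(3) by auto
  moreover have "P2 f = - (a + b + c)" "P0 f = - (a * b * c)"
    by (simp_all add: abc)
  ultimately show "repelling f"
    using abc(2) Q P ord by (intro repelling_3_cycle[where ?w1.0 = a and ?w2.0 = b and ?w3.0 = c and q = "Q2 f"]) auto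
qed

lemma small_root_of_quadratic_coeff:
  assumes "nrm (poly.coeff p 0) < 1" "nrm (poly.coeff p 2) = 1"
  shows "\<exists>x. nrm x < 1 \<and> poly p x = 0"
proof (rule ccontr)
  assume no: "\<not> ?thesis"
  let ?\<rho> = "sqrt (nrm (poly.coeff p 0))"
  have "?\<rho> < 1"
    using assms(1) by simp
  then have "?\<rho> < nrm x" if "poly p x = 0" for x
    using no that by (meson less_le_trans not_le)
  moreover have "p \<noteq> 0"
    using assms(2) by auto
  ultimately have "nrm (poly.coeff p 2) * ?\<rho> ^ 2 < nrm (poly.coeff p 0)"
    using nrm_nonneg by (intro coeff_bound) auto
  then show False
    using assms(2) nrm_nonneg by simp
qed

text \<open>The reduction is [0 : z], a constant map with holes at 0 and infinity. A fixed point is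
  moved to infinity, a pole to 0, and the numerator is made monic; the local facts
  \<open>last\<close> and \<open>pole\<close> treat these stages in reverse order.\<close>

lemma alternative_degree_0:
  assumes "nrm (P0 f) < 1" "nrm (P1 f) < 1" "nrm (P2 f) < 1" "nrm (P3 f) < 1"
    "nrm (Q0 f) < 1" "nrm (Q1 f) = 1" "nrm (Q2 f) < 1" "nrm (Q3 f) < 1"
  shows "alternative f"
proof -
  have last: "alternative g" if Q: "Q0 g = 0" "Q3 g = 0" "nrm (Q1 g) = 1" "nrm (Q2 g) < 1"
    and P: "nrm (P0 g) < 1" "nrm (P1 g) < 1" "nrm (P2 g) < 1" "nrm (P3 g) < 1" for g
  proof (rule alternative_smul)
    let ?k = "inverse (Q1 g)"
    show "?k \<noteq> 0"
      using Q by auto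
    have k: "nrm ?k = 1"
      using Q by (simp add: nrm_inverse)
    define h where "h = smul ?k g"
    have h: "Q0 h = 0" "Q3 h = 0" "Q1 h = 1" "nrm (Q2 h) < 1"
      "nrm (P0 h) < 1" "nrm (P1 h) < 1" "nrm (P2 h) < 1" "nrm (P3 h) < 1"
      using Q P k \<open>?k \<noteq> 0\<close> by (auto simp: h_def nrm_mult)
    have "alternative h"
    proof (cases "P3 h = 0")
      case True
      then show ?thesis
        using h nondegD(1)[of h] by (auto simp: alternative_def)
    next
      case P3: False
      then have p3: "0 < nrm (P3 h)"
        by (simp add: nrm_pos_iff)
      show ?thesis
      \<comment> \<open>Infinity is fixed with multiplier \<open>Q2 h / P3 h\<close>. If it is not
        repelling, the same quotient is the parameter \<open>q\<close> of norm at most 1 after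
        zooming out by \<open>P3 h\<close>.\<close>
      proof (cases "nrm (P3 h) < nrm (Q2 h)")
        case True
        have "repelling h"
          by (rule repelling_fixed_point[of 1 0 _ "P3 h"])
            (use True h p3 in \<open>simp_all add: homP_def homQ_def jac_def nrm_mult power2_eq_square\<close>)
        then show ?thesis
          by (simp add: alternative_def)
      next
        case False
        show ?thesis
        proof (rule alternative_rescale)
          show "inverse (P3 h) \<noteq> 0"
            using P3 by simp
          show "alternative (rescale (inverse (P3 h)) h)"
          proof (rule alternative_squaring)
            show "nrm (Q2 (rescale (inverse (P3 h)) h)) \<le> 1"
              using False p3 by (simp add: nrm_divide field_simps)
            have "P0 (rescale (inverse (P3 h)) h) = P0 h * (P3 h)\<^sup>2" "P1 (rescale (inverse (P3 h)) h) = P1 h * P3 h"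
              using P3 by (simp_all add: field_simps)
            then show "nrm (P0 (rescale (inverse (P3 h)) h)) < 1" "nrm (P1 (rescale (inverse (P3 h)) h)) < 1"
              using h by (auto intro!: nrm_mult_less1 nrm_power_le1)
          qed (use h P3 in simp_all)
        qed
      qed
    qed
    then show "alternative (smul ?k g)"
      by (simp add: h_def)
  qed
  have pole: "alternative g" if Q: "nrm (Q0 g) < 1" "Q3 g = 0" "nrm (Q1 g) = 1" "nrm (Q2 g) < 1"
    and P: "nrm (P0 g) < 1" "nrm (P1 g) < 1" "nrm (P2 g) < 1" "nrm (P3 g) < 1" for g
  proof -
    have "\<exists>c. nrm (c - 0) \<le> nrm (Q0 g) \<and> poly (den g) c = 0"
      by (rule newton_root) (simp_all add: den_def pderiv_pCons Q nrm_nonneg)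
    then obtain c where c: "nrm c < 1" "poly (den g) c = 0"
      using Q(1) by (metis diff_zero le_less_trans)
    have c2: "nrm (c\<^sup>2) < 1" "nrm (c ^ 3) < 1"
      using c by (simp_all add: nrm_power_less1)
    have "nrm (2 * Q2 g * c) < 1"
      using Q c by (intro nrm_mult_less1') (auto simp: nrm_mult)
    then have "nrm (Q1 g + 2 * Q2 g * c) = 1"
      using Q by (simp add: nrm_add_eq2)
    moreover have "nrm (c * (Q0 g + Q1 g * c + Q2 g * c\<^sup>2)) < 1" "nrm (c * (Q1 g + 2 * Q2 g * c)) < 1"
      "nrm (c * Q2 g) < 1"
      using Q c c2 by (auto intro!: nrm_mult_less1 nrm_add_leI nrm_mult_le1)
    moreover have "nrm (P0 g + P1 g * c + P2 g * c\<^sup>2 + P3 g * c ^ 3) < 1"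
      "nrm (P1 g + 2 * P2 g * c + 3 * P3 g * c\<^sup>2) < 1" "nrm (P2 g + 3 * P3 g * c) < 1"
      using P c c2 by (auto intro!: nrm_add_lessI nrm_mult_less1' nrm_mult_le1)
    moreover have "Q0 g + Q1 g * c + Q2 g * c\<^sup>2 = 0"
      using c(2) Q by (simp add: den_def algebra_simps power2_eq_square)
    ultimately have "alternative (translate c g)"
      using Q P by (intro last) (auto intro!: nrm_diff_lessI)
    then show ?thesis
      by (rule alternative_translate)
  qed
  \<comment> \<open>In the coordinate 1/z the fixed point quartic has a small constant coefficient
    and a unit coefficient at degree 2, so a fixed point lies near 0, that is, near infinity for
    \<open>f\<close>.\<close>
  define g where "g = invert f"
  have g: "nrm (P0 g) < 1" "nrm (P1 g) < 1" "nrm (P2 g) = 1" "nrm (P3 g) < 1"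
    "nrm (Q0 g) < 1" "nrm (Q1 g) < 1" "nrm (Q2 g) < 1" "nrm (Q3 g) < 1"
    using assms by (simp_all add: g_def)
  let ?F = "[:- P0 g, Q0 g - P1 g, Q1 g - P2 g, Q2 g - P3 g, Q3 g:]"
  have "nrm (Q1 g - P2 g) = 1"
    using g by (simp add: nrm_diff_eq)
  then obtain c where c: "nrm c < 1" "poly ?F c = 0"
    using small_root_of_quadratic_coeff[of ?F] g by (auto simp: eval_nat_numeral)
  have c2: "nrm (c\<^sup>2) < 1" "nrm (c ^ 3) < 1"
    using c by (simp_all add: nrm_power_less1)
  have "P0 g + P1 g * c + P2 g * c\<^sup>2 + P3 g * c ^ 3 - c * (Q0 g + Q1 g * c + Q2 g * c\<^sup>2 + Q3 g * c ^ 3)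
      = - poly ?F c"
    by (simp add: expand_simps)
  then have P0: "P0 (translate c g) = 0"
    unfolding translate_simps c(2) by simp
  have P2: "nrm (P2 (translate c g)) = 1"
  proof -
    have "nrm (3 * P3 g * c - c * (Q2 g + 3 * Q3 g * c)) < 1"
      using g c by (intro nrm_diff_lessI nrm_mult_less1' nrm_mult_less1 nrm_add_leI nrm_mult_le1) auto
    then have "nrm (P2 g + (3 * P3 g * c - c * (Q2 g + 3 * Q3 g * c))) = 1"
      using g by (simp add: nrm_add_eq2)
    then show ?thesis
      by (simp add: algebra_simps)
  qed
  have rest: "nrm (P1 (translate c g)) < 1" "nrm (P3 (translate c g)) < 1" "nrm (Q0 (translate c g)) < 1"
    "nrm (Q1 (translate c g)) < 1" "nrm (Q2 (translate c g)) < 1" "nrm (Q3 (translate c g)) < 1"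
    using g c c2
    by (auto intro!: nrm_add_lessI nrm_diff_lessI nrm_mult_less1' nrm_mult_le1)
  have "alternative (invert (translate c g))"
    by (rule pole) (use P0 P2 rest in \<open>simp_all del: translate_simps\<close>)
  then show ?thesis
    using alternative_invert alternative_translate g_def by metis
qed

lemma alternative_two_holes:
  assumes "nrm (P0 f) < 1" "nrm (P1 f) < 1" "nrm (P3 f) < 1" "nrm (Q0 f) < 1" "nrm (Q2 f) < 1" "nrm (Q3 f) < 1"
    and "nrm (P2 f) \<le> 1" "nrm (Q1 f) \<le> 1" "nrm (P2 f) = 1 \<or> nrm (Q1 f) = 1"
  shows "alternative f"
proof -
  consider "nrm (P2 f) = 1" "nrm (Q1 f) = 1" | "nrm (P2 f) < 1" "nrm (Q1 f) = 1"
    | "nrm (P2 f) = 1" "nrm (Q1 f) < 1"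
    using assms by linarith
  then show ?thesis
  proof cases
    case 1
    then show ?thesis
      using assms repelling_2_cycle by (auto simp: alternative_def)
  next
    case 2
    then show ?thesis
      using assms by (intro alternative_degree_0) auto
  next
    case 3
    then show ?thesis
      using assms by (intro alternative_invert[OF alternative_degree_0]) auto
  qed
qed

subsection \<open>Semistable models\<close>

text \<open>The Hilbert-Mumford condition at 0: every coefficient of nonpositive weight under
  \<open>rescale\<close> is small. A slight zoom into 0 then makes all coefficients of an integral
  model small.\<close>

definition destabilized :: "'a cubic \<Rightarrow> bool" where
  "destabilized f \<longleftrightarrow> nrm (P0 f) < 1 \<and> nrm (P1 f) < 1 \<and> nrm (P2 f) < 1 \<and> nrm (Q0 f) < 1 \<and> nrm (Q1 f) < 1"

text \<open>The test is made at every point of the reduced projective line; infinity is reached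
  through \<open>invert\<close>.\<close>

definition semistable :: "'a cubic \<Rightarrow> bool" where
  "semistable f \<longleftrightarrow> integral f \<and> (\<forall>c. nrm c \<le> 1 \<longrightarrow> \<not> destabilized (translate c f))
     \<and> \<not> destabilized (invert f)"

lemma integral_translate: "integral f \<Longrightarrow> nrm c \<le> 1 \<Longrightarrow> integral (translate c f)"
  by (auto simp: integral_def intro!: le1_intros)

text \<open>For \<open>m\<close> of norm below 1 dominating the three elements, a cube root
  \<open>s\<close> satisfies |m| = |s|^3 < |s|^2 < 1.\<close>

lemma exists_larger:
  assumes "nrm x < 1" "nrm y < 1" "nrm z < 1"
  shows "\<exists>s. s \<noteq> 0 \<and> nrm s < 1 \<and> nrm x < (nrm s)\<^sup>2 \<and> nrm y < (nrm s)\<^sup>2 \<and> nrm z < (nrm s)\<^sup>2"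
proof -
  obtain m where m: "nrm m < 1" "nrm x \<le> nrm m" "nrm y \<le> nrm m" "nrm z \<le> nrm m" "m \<noteq> 0"
  proof -
    obtain e where e: "e \<noteq> 0" "nrm e < 1"
      using exists_small by blast
    obtain a where a: "a = x \<or> a = y" "nrm x \<le> nrm a" "nrm y \<le> nrm a"
      using nrm_larger by blast
    obtain b where b: "b = z \<or> b = e" "nrm z \<le> nrm b" "nrm e \<le> nrm b"
      using nrm_larger by blast
    obtain m where m: "m = a \<or> m = b" "nrm a \<le> nrm m" "nrm b \<le> nrm m"
      using nrm_larger by blast
    have "0 < nrm e"
      using e by (simp add: nrm_pos_iff)
    then have "0 < nrm m"
      using b m by linarith
    moreover have "nrm m < 1"
      using assms e a(1) b(1) m(1) by blast
    ultimately show thesis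
      using that[of m] a b m by (simp add: nrm_pos_iff)
  qed
  obtain s where s: "s ^ 3 = m"
    using nth_root[of 3 m] by auto
  have s0: "s \<noteq> 0"
    using s m by auto
  have "nrm s ^ 3 = nrm m"
    by (simp add: nrm_power flip: s)
  moreover have "nrm s < 1"
  proof (rule ccontr)
    assume "\<not> ?thesis"
    then have "1 \<le> nrm s ^ 3"
      by (intro one_le_power) simp
    then show False
      using m calculation by simp
  qed
  moreover from this s0 have "nrm s ^ 3 < nrm s ^ 2"
    by (intro power_strict_decreasing) (auto simp: nrm_pos_iff)
  ultimately show ?thesis
    using m s0 by (intro exI[of _ s]) auto
qed

lemma alternative_hole:
  assumes int: "integral f" and hole: "nrm (P0 f) < 1" "nrm (Q0 f) < 1" and st: "\<not> destabilized f"
  shows "alternative f"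
proof (cases "nrm (P1 f) < 1")
  case True
  then have unit: "nrm (P2 f) = 1 \<or> nrm (Q1 f) = 1"
    using int hole st by (auto simp: integral_def destabilized_def)
  \<comment> \<open>The zoom is mild enough that dividing by \<open>s\<close> or
    \<open>s\<^sup>2\<close> keeps the coefficients of negative weight small, while those of
    positive weight become small. \<open>P2\<close> and \<open>Q1\<close> do not change, and one of
    them is a unit because the point does not destabilise.\<close>
  obtain s where s: "s \<noteq> 0" "nrm s < 1" "nrm (P0 f) < (nrm s)\<^sup>2" "nrm (P1 f) < (nrm s)\<^sup>2"
    "nrm (Q0 f) < (nrm s)\<^sup>2"
    using exists_larger[OF hole(1) True hole(2)] by blast
  have s0: "0 < nrm s"
    using s by (simp add: nrm_pos_iff)
  have s1: "(nrm s)\<^sup>2 < nrm s"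
    using mult_strict_left_mono[OF s(2) s0] by (simp add: power2_eq_square)
  have "alternative (rescale s f)"
  proof (rule alternative_two_holes)
    show "nrm (P0 (rescale s f)) < 1" "nrm (P1 (rescale s f)) < 1" "nrm (Q0 (rescale s f)) < 1"
      using s s0 s1 by (simp_all add: nrm_divide nrm_power)
    show "nrm (P3 (rescale s f)) < 1" "nrm (Q2 (rescale s f)) < 1" "nrm (Q3 (rescale s f)) < 1"
      using int s by (auto simp: integral_def intro!: nrm_mult_less1' nrm_power_less1)
  qed (use unit int in \<open>auto simp: integral_def\<close>)
  then show ?thesis
    by (rule alternative_rescale[OF s(1)])
next
  case False
  then have P1: "nrm (P1 f) = 1"
    using int by (auto simp: integral_def)
  show ?thesis
    unfolding alternative_def
  proof (intro impI disjI2)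
    assume f: "nondeg f"
    \<comment> \<open>The linear coefficient is a unit: the hole is a simple zero of the reduced
      fixed point form. At the fixed point near it the denominator is small, whereas P' - z Q' is a
      unit, so the multiplier is the inverse of a small number in norm.\<close>
    let ?F = "[:- P0 f, Q0 f - P1 f, Q1 f - P2 f, Q2 f - P3 f, Q3 f:]"
    have "nrm (Q0 f - P1 f) = 1"
      using P1 hole by (simp add: nrm_diff_eq)
    then have "\<exists>z. nrm (z - 0) \<le> nrm (P0 f) \<and> poly ?F z = 0"
      by (intro newton_root) (simp_all add: pderiv_pCons nrm_nonneg)
    then obtain z where z: "nrm z < 1" "poly ?F z = 0"
      using hole(1) by (metis diff_zero le_less_trans)
    have fp: "poly (num f) z = z * poly (den f) z"
      using z(2) by (simp add: num_def den_def algebra_simps)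
    have "poly (den f) z = Q0 f + z * (Q1 f + z * (Q2 f + z * Q3 f))"
      by (simp add: den_def)
    moreover have "nrm (Q0 f + z * (Q1 f + z * (Q2 f + z * Q3 f))) < 1"
      using hole int z unfolding integral_def
      by (intro nrm_add_lessI nrm_mult_less1 nrm_add_leI nrm_mult_le1) auto
    ultimately have d1: "nrm (poly (den f) z) < 1"
      by simp
    have d0: "poly (den f) z \<noteq> 0"
      using nondegD(3)[OF f, of z] fp by auto
    have jac: "jac f z 1 = poly (den f) z * (poly (pderiv (num f)) z - z * poly (pderiv (den f)) z)"
      unfolding jac_1 fp by (simp add: algebra_simps)
    have "poly (pderiv (num f)) z - z * poly (pderiv (den f)) z
        = P1 f + z * (2 * P2 f + 3 * P3 f * z - (Q1 f + 2 * Q2 f * z + 3 * Q3 f * z * z))"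
      by (simp add: num_def den_def pderiv_pCons algebra_simps)
    moreover have "nrm (z * (2 * P2 f + 3 * P3 f * z - (Q1 f + 2 * Q2 f * z + 3 * Q3 f * z * z))) < 1"
      using int z unfolding integral_def
      by (intro nrm_mult_less1 nrm_diff_leI nrm_add_leI nrm_mult_le1) auto
    ultimately have "nrm (poly (pderiv (num f)) z - z * poly (pderiv (den f)) z) = 1"
      using P1 by (simp add: nrm_add_eq2)
    then have "nrm (jac f z 1) = nrm (poly (den f) z)"
      by (simp add: jac nrm_mult)
    moreover have "nrm (poly (den f) z) * nrm (poly (den f) z) < nrm (poly (den f) z) * 1"
      using d0 d1 by (intro mult_strict_left_mono) (auto simp: nrm_pos_iff)
    ultimately show "repelling f"
      by (intro repelling_fixed_point[of z 1 _ "poly (den f) z"])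
        (simp_all add: homP_1 homQ_1 fp power2_eq_square)
  qed
qed

lemma alternative_semistable:
  assumes ss: "semistable f"
  shows "alternative f"
proof (cases "no_hole f")
  case True
  have "conjugate_by 1 0 0 1 1 f f"
    by (simp add: conjugate_by_def)
  then show ?thesis
    using True unfolding alternative_def potentially_good_def by blast
next
  case False
  have int: "integral f"
    using ss by (simp add: semistable_def)
  note co = integral_coeff[OF int]
  consider c where "nrm c \<le> 1" "nrm (poly (num f) c) < 1" "nrm (poly (den f) c) < 1"
    | "nrm (P3 f) < 1" "nrm (Q3 f) < 1"
    using False int nrm_poly_le1[OF co(1)] nrm_poly_le1[OF co(2)]
    unfolding no_hole_def integral_def by (meson antisym_conv2)
  then show ?thesis
  proof cases
    case 1
    have "P0 (translate c f) = poly (num f) c - c * poly (den f) c" "Q0 (translate c f) = poly (den f) c"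
      by (simp_all add: num_def den_def expand_simps)
    then have "alternative (translate c f)"
      using 1 ss integral_translate[OF int 1(1)] unfolding semistable_def
      by (intro alternative_hole) (auto intro!: nrm_diff_lessI nrm_mult_less1' simp del: translate_simps)
    then show ?thesis
      by (rule alternative_translate)
  next
    case 2
    have "integral (invert f)"
      using int by (auto simp: integral_def)
    then have "alternative (invert f)"
      using 2 ss unfolding semistable_def by (intro alternative_hole) auto
    then show ?thesis
      by (rule alternative_invert)
  qed
qed

text \<open>The quadratic form is centred with leading coefficient 1. Destabilisation at infinity
  would make this leading coefficient small; at \<open>c\<close> it would make the middle
  coefficient, which translation turns into a multiple of \<open>c\<close>, small. So only the class
  of 0 remains, and there a unit coefficient prevents it.\<close>

lemma semistable_normal_form:
  assumes H: "P2 f + Q1 f = 0" "3 * P3 f + Q2 f = 1"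
    and le: "nrm (P0 f) \<le> 1" "nrm (Q0 f - P1 f) \<le> 1" "nrm (Q1 f - P2 f) \<le> 1" "nrm (3 * Q0 f + P1 f) \<le> 1"
    and less: "nrm (Q2 f - P3 f) < 1" "nrm (Q3 f) < 1"
    and unit: "nrm (P0 f) = 1 \<or> nrm (Q0 f - P1 f) = 1 \<or> nrm (Q1 f - P2 f) = 1 \<or> nrm (3 * Q0 f + P1 f) = 1"
  shows "semistable f"
proof -
  have int: "integral f"
  proof -
    \<comment> \<open>P and Q are recovered from \<open>F\<close> and \<open>h\<close> by linear
      formulas whose denominators 2 and 4 are units.\<close>
    have "nrm (4 * P1 f) \<le> 1" "nrm (4 * Q0 f) \<le> 1" "nrm (2 * Q1 f) \<le> 1" "nrm (4 * P3 f) \<le> 1" "nrm (4 * Q2 f) \<le> 1"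
    proof -
      have "4 * P1 f = (3 * Q0 f + P1 f) - 3 * (Q0 f - P1 f)" "4 * Q0 f = (3 * Q0 f + P1 f) + (Q0 f - P1 f)"
        "2 * Q1 f = (P2 f + Q1 f) + (Q1 f - P2 f)" "4 * P3 f = (3 * P3 f + Q2 f) - (Q2 f - P3 f)"
        "4 * Q2 f = (3 * P3 f + Q2 f) + 3 * (Q2 f - P3 f)"
        by (simp_all add: algebra_simps)
      moreover have "nrm ((3 * Q0 f + P1 f) - 3 * (Q0 f - P1 f)) \<le> 1" "nrm ((3 * Q0 f + P1 f) + (Q0 f - P1 f)) \<le> 1"
        "nrm (0 + (Q1 f - P2 f)) \<le> 1" "nrm (1 - (Q2 f - P3 f)) \<le> 1" "nrm (1 + 3 * (Q2 f - P3 f)) \<le> 1"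
      proof -
        have 3: "nrm (3 * (Q0 f - P1 f)) \<le> 1" "nrm (3 * (Q2 f - P3 f)) \<le> 1"
          using le less by (simp_all only: nrm_mult nrm_numeral mult_1 less_imp_le)
        show "nrm ((3 * Q0 f + P1 f) - 3 * (Q0 f - P1 f)) \<le> 1" "nrm ((3 * Q0 f + P1 f) + (Q0 f - P1 f)) \<le> 1"
          by (rule nrm_diff_leI[OF le(4) 3(1)], rule nrm_add_leI[OF le(4) le(2)])
        show "nrm (0 + (Q1 f - P2 f)) \<le> 1" "nrm (1 - (Q2 f - P3 f)) \<le> 1" "nrm (1 + 3 * (Q2 f - P3 f)) \<le> 1"
          using le(3) less(1) 3(2) by (simp_all only: nrm_diff_leI nrm_add_leI nrm_one order_refl less_imp_le add_0)
      qed
      ultimately show "nrm (4 * P1 f) \<le> 1" "nrm (4 * Q0 f) \<le> 1" "nrm (2 * Q1 f) \<le> 1"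
        "nrm (4 * P3 f) \<le> 1" "nrm (4 * Q2 f) \<le> 1"
        using H by metis+
    qed
    then have 1: "nrm (P1 f) \<le> 1" "nrm (Q0 f) \<le> 1" "nrm (Q1 f) \<le> 1" "nrm (P3 f) \<le> 1" "nrm (Q2 f) \<le> 1"
      by (simp_all only: nrm_mult nrm_numeral mult_1)
    have "P2 f = - Q1 f"
      using H(1) by (simp add: eq_neg_iff_add_eq_0)
    then show ?thesis
      unfolding integral_def using 1 le less by simp
  qed
  have "\<not> destabilized (invert f)"
  proof
    assume "destabilized (invert f)"
    then have "nrm (3 * P3 f + Q2 f) < 1"
      by (intro nrm_add_lessI) (simp_all add: destabilized_def nrm_mult)
    then show False
      using H by simp
  qed
  moreover have "\<not> destabilized (translate c f)" if c1: "nrm c \<le> 1" for c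
  proof
    assume d: "destabilized (translate c f)"
    have "P2 (translate c f) + Q1 (translate c f) = (P2 f + Q1 f) + c * (3 * P3 f + Q2 f)"
      by (simp add: algebra_simps power2_eq_square)
    also have "\<dots> = c"
      using H by simp
    finally have "c = P2 (translate c f) + Q1 (translate c f)" ..
    then have c: "nrm c < 1"
      using d nrm_add_lessI unfolding destabilized_def by metis
    have descend: "nrm x < 1" if "nrm (x + c * y) < 1" "nrm y \<le> 1" for x y
      using nrm_diff_lessI[OF that(1) nrm_mult_less1[OF c that(2)]] by simp
    note i = int[unfolded integral_def]
    have P0: "nrm (P0 f) < 1"
    proof (rule descend)
      show "nrm (P0 f + c * (P1 f + P2 f * c + P3 f * c\<^sup>2 - (Q0 f + Q1 f * c + Q2 f * c\<^sup>2 + Q3 f * c ^ 3))) < 1"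
        using d by (simp add: destabilized_def expand_simps)
    qed (use i c1 in \<open>auto intro!: le1_intros\<close>)
    moreover have P1: "nrm (P1 f) < 1"
    proof (rule descend)
      show "nrm (P1 f + c * (2 * P2 f + 3 * P3 f * c - (Q1 f + 2 * Q2 f * c + 3 * Q3 f * c\<^sup>2))) < 1"
        using d by (simp add: destabilized_def expand_simps)
    qed (use i c1 in \<open>auto intro!: le1_intros\<close>)
    moreover have P2: "nrm (P2 f) < 1"
    proof (rule descend)
      show "nrm (P2 f + c * (3 * P3 f - (Q2 f + 3 * Q3 f * c))) < 1"
        using d by (simp add: destabilized_def expand_simps)
    qed (use i c1 in \<open>auto intro!: le1_intros\<close>)
    moreover have Q0: "nrm (Q0 f) < 1"
    proof (rule descend)
      show "nrm (Q0 f + c * (Q1 f + Q2 f * c + Q3 f * c\<^sup>2)) < 1"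
        using d by (simp add: destabilized_def expand_simps)
    qed (use i c1 in \<open>auto intro!: le1_intros\<close>)
    moreover have Q1: "nrm (Q1 f) < 1"
    proof (rule descend)
      show "nrm (Q1 f + c * (2 * Q2 f + 3 * Q3 f * c)) < 1"
        using d by (simp add: destabilized_def expand_simps)
    qed (use i c1 in \<open>auto intro!: le1_intros\<close>)
    have "nrm (Q0 f - P1 f) < 1" "nrm (Q1 f - P2 f) < 1" "nrm (3 * Q0 f + P1 f) < 1"
      using P1 P2 Q0 Q1 by (auto intro!: nrm_diff_lessI nrm_add_lessI simp: nrm_mult)
    then show False
      using unit P0 by auto
  qed
  ultimately show ?thesis
    using int by (simp add: semistable_def)
qed

text \<open>
  Writing \<open>F = z Q - P\<close> and \<open>h = (3 Q\<^sub>0 + P\<^sub>1) + 2 (P\<^sub>2 + Q\<^sub>1) z + (3 P\<^sub>3 + Q\<^sub>2) z\<^sup>2\<close>, changes of coordinate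
  act on \<open>F\<close> and \<open>h\<close> as on a binary quartic and a binary quadratic form. Here \<open>0\<close> is the centre of
  the roots of \<open>h\<close>, and the scale is chosen where \<open>h\<close> and the leading part of \<open>F\<close> have the same size.
\<close>

lemma alternative_centred:
  assumes H1: "P2 f + Q1 f = 0" and H2: "3 * P3 f + Q2 f \<noteq> 0"
    and F3: "nrm (Q2 f - P3 f) < nrm (3 * P3 f + Q2 f)"
    and F4: "Q3 f = 0 \<or> nrm (Q3 f) < nrm (3 * P3 f + Q2 f) \<and> nrm (P0 f) \<le> nrm (3 * P3 f + Q2 f)
      \<and> nrm (Q0 f - P1 f) \<le> nrm (3 * P3 f + Q2 f) \<and> nrm (Q1 f - P2 f) \<le> nrm (3 * P3 f + Q2 f)
      \<and> nrm (3 * Q0 f + P1 f) \<le> nrm (3 * P3 f + Q2 f)"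
  shows "alternative f"
proof -
  define H where "H = 3 * P3 f + Q2 f"
  have H0: "H \<noteq> 0" "0 < nrm H"
    using H2 by (simp_all add: H_def nrm_pos_iff)
  \<comment> \<open>After rescaling by \<open>s\<close> and normalising \<open>h\<close>, the four
    coefficients carry the factors s^-3, s^-2, s^-1 and s^-2. Extracting the matching roots makes
    every bound read |r_i| \<le> |s|, so the largest of the roots is the right scale.\<close>
  obtain r0 where r0: "r0 ^ 3 = P0 f / H"
    using nth_root[of 3] by auto
  obtain r1 where r1: "r1 ^ 2 = (Q0 f - P1 f) / H"
    using nth_root[of 2] by auto
  define r2 where "r2 = (Q1 f - P2 f) / H"
  obtain r3 where r3: "r3 ^ 2 = (3 * Q0 f + P1 f) / H"
    using nth_root[of 2] by auto
  obtain s where s: "s = r0 \<or> s = r1 \<or> s = r2 \<or> s = r3"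
    "nrm r0 \<le> nrm s" "nrm r1 \<le> nrm s" "nrm r2 \<le> nrm s" "nrm r3 \<le> nrm s"
  proof -
    obtain a where a: "a = r0 \<or> a = r1" "nrm r0 \<le> nrm a" "nrm r1 \<le> nrm a"
      using nrm_larger by blast
    obtain b where b: "b = r2 \<or> b = r3" "nrm r2 \<le> nrm b" "nrm r3 \<le> nrm b"
      using nrm_larger by blast
    obtain m where m: "m = a \<or> m = b" "nrm a \<le> nrm m" "nrm b \<le> nrm m"
      using nrm_larger by blast
    show thesis
    proof (rule that)
      show "m = r0 \<or> m = r1 \<or> m = r2 \<or> m = r3"
        using a b m by blast
    qed (use a b m in linarith)+
  qed
  show ?thesis
  \<comment> \<open>No scale exists only if all four coefficients vanish; then P and Q have the
    common zero 0.\<close>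
  proof (cases "s = 0")
    case True
    then have "nrm r0 \<le> 0" "nrm r1 \<le> 0" "nrm r2 \<le> 0" "nrm r3 \<le> 0"
      using s by simp_all
    then have "r0 = 0" "r1 = 0" "r2 = 0" "r3 = 0"
      by (meson nrm_pos_iff not_le)+
    then have z: "P0 f = 0" "Q0 f - P1 f = 0" "3 * Q0 f + P1 f = 0"
      using r0 r1 r3 H0 by auto
    have "4 * Q0 f = (3 * Q0 f + P1 f) + (Q0 f - P1 f)"
      by (simp add: algebra_simps)
    then have "Q0 f = 0"
      unfolding z by simp
    then have "\<not> nondeg f"
      using nondegD(2)[of f] z by auto
    then show ?thesis
      by (simp add: alternative_def)
  next
    case False
    then have s0: "0 < nrm s"
      by (simp add: nrm_pos_iff)
    define k where "k = inverse (H * s)"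
    define g where "g = smul k (rescale s f)"
    have k: "k \<noteq> 0"
      using H0 False by (simp add: k_def)
    have c: "P0 g = r0 ^ 3 / s ^ 3" "Q0 g - P1 g = r1\<^sup>2 / s\<^sup>2" "Q1 g - P2 g = r2 / s"
      "3 * Q0 g + P1 g = r3\<^sup>2 / s\<^sup>2" "Q2 g - P3 g = (Q2 f - P3 f) / H" "Q3 g = Q3 f / H * s"
      "P2 g + Q1 g = (P2 f + Q1 f) / (H * s)" "3 * P3 g + Q2 g = (3 * P3 f + Q2 f) / H"
      unfolding r0 r1 r3 r2_def using H0 False
      by (simp_all add: g_def k_def divide_simps power2_eq_square power3_eq_cube)
    have le1: "nrm (r ^ n / s ^ n) \<le> 1" if "nrm r \<le> nrm s" for r n
      using power_mono[OF that nrm_nonneg, of n] s0 by (simp add: nrm_divide nrm_power)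
    have "semistable g"
    proof (rule semistable_normal_form)
      show "P2 g + Q1 g = 0" "3 * P3 g + Q2 g = 1"
        unfolding c using H1 H0 by (simp_all add: H_def)
      show "nrm (P0 g) \<le> 1" "nrm (Q0 g - P1 g) \<le> 1" "nrm (Q1 g - P2 g) \<le> 1" "nrm (3 * Q0 g + P1 g) \<le> 1"
        unfolding c using le1[OF s(2)] le1[OF s(3)] le1[OF s(4), of 1] le1[OF s(5)] by simp_all
      show "nrm (Q2 g - P3 g) < 1"
        unfolding c using F3 H0 by (simp add: nrm_divide H_def)
      show "nrm (P0 g) = 1 \<or> nrm (Q0 g - P1 g) = 1 \<or> nrm (Q1 g - P2 g) = 1 \<or> nrm (3 * Q0 g + P1 g) = 1"
        unfolding c using s(1) False by auto
      show "nrm (Q3 g) < 1"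
      proof (cases "Q3 f = 0")
        case False
        then have small: "nrm (Q3 f) < nrm H" "nrm (P0 f) \<le> nrm H" "nrm (Q0 f - P1 f) \<le> nrm H"
          "nrm (Q1 f - P2 f) \<le> nrm H" "nrm (3 * Q0 f + P1 f) \<le> nrm H"
          using F4 by (simp_all add: H_def)
        have "nrm (r0 ^ 3) \<le> 1" "nrm (r1\<^sup>2) \<le> 1" "nrm r2 \<le> 1" "nrm (r3\<^sup>2) \<le> 1"
          unfolding r0 r1 r3 r2_def using small H0 by (simp_all add: nrm_divide)
        moreover have "nrm r \<le> 1" if "nrm (r ^ n) \<le> 1" "0 < n" for r n
        proof (rule ccontr)
          assume "\<not> ?thesis"
          then have "1 < nrm r ^ n"
            using that(2) by (intro one_less_power) auto
          then show False
            using that(1) by (simp add: nrm_power)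
        qed
        ultimately have "nrm s \<le> 1"
          using s(1) by (metis zero_less_numeral)
        moreover have "nrm (Q3 f / H) < 1"
          using small(1) H0 by (simp add: nrm_divide)
        ultimately show ?thesis
          unfolding c by (intro nrm_mult_less1)
      qed (simp add: c)
    qed
    then have "alternative g"
      by (rule alternative_semistable)
    then show ?thesis
      unfolding g_def by (rule alternative_rescale[OF False alternative_smul[OF k]])
  qed
qed

text \<open>\<open>b\<close> is the midpoint of the two roots of \<open>h\<close>; translating it to
  0 removes the middle coefficient.\<close>

lemma centre_translation:
  assumes "3 * P3 f + Q2 f \<noteq> 0" and b: "b = - ((P2 f + Q1 f) / (3 * P3 f + Q2 f))"
  shows "P2 (translate b f) + Q1 (translate b f) = 0"
    "3 * P3 (translate b f) + Q2 (translate b f) = 3 * P3 f + Q2 f"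
    "Q2 (translate b f) - P3 (translate b f) = Q2 f - P3 f + 4 * b * Q3 f"
    "Q3 (translate b f) = Q3 f"
proof -
  have "P2 (translate b f) + Q1 (translate b f) = (P2 f + Q1 f) + b * (3 * P3 f + Q2 f)"
    by (simp add: algebra_simps power2_eq_square)
  also have "\<dots> = 0"
    unfolding b using assms(1) by simp
  finally show "P2 (translate b f) + Q1 (translate b f) = 0" .
qed (simp_all add: algebra_simps)

text \<open>All of \<open>F\<close> is small here, while the leading coefficient of \<open>h\<close>
  differs from \<open>4 * P3 f\<close> by a small term and is a unit. The centre of \<open>h\<close>
  then lies in the open unit disc, and recentring there keeps the model integral.\<close>

lemma alternative_destabilized:
  assumes int: "integral f" and d: "destabilized f" and less: "nrm (Q2 f - P3 f) < 1" "nrm (Q3 f) < 1"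
    and unit: "nrm (P3 f) = 1 \<or> nrm (Q2 f) = 1"
  shows "alternative f"
proof -
  have P3: "nrm (P3 f) = 1"
    using unit nrm_diff_eq2[of "Q2 f - P3 f" "Q2 f"] less(1) by auto
  have "nrm (4 * P3 f + (Q2 f - P3 f)) = 1"
    using P3 less by (subst nrm_add_eq2) (simp_all add: nrm_mult)
  moreover have "4 * P3 f + (Q2 f - P3 f) = 3 * P3 f + Q2 f"
    by (simp add: algebra_simps)
  ultimately have H: "nrm (3 * P3 f + Q2 f) = 1"
    by simp
  then have H0: "3 * P3 f + Q2 f \<noteq> 0"
    by auto
  define b where "b = - ((P2 f + Q1 f) / (3 * P3 f + Q2 f))"
  have b: "nrm b < 1"
    using d H unfolding b_def destabilized_def by (simp add: nrm_divide nrm_add_lessI)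
  note t = centre_translation[OF H0 b_def]
  have i: "integral (translate b f)"
    using int b by (intro integral_translate) auto
  have "nrm (4 * b * Q3 f) < 1"
    using b less by (intro nrm_mult_less1') (auto simp: nrm_mult)
  then have "nrm (Q2 (translate b f) - P3 (translate b f)) < 1"
    unfolding t using less by (intro nrm_add_lessI) auto
  then have "alternative (translate b f)"
    using i t H0 H less unfolding integral_def
    by (intro alternative_centred disjI2)
      (auto simp del: translate_simps intro!: nrm_diff_leI nrm_add_leI simp: t nrm_mult)
  then show ?thesis
    by (rule alternative_translate)
qed

section \<open>Coordinates chosen from the fixed points\<close>

text \<open>
  The fixed points are \<open>0\<close>, \<open>\<infinity>\<close> and, in the first case, \<open>1\<close>; or, in the second case, both \<open>0\<close> and
  \<open>\<infinity>\<close> are double fixed points. No direction contains three of them unless all of \<open>F\<close> is small.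
\<close>

lemma alternative_normalized_fixed_points:
  assumes fix0: "P0 f = 0" and fix_inf: "Q3 f = 0"
    and F: "(Q0 f - P1 f) + (Q1 f - P2 f) + (Q2 f - P3 f) = 0 \<or> Q0 f - P1 f = 0 \<and> Q2 f - P3 f = 0"
    and int: "integral f"
    and unit: "nrm (P1 f) = 1 \<or> nrm (P2 f) = 1 \<or> nrm (P3 f) = 1 \<or> nrm (Q0 f) = 1 \<or> nrm (Q1 f) = 1 \<or> nrm (Q2 f) = 1"
  shows "alternative f"
proof (cases "semistable f")
  case True
  then show ?thesis
    by (rule alternative_semistable)
next
  case False
  then consider c where "nrm c \<le> 1" "destabilized (translate c f)" | "destabilized (invert f)"
    using int unfolding semistable_def by blast
  then show ?thesis
  proof cases
    case 1
    define F1 F2 F3 where "F1 = Q0 f - P1 f" and "F2 = Q1 f - P2 f" and "F3 = Q2 f - P3 f"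
    let ?g = "translate c f"
    have d: "nrm (- P0 ?g) < 1" "nrm (Q0 ?g - P1 ?g) < 1" "nrm (Q1 ?g - P2 ?g) < 1"
      using 1(2) unfolding destabilized_def by (auto intro!: nrm_diff_lessI simp del: translate_simps)
    have d2: "Q1 ?g - P2 ?g = F2 + 3 * F3 * c"
      by (simp add: fix_inf F2_def F3_def algebra_simps)
    have d1: "Q0 ?g - P1 ?g = F1 + 2 * F2 * c + 3 * F3 * c\<^sup>2"
      by (simp add: fix_inf F1_def F2_def F3_def expand_simps)
    have d0: "- P0 ?g = c * (F1 + F2 * c + F3 * c\<^sup>2)"
      by (simp add: fix0 fix_inf F1_def F2_def F3_def expand_simps)
    have F3: "nrm F3 < 1"
      using F
    proof
      assume sum: "Q0 f - P1 f + (Q1 f - P2 f) + (Q2 f - P3 f) = 0"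
      define e where "e = F2 + 3 * F3 * c"
      have e: "nrm e < 1"
        using d(3) d2 by (simp add: e_def)
      have F21: "F2 = e - 3 * F3 * c" "F1 = - (e - 3 * F3 * c) - F3"
        using sum by (simp_all add: e_def F1_def F2_def F3_def algebra_simps)
      \<comment> \<open>With \<open>F1\<close> and \<open>F2\<close> eliminated, a triple zero of
        the reduced quartic at \<open>c\<close> makes \<open>F3 * A\<close> and
        \<open>F3 * B\<close> small. Since A^2 = s^2 (1 + 4 s) and B = - (1 + 3 s), the two are
        coprime as polynomials in \<open>c\<close>, and the identity with 27 below is the Bezout
        relation. Hence \<open>F3\<close> is small.\<close>
      define A B s where "A = c * (c - 1) * (1 - 2 * c)" and "B = 3 * c - 1 - 3 * c\<^sup>2" and "s = c\<^sup>2 - c"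
      have "(Q0 ?g - P1 ?g) - (2 * c - 1) * e = F3 * B"
        unfolding d1 F21 B_def by (simp add: algebra_simps power2_eq_square)
      moreover have "nrm ((Q0 ?g - P1 ?g) - (2 * c - 1) * e) < 1"
        using d(2) e 1(1) by (intro nrm_diff_lessI[OF d(2)] nrm_mult_less1' nrm_diff_leI) (auto simp: nrm_mult)
      ultimately have FB: "nrm (F3 * B) < 1"
        by metis
      have "- P0 ?g - c * (c - 1) * e = F3 * A"
        unfolding d0 F21 A_def by (simp add: expand_simps)
      moreover have "nrm (- P0 ?g - c * (c - 1) * e) < 1"
        using d(1) e 1(1) by (intro nrm_diff_lessI[OF d(1)] nrm_mult_less1' nrm_diff_leI nrm_mult_le1) auto
      ultimately have FA: "nrm (F3 * A) < 1"
        by metis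
      have c1: "nrm c \<le> 1" "nrm A \<le> 1" "nrm s \<le> 1"
        using 1(1) by (auto simp: A_def s_def intro!: nrm_mult_le1 nrm_diff_leI nrm_power_le1)
      have "27 * A * A + B * (36 * s * s - 3 * s + 1) = - 1"
        unfolding A_def B_def s_def by (simp add: algebra_simps power2_eq_square)
      moreover have "27 * A * (F3 * A) + (36 * s * s - 3 * s + 1) * (F3 * B)
          = F3 * (27 * A * A + B * (36 * s * s - 3 * s + 1))"
        by (simp only: algebra_simps)
      ultimately have "F3 = - (27 * A * (F3 * A) + (36 * s * s - 3 * s + 1) * (F3 * B))"
        by simp
      moreover have "nrm (27 * A * (F3 * A) + (36 * s * s - 3 * s + 1) * (F3 * B)) < 1"
        by (rule nrm_add_lessI[OF nrm_mult_less1'[OF _ FA] nrm_mult_less1'[OF _ FB]])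
          (use c1 in \<open>auto intro!: nrm_add_leI nrm_diff_leI nrm_mult_le1\<close>)
      ultimately show "nrm F3 < 1"
        by (metis nrm_uminus)
    qed (simp add: F3_def)
    have ig: "integral ?g"
      by (rule integral_translate[OF int 1(1)])
    have F3g: "Q2 ?g - P3 ?g = F3" "Q3 ?g = 0"
      by (simp_all add: F3_def fix_inf)
    have "nrm (P3 ?g) = 1 \<or> nrm (Q2 ?g) = 1"
    proof (rule ccontr)
      assume "\<not> ?thesis"
      then have s: "nrm (P3 f) < 1" "nrm (Q2 f) < 1"
        using int by (auto simp: integral_def fix_inf)
      have q: "nrm (P2 f + (3 * P3 f * c - c * Q2 f)) < 1" "nrm (Q1 f + 2 * Q2 f * c) < 1"
        using 1(2) by (simp_all add: destabilized_def fix_inf algebra_simps)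
      have "nrm (3 * P3 f * c) < 1" "nrm (c * Q2 f) < 1" "nrm (2 * Q2 f * c) < 1"
        using s 1(1) nrm_mult_less1[of "3 * P3 f" c] nrm_mult_less1'[of c "Q2 f"] nrm_mult_less1[of "2 * Q2 f" c]
        by (simp_all add: nrm_mult)
      then have "nrm (3 * P3 f * c - c * Q2 f) < 1" "nrm (2 * Q2 f * c) < 1"
        by (simp_all only: nrm_diff_lessI)
      with q have s': "nrm (P2 f) < 1" "nrm (Q1 f) < 1"
        by (metis nrm_diff_lessI add_diff_cancel_right')+
      have "nrm (Q0 f + (Q1 f * c + Q2 f * c\<^sup>2)) < 1"
        using 1(2) by (simp add: destabilized_def fix_inf algebra_simps)
      moreover have "nrm (Q1 f * c + Q2 f * c\<^sup>2) < 1"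
        using s s' 1(1) by (auto intro!: nrm_add_lessI nrm_mult_less1 nrm_power_le1)
      ultimately have Q0: "nrm (Q0 f) < 1"
        by (metis nrm_diff_lessI add_diff_cancel_right')
      have "nrm (P1 f + (2 * P2 f * c + 3 * P3 f * c\<^sup>2 - c * (Q1 f + 2 * Q2 f * c))) < 1"
        using 1(2) by (simp add: destabilized_def fix_inf algebra_simps)
      moreover have "nrm (2 * P2 f * c + 3 * P3 f * c\<^sup>2 - c * (Q1 f + 2 * Q2 f * c)) < 1"
      proof -
        have "nrm (2 * P2 f * c) < 1"
          by (rule nrm_mult_less1[OF _ 1(1)]) (use s' in \<open>simp add: nrm_mult\<close>)
        moreover have "nrm (3 * P3 f * c\<^sup>2) < 1"
          by (rule nrm_mult_less1[OF _ nrm_power_le1[OF 1(1)]]) (use s in \<open>simp add: nrm_mult\<close>)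
        moreover have "nrm (c * (Q1 f + 2 * Q2 f * c)) < 1"
          by (rule nrm_mult_less1'[OF 1(1) q(2)])
        ultimately show ?thesis
          by (simp only: nrm_diff_lessI nrm_add_lessI)
      qed
      ultimately have "nrm (P1 f) < 1"
        by (metis nrm_diff_lessI add_diff_cancel_right')
      then show False
        using unit s s' Q0 by auto
    qed
    then have "alternative ?g"
      using 1(2) ig F3 F3g by (intro alternative_destabilized) (simp_all del: translate_simps)
    then show ?thesis
      by (rule alternative_translate)
  next
    case 2
    have i: "integral (invert f)"
      using int by (auto simp: integral_def)
    have F23: "nrm (Q1 f - P2 f) < 1" "nrm (Q2 f - P3 f) < 1"
      using 2 by (auto simp: destabilized_def intro!: nrm_diff_lessI)
    have "nrm (P1 f - Q0 f) < 1"
      using F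
    proof
      assume "Q0 f - P1 f + (Q1 f - P2 f) + (Q2 f - P3 f) = 0"
      then have "P1 f - Q0 f = (Q1 f - P2 f) + (Q2 f - P3 f)"
        by (simp add: algebra_simps)
      then show ?thesis
        using F23 by (simp only: nrm_add_lessI)
    qed simp
    then have "alternative (invert f)"
      using 2 i unit by (intro alternative_destabilized) (auto simp: fix0 destabilized_def)
    then show ?thesis
      by (rule alternative_invert)
  qed
qed

lemma alternative_fixed_points:
  assumes fix0: "P0 f = 0" and fix_inf: "Q3 f = 0"
    and F: "(Q0 f - P1 f) + (Q1 f - P2 f) + (Q2 f - P3 f) = 0 \<or> Q0 f - P1 f = 0 \<and> Q2 f - P3 f = 0"
  shows "alternative f"
proof (cases "nondeg f")
  case True
  define S where "S = {P1 f, P2 f, P3 f, Q0 f, Q1 f, Q2 f}"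
  have fin: "finite (nrm ` S)" "nrm ` S \<noteq> {}"
    by (auto simp: S_def)
  obtain k where k: "k \<in> S" "Max (nrm ` S) = nrm k"
    using Max_in[OF fin] by auto
  have le: "nrm x \<le> nrm k" if "x \<in> S" for x
    using Max_ge[OF fin(1)] that k by auto
  have "k \<noteq> 0"
  proof
    assume "k = 0"
    then have "P3 f = 0"
      using le[of "P3 f"] nrm_nonneg[of "P3 f"] nrm_eq_0_iff by (simp add: S_def)
    then show False
      using nondegD(1)[OF True] fix_inf by simp
  qed
  then have pos: "0 < nrm k"
    by (simp add: nrm_pos_iff)
  let ?g = "smul (inverse k) f"
  have le1: "nrm (inverse k * x) \<le> 1" if "x \<in> S" for x
    using le[OF that] pos by (simp add: nrm_divide field_simps)
  have "alternative ?g"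
  proof (rule alternative_normalized_fixed_points)
    have "inverse k * (x - y) + inverse k * (x' - y') + inverse k * (x'' - y'')
        = inverse k * ((x - y) + (x' - y') + (x'' - y''))" for x y x' y' x'' y''
      by (simp only: distrib_left)
    then show "(Q0 ?g - P1 ?g) + (Q1 ?g - P2 ?g) + (Q2 ?g - P3 ?g) = 0
        \<or> Q0 ?g - P1 ?g = 0 \<and> Q2 ?g - P3 ?g = 0"
      using F by (auto simp flip: right_diff_distrib)
    show "integral ?g"
      using le1 by (simp add: integral_def fix0 fix_inf S_def)
    have "nrm (inverse k * k) = 1"
      using \<open>k \<noteq> 0\<close> by simp
    then show "nrm (P1 ?g) = 1 \<or> nrm (P2 ?g) = 1 \<or> nrm (P3 ?g) = 1 \<or> nrm (Q0 ?g) = 1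
        \<or> nrm (Q1 ?g) = 1 \<or> nrm (Q2 ?g) = 1"
      using k(1) by (auto simp: S_def)
  qed (simp_all add: fix0 fix_inf)
  then show ?thesis
    using alternative_smul[of "inverse k" f] \<open>k \<noteq> 0\<close> by simp
qed (simp add: alternative_def)

text \<open>Infinity is at least a triple fixed point, so fixed points give no coordinate. The
  leading coefficient of \<open>h\<close> is then \<open>4 * P3 f\<close>, and \<open>h\<close> can
  be centred directly.\<close>

lemma alternative_triple_fixed_point:
  assumes "Q1 f = P2 f" "Q2 f = P3 f" "Q3 f = 0"
  shows "alternative f"
proof (cases "P3 f = 0")
  case True
  then show ?thesis
    using nondegD(1)[of f] assms by (auto simp: alternative_def)
next
  case False
  have "3 * P3 f + Q2 f = 4 * P3 f"
    by (simp add: assms)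
  then have H: "3 * P3 f + Q2 f \<noteq> 0"
    using False by simp
  define b where "b = - ((P2 f + Q1 f) / (3 * P3 f + Q2 f))"
  note t = centre_translation[OF H b_def]
  have "alternative (translate b f)"
    by (rule alternative_centred) (use H assms in \<open>simp_all add: t nrm_pos_iff del: translate_simps\<close>)
  then show ?thesis
    by (rule alternative_translate)
qed

lemma translate_fixed_point:
  assumes "poly [:- P0 f, Q0 f - P1 f, Q1 f - P2 f, Q2 f - P3 f, Q3 f:] c = 0"
  shows "P0 (translate c f) = 0"
proof -
  have "P0 (translate c f) = - poly [:- P0 f, Q0 f - P1 f, Q1 f - P2 f, Q2 f - P3 f, Q3 f:] c"
    by (simp add: expand_simps)
  then show ?thesis
    unfolding assms by simp
qed

text \<open>With fixed points at 0 and infinity, a third one can be scaled to 1. The exceptions are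
  a triple fixed point, treated through \<open>h\<close>, and double fixed points at both 0 and
  infinity.\<close>

lemma alternative_fixed_infinity:
  assumes inf: "Q3 f = 0"
  shows "alternative f"
proof (cases "Q2 f = P3 f \<and> Q1 f = P2 f")
  case True
  then show ?thesis
    using inf by (intro alternative_triple_fixed_point) auto
next
  case False
  let ?F = "[:- P0 f, Q0 f - P1 f, Q1 f - P2 f, Q2 f - P3 f, Q3 f:]"
  have "0 < Polynomial.degree ?F"
    using False by auto
  then obtain c where "poly ?F c = 0"
    using poly_root by blast
  then have c: "P0 (translate c f) = 0"
    by (rule translate_fixed_point)
  define g where "g = translate c f"
  have g: "P0 g = 0" "Q3 g = 0" "Q2 g - P3 g = Q2 f - P3 f"
    using c inf by (simp_all add: g_def)
  have F2: "Q1 g - P2 g = Q1 f - P2 f" if "Q2 f = P3 f"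
    using inf that by (simp add: g_def algebra_simps)
  have "alternative g"
  proof (cases "Q1 g = P2 g \<and> Q0 g = P1 g")
    case True
    then have "alternative (invert g)"
      using g by (intro alternative_triple_fixed_point) auto
    then show ?thesis
      by (rule alternative_invert)
  next
    case False': False
    let ?G = "[:Q0 g - P1 g, Q1 g - P2 g, Q2 g - P3 g:]"
    show ?thesis
    proof (cases "Q0 g - P1 g = 0 \<and> Q2 g - P3 g = 0")
      case True
      then show ?thesis
        using g by (intro alternative_fixed_points) auto
    next
      case F13: False
      have nz: "Q2 g - P3 g \<noteq> 0 \<or> Q1 g - P2 g \<noteq> 0"
        using False g(3) F2 by auto
      \<comment> \<open>If 0 is a double fixed point, the remaining finite one is explicit and
        nonzero; otherwise 0 is not a root of \<open>?G\<close> and any root will do.\<close>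
      have "\<exists>s. s \<noteq> 0 \<and> poly ?G s = 0"
      proof (cases "Q0 g - P1 g = 0")
        case True
        then have "Q2 g - P3 g \<noteq> 0" "Q1 g - P2 g \<noteq> 0"
          using F13 False' by auto
        then show ?thesis
          using True by (intro exI[of _ "- ((Q1 g - P2 g) / (Q2 g - P3 g))"]) (simp add: field_simps)
      next
        case False
        have "0 < Polynomial.degree ?G"
          using nz by auto
        then obtain s where "poly ?G s = 0"
          using poly_root by blast
        moreover from this False have "s \<noteq> 0"
          by auto
        ultimately show ?thesis
          by blast
      qed
      then obtain s where s: "s \<noteq> 0" "poly ?G s = 0"
        by blast
      have "(Q0 (rescale s g) - P1 (rescale s g)) + (Q1 (rescale s g) - P2 (rescale s g))
          + (Q2 (rescale s g) - P3 (rescale s g)) = poly ?G s / s"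
        using s(1) by (simp add: divide_simps) (simp add: algebra_simps)
      then have "alternative (rescale s g)"
        using s g by (intro alternative_fixed_points disjI1) simp_all
      then show ?thesis
        by (rule alternative_rescale[OF s(1)])
    qed
  qed
  then show ?thesis
    unfolding g_def by (rule alternative_translate)
qed

lemma alternative_all: "alternative f"
proof (cases "Q3 f = 0")
  case True
  then show ?thesis
    by (rule alternative_fixed_infinity)
next
  case False
  let ?F = "[:- P0 f, Q0 f - P1 f, Q1 f - P2 f, Q2 f - P3 f, Q3 f:]"
  have "0 < Polynomial.degree ?F"
    using False by simp
  then obtain c where "poly ?F c = 0"
    using poly_root by blast
  then have "P0 (translate c f) = 0"
    by (rule translate_fixed_point)
  then have "alternative (invert (translate c f))"
    by (intro alternative_fixed_infinity) simp
  then show ?thesis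
    using alternative_invert alternative_translate by blast
qed

section \<open>Passage from Laurent series to the completed algebraic closure\<close>

text \<open>
  A nonzero polynomial of least degree vanishing at a common zero divides both polynomials.
\<close>

lemma coprime_no_common_root:
  fixes p q :: "'b::field poly" and h :: "'b \<Rightarrow> 'c::field"
  assumes h: "h 0 = 0" "h 1 = 1" "\<And>x y. h (x + y) = h x + h y" "\<And>x y. h (x * y) = h x * h y"
    and cop: "coprime p q" and z: "poly (map_poly h p) z = 0" "poly (map_poly h q) z = 0"
  shows False
proof -
  let ?e = "\<lambda>r. poly (map_poly h r) z"
  have add: "?e (r + s) = ?e r + ?e s" and mult: "?e (r * s) = ?e r * ?e s" for r s
    using map_poly_add_hom[of h r s] map_poly_mult_hom[of h r s] h by simp_all
  have h0: "h x \<noteq> 0" if "x \<noteq> 0" for x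
  proof
    assume "h x = 0"
    then have "h (x * inverse x) = 0"
      by (simp only: h(4) mult_zero_left)
    then show False
      using that h(2) by simp
  qed
  have "p \<noteq> 0 \<or> q \<noteq> 0"
    using cop by auto
  then have "\<exists>r. r \<noteq> 0 \<and> ?e r = 0"
    using z by blast
  then obtain d where d: "d \<noteq> 0" "?e d = 0"
    and least: "\<And>r. r \<noteq> 0 \<and> ?e r = 0 \<Longrightarrow> Polynomial.degree d \<le> Polynomial.degree r"
    using ex_has_least_nat[of "\<lambda>r. r \<noteq> 0 \<and> ?e r = 0" _ Polynomial.degree] by blast
  have dvd: "d dvd r" if "?e r = 0" for r
  proof -
    have "?e r = ?e (r div d) * ?e d + ?e (r mod d)"
      by (simp flip: add mult)
    then have "?e (r mod d) = 0"
      using that d(2) by simp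
    then have "r mod d = 0"
      using least[of "r mod d"] degree_mod_less[OF d(1), of r] by fastforce
    then show ?thesis
      by auto
  qed
  have "is_unit d"
    using cop dvd[OF z(1)] dvd[OF z(2)] by (meson coprime_def)
  then obtain a where "d = [:a:]" "a \<noteq> 0"
    using d(1) by (metis is_unit_iff_degree degree_eq_zeroE pCons_0_0)
  then show False
    using d(2) h0[of a] by (simp add: map_poly_pCons h(1))
qed

lemma base_change_cubic:
  assumes f: "rational_map 3 f"
  shows "\<exists>g. nondeg g \<and> (num g, den g) = base_change emb f"
proof -
  let ?h = "\<lambda>a. emb (to_ac a)"
  let ?p = "map_poly ?h (fst f)" and ?q = "map_poly ?h (snd f)"
  have h: "?h 0 = 0" "?h 1 = 1" "\<And>x y. ?h (x + y) = ?h x + ?h y" "\<And>x y. ?h (x * y) = ?h x * ?h y"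
    by (simp_all add: emb_0 emb_1 emb_add emb_mult)
  define g where "g = Cubic (poly.coeff ?p 0) (poly.coeff ?p 1) (poly.coeff ?p 2) (poly.coeff ?p 3)
    (poly.coeff ?q 0) (poly.coeff ?q 1) (poly.coeff ?q 2) (poly.coeff ?q 3)"
  have d: "Polynomial.degree (fst f) \<le> 3" "Polynomial.degree (snd f) \<le> 3"
    "Polynomial.degree (fst f) = 3 \<or> Polynomial.degree (snd f) = 3"
    using f by (auto simp: rational_map_def rat_degree_def max_def split: if_splits)
  have expand: "r = [:poly.coeff r 0, poly.coeff r 1, poly.coeff r 2, poly.coeff r 3:]"
    if "Polynomial.degree r \<le> 3" for r :: "'a poly"
  proof (rule poly_eqI)
    fix i :: nat
    have "i = 0 \<or> i = 1 \<or> i = 2 \<or> i = 3 \<or> 3 < i"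
      by linarith
    then show "poly.coeff r i = poly.coeff [:poly.coeff r 0, poly.coeff r 1, poly.coeff r 2, poly.coeff r 3:] i"
      using that by (auto simp: coeff_pCons coeff_eq_0 numeral_2_eq_2 numeral_3_eq_3 split: nat.split)
  qed
  have pq: "num g = ?p" "den g = ?q"
    using expand[of ?p] expand[of ?q] d map_poly_degree_leq[of ?h "fst f"] map_poly_degree_leq[of ?h "snd f"]
    by (simp_all add: g_def num_def den_def h(1))
  have "nondeg g"
    unfolding nondeg_def
  proof (intro allI impI)
    fix x y
    assume z: "homP g x y = 0" "homQ g x y = 0"
    have y: "y = 0"
    proof (rule ccontr)
      assume "y \<noteq> 0"
      then have "poly ?p (x / y) = 0" "poly ?q (x / y) = 0"
        using z hom_quotient(1,2)[of y g x] pq by auto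
      then show False
        using coprime_no_common_root[OF h, of "fst f" "snd f"] f by (auto simp: rational_map_def)
    qed
    have "poly.coeff (fst f) 3 \<noteq> 0 \<or> poly.coeff (snd f) 3 \<noteq> 0"
      using d(3) by (metis leading_coeff_0_iff degree_0 zero_neq_numeral)
    then have "P3 g \<noteq> 0 \<or> Q3 g \<noteq> 0"
      by (auto simp: g_def coeff_map_poly h(1) emb_eq_0_iff)
    moreover have "P3 g * x ^ 3 = 0" "Q3 g * x ^ 3 = 0"
      using z y by (simp_all add: homP_def homQ_def)
    ultimately show "x = 0 \<and> y = 0"
      using y by auto
  qed
  then show ?thesis
    using pq by (auto simp: map_ratmap_def)
qed

end

theorem theorem3p2:
  fixes nrm :: "'a::field \<Rightarrow> real"
    and emb :: "complex fls alg_closure \<Rightarrow> 'a"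
    and f :: "complex fls ratmap"
  assumes "completed_alg_closure nrm emb"
    and "rational_map 3 f"
    and "\<not> potential_good_reduction nrm emb (base_change emb f)"
  shows "\<exists>n C. n \<le> 3 \<and> repelling_cycle nrm (base_change emb f) n C"
proof -
  interpret completed_alg_closure nrm emb
    by (rule assms(1))
  obtain g where g: "nondeg g" "(num g, den g) = base_change emb f"
    using base_change_cubic[OF assms(2)] by blast
  have "\<not> potentially_good g"
    using potentially_good_imp[OF _ nondeg_rat_degree[OF g(1)]] assms(3) g(2) by auto
  then have "repelling g"
    using alternative_all[of g] g(1) by (simp add: alternative_def)
  then show ?thesis
    using repelling_imp[OF g(1)] g(2) by simp
qed

end
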